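(* For every integer $s\geq 3$, the moduli space $\bar X_s=\mathcal{MRG}_{1,s}$ of holocolored one-loop graphs with remembered edges and $s$ legs satisfies $$H_{s-1}(\bar X_s;\mathbb{Z})\cong\mathbb{Z}^{\frac{(s-1)!}{2}}.$$
   Context: Graphs are finite multigraphs (self-loops and multiple edges allowed) with a set $E(G)$ of internal edges and $s$ external legs labeled bijectively by $1,\ldots,s$, each leg attached to a vertex. A one-loop admissible graph with $s$ legs is a cycle with $k$ vertices and $k$ internal edges, $1\leq k\leq s$ ($k=1$: one vertex with a self-loop; $k=2$: two vertices joined by a double edge), each vertex carrying at least one leg. The set of colors is $C=\{1,\ldots,s\}$; a holocoloring is an injective map $c:E(G)\to C$. In $\bar X_s$ the color of an edge is remembered when the edge is shrunk to length zero. Concretely: a weighted graph is a triple $(G,c,w)$ with $G$ one-loop admissible with $s$ legs, $c$ a holocoloring and $w$ assigning to each vertex $v$ a set $w(v)\subset C$ with $|w(v)|=(\text{number of legs at }v)-1$, such that the sets $w(v)$, over all vertices $v$, and $c(E(G))$ are pairwise disjoint with union $C$ (the set $w(v)$ records the colors of the edges which were collapsed to $v$). Isomorphisms of weighted graphs are graph isomorphisms preserving leg labels, edge colors and vertex weights. Collapsing a non-loop edge $e$ with end vertices $u\neq v$ merges $u$ and $v$ into one vertex with weight $w(u)\cup w(v)\cup\{c(e)\}$. For each isomorphism class of weighted graphs with $k$ edges take the closed simplex of dimension $k-1$ of all metrics $\lambda:E(G)\to\mathbb{R}_{\geq 0}$ with $\sum_e\lambda(e)=1$. $\bar X_s$ is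 the quotient space of the disjoint union of these simplices obtained by identifying a point whose metric vanishes on $Z\subsetneq E(G)$ with the corresponding point $\lambda|_{E(G)\setminus Z}$ in the simplex of the weighted graph obtained by collapsing all edges in $Z$, and by identifying points $(G,c,w,\lambda)$, $(G',c',w',\lambda')$ related by an isomorphism of weighted graphs carrying $\lambda$ to $\lambda'$. *)

theory Defs
  imports "HOL-Homology.Homology" "HOL-Library.Uprod"
begin

section \<open>Weighted one-loop graphs\<close>

text \<open>
  A multigraph with legs \<open>1, \<dots>, s\<close>: the ends of an edge form an unordered pair of vertices, so
  that self-loops (improper pairs) and multiple edges are allowed. The values of \<open>ends\<close>, \<open>col\<close>
  off the edges, of \<open>wt\<close> off the vertices and of \<open>leg\<close> off \<open>{1..s}\<close> carry no meaning, and nothing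
  below depends on them up to isomorphism.
\<close>

record ('v, 'e) legged_graph =
  verts :: "'v set"
  edges :: "'e set"
  ends :: "'e \<Rightarrow> 'v uprod"
  leg :: "nat \<Rightarrow> 'v"

record ('v, 'e) coloured_graph = "('v, 'e) legged_graph" +
  col :: "'e \<Rightarrow> nat"
  wt :: "'v \<Rightarrow> nat set"

definition legs_at :: "nat \<Rightarrow> ('v, 'e, 'x) legged_graph_scheme \<Rightarrow> 'v \<Rightarrow> nat set" where
  "legs_at s G v = {i \<in> {1..s}. leg G i = v}"

definition is_cycle :: "nat \<Rightarrow> ('v, 'e, 'x) legged_graph_scheme \<Rightarrow> bool" where
  "is_cycle k G \<longleftrightarrow>
     (\<exists>v e. bij_betw v {..<k} (verts G) \<and> bij_betw e {..<k} (edges G) \<and>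
            (\<forall>i<k. ends G (e i) = Upair (v i) (v ((i + 1) mod k))))"

definition one_loop_admissible :: "nat \<Rightarrow> ('v, 'e, 'x) legged_graph_scheme \<Rightarrow> bool" where
  "one_loop_admissible s G \<longleftrightarrow>
     (\<exists>k. 1 \<le> k \<and> k \<le> s \<and> is_cycle k G) \<and>
     (\<forall>i\<in>{1..s}. leg G i \<in> verts G) \<and>
     (\<forall>v\<in>verts G. legs_at s G v \<noteq> {})"

definition holocoloring :: "nat \<Rightarrow> ('v, 'e) coloured_graph \<Rightarrow> bool" where
  "holocoloring s G \<longleftrightarrow> inj_on (col G) (edges G) \<and> col G ` edges G \<subseteq> {1..s}"

definition weighted_graph :: "nat \<Rightarrow> ('v, 'e) coloured_graph \<Rightarrow> bool" where
  "weighted_graph s G \<longleftrightarrow>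
     one_loop_admissible s G \<and>
     holocoloring s G \<and>
     (\<forall>v\<in>verts G. wt G v \<subseteq> {1..s} \<and> card (wt G v) = card (legs_at s G v) - 1) \<and>
     disjoint_family_on (wt G) (verts G) \<and>
     (\<forall>v\<in>verts G. wt G v \<inter> col G ` edges G = {}) \<and>
     (\<Union>v\<in>verts G. wt G v) \<union> col G ` edges G = {1..s}"

definition weighted_iso ::
    "nat \<Rightarrow> ('v \<Rightarrow> 'w) \<Rightarrow> ('e \<Rightarrow> 'f) \<Rightarrow> ('v, 'e) coloured_graph \<Rightarrow> ('w, 'f) coloured_graph \<Rightarrow> bool" where
  "weighted_iso s f g G H \<longleftrightarrow>
     bij_betw f (verts G) (verts H) \<and>
     bij_betw g (edges G) (edges H) \<and>
     (\<forall>e\<in>edges G. ends H (g e) = map_uprod f (ends G e)) \<and>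
     (\<forall>i\<in>{1..s}. leg H i = f (leg G i)) \<and>
     (\<forall>e\<in>edges G. col H (g e) = col G e) \<and>
     (\<forall>v\<in>verts G. wt H (f v) = wt G v)"


section \<open>Collapsing edges\<close>

text \<open>
  The vertex resulting from the collapse of \<open>e\<close> is named by the smaller of the two ends of \<open>e\<close>;
  up to isomorphism the choice of name is irrelevant.
\<close>

definition collapse_edge :: "'e \<Rightarrow> ('v::linorder, 'e) coloured_graph \<Rightarrow> ('v, 'e) coloured_graph" where
  "collapse_edge e G =
     (let B = set_uprod (ends G e);
          m = Min B;
          q = (\<lambda>x. if x \<in> B then m else x)
      in \<lparr>verts = q ` verts G,
          edges = edges G - {e},
          ends = (\<lambda>d. map_uprod q (ends G d)),
          leg = (\<lambda>i. q (leg G i)),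
          col = col G,
          wt = (wt G)(m := (\<Union>v\<in>B. wt G v) \<union> {col G e})\<rparr>)"

text \<open>
  \<open>collapses G Z H\<close>: collapsing the edges in \<open>Z\<close> one after the other, in some order, each of them
  being a non-loop when its turn comes, turns \<open>G\<close> into \<open>H\<close>.
\<close>

inductive collapses ::
    "('v::linorder, 'e) coloured_graph \<Rightarrow> 'e set \<Rightarrow> ('v, 'e) coloured_graph \<Rightarrow> bool" where
  empty: "collapses G {} G"
| insert: "e \<in> edges G \<Longrightarrow> proper_uprod (ends G e) \<Longrightarrow> collapses (collapse_edge e G) Z H \<Longrightarrow>
             collapses G (insert e Z) H"


section \<open>Quotient spaces\<close>

definition quotient_topology :: "'a topology \<Rightarrow> ('a \<times> 'a) set \<Rightarrow> 'a set topology" where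
  "quotient_topology X R = topology (\<lambda>U. U \<subseteq> topspace X // R \<and> openin X (\<Union>U))"

lemma openin_quotient_topology:
  assumes "equiv (topspace X) R"
  shows "openin (quotient_topology X R) U \<longleftrightarrow> U \<subseteq> topspace X // R \<and> openin X (\<Union>U)"
proof -
  have Int: "\<Union>(S \<inter> T) = \<Union>S \<inter> \<Union>T" if "S \<subseteq> topspace X // R" "T \<subseteq> topspace X // R" for S T
    using that quotient_disj[OF assms] by blast
  have "istopology (\<lambda>U. U \<subseteq> topspace X // R \<and> openin X (\<Union>U))"
    unfolding istopology_def
  proof (intro conjI allI impI)
    fix S T
    assume "S \<subseteq> topspace X // R \<and> openin X (\<Union>S)" "T \<subseteq> topspace X // R \<and> openin X (\<Union>T)"
    then show "S \<inter> T \<subseteq> topspace X // R" "openin X (\<Union>(S \<inter> T))"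
      using Int[of S T] by auto
  next
    fix K
    assume K: "\<forall>S\<in>K. S \<subseteq> topspace X // R \<and> openin X (\<Union>S)"
    then show "\<Union>K \<subseteq> topspace X // R" by blast
    have "\<Union>(\<Union>K) = (\<Union>S\<in>K. \<Union>S)" by blast
    then show "openin X (\<Union>(\<Union>K))" using K by auto
  qed
  then show ?thesis
    unfolding quotient_topology_def by (simp add: topology_inverse')
qed

lemma topspace_quotient_topology:
  assumes "equiv (topspace X) R"
  shows "topspace (quotient_topology X R) = topspace X // R"
proof
  show "topspace (quotient_topology X R) \<subseteq> topspace X // R"
    using openin_quotient_topology[OF assms] openin_topspace by blast
  have "openin (quotient_topology X R) (topspace X // R)"
    by (simp add: openin_quotient_topology[OF assms] Union_quotient[OF assms])
  then show "topspace X // R \<subseteq> topspace (quotient_topology X R)"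
    by (rule openin_subset)
qed

lemma quotient_map_quotient_topology:
  assumes "equiv (topspace X) R"
  shows "quotient_map X (quotient_topology X R) (\<lambda>x. R `` {x})"
proof -
  have "{x \<in> topspace X. R `` {x} \<in> U} = \<Union>U" if "U \<subseteq> topspace X // R" for U
  proof
    show "{x \<in> topspace X. R `` {x} \<in> U} \<subseteq> \<Union>U"
      using equiv_class_self[OF assms] by blast
    show "\<Union>U \<subseteq> {x \<in> topspace X. R `` {x} \<in> U}"
    proof
      fix x assume "x \<in> \<Union>U"
      then obtain A where A: "A \<in> U" "x \<in> A" by blast
      then have "A \<in> topspace X // R" using that by blast
      then obtain y where y: "y \<in> topspace X" "A = R `` {y}" by (rule quotientE)
      then have "(y, x) \<in> R" using A by blast
      then have "R `` {x} = A" "x \<in> topspace X"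
        using y equiv_class_eq[OF assms] equiv_type[OF assms] by auto
      then show "x \<in> {x \<in> topspace X. R `` {x} \<in> U}" using A by simp
    qed
  qed
  then show ?thesis
    unfolding quotient_map_def
    by (auto simp: topspace_quotient_topology[OF assms] openin_quotient_topology[OF assms]
        quotient_def)
qed


section \<open>The moduli space\<close>

definition metric_simplex :: "('v, 'e) coloured_graph \<Rightarrow> ('e \<Rightarrow> real) topology" where
  "metric_simplex G =
     subtopology (powertop_real (edges G)) {l. (\<forall>e\<in>edges G. 0 \<le> l e) \<and> (\<Sum>e\<in>edges G. l e) = 1}"

text \<open>
  Every one-loop graph is isomorphic to one whose vertices and edges are natural numbers. Instead
  of one simplex per isomorphism class we take one simplex for every such weighted graph; the
  surplus copies are identified with each other by the isomorphisms in \<open>glue\<close>, which gives the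
  same quotient.
\<close>

type_synonym metric_graph = "(nat, nat) coloured_graph \<times> (nat \<Rightarrow> real)"

definition simplices :: "nat \<Rightarrow> metric_graph topology" where
  "simplices s = sum_topology metric_simplex {G. weighted_graph s G}"

inductive glue :: "nat \<Rightarrow> metric_graph \<Rightarrow> metric_graph \<Rightarrow> bool" for s where
  iso: "(G, l) \<in> topspace (simplices s) \<Longrightarrow> (H, m) \<in> topspace (simplices s) \<Longrightarrow>
          weighted_iso s f g G H \<Longrightarrow> (\<forall>e\<in>edges G. m (g e) = l e) \<Longrightarrow>
          glue s (G, l) (H, m)"
| face: "(G, l) \<in> topspace (simplices s) \<Longrightarrow> Z \<subset> edges G \<Longrightarrow> (\<forall>e\<in>Z. l e = 0) \<Longrightarrow>
          collapses G Z H \<Longrightarrow>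
          glue s (G, l) (H, restrict l (edges G - Z))"

definition glue_rel :: "nat \<Rightarrow> (metric_graph \<times> metric_graph) set" where
  "glue_rel s =
     {(x, y). x \<in> topspace (simplices s) \<and> y \<in> topspace (simplices s) \<and> equivclp (glue s) x y}"

lemma equiv_glue_rel: "equiv (topspace (simplices s)) (glue_rel s)"
  by (rule equivI)
    (auto simp: glue_rel_def refl_on_def intro!: symI transI intro: equivclp_sym equivclp_trans)

definition moduli_space :: "nat \<Rightarrow> metric_graph set topology" where
  "moduli_space s = quotient_topology (simplices s) (glue_rel s)"

end

theory Submission
  imports Defs "HOL-Analysis.Abstract_Topological_Spaces" "HOL-Combinatorics.Permutations"
begin

text \<open>
  Recording the length of each colour maps the space to a simplex. Over this simplex the space is
  \<open>\<Delta> \<times> T\<close> modulo \<open>(x, t) \<sim> (x, t')\<close> iff \<open>t\<close> and \<open>t'\<close> have the same label \<open>\<kappa> (supp x)\<close>, where \<open>T\<close> is the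
  set of maximal graphs and \<open>\<kappa> F t\<close> is what remains of \<open>t\<close> after collapsing all colours outside \<open>F\<close>.

  For every such glued space the top homology is the group of simplicial cycles, the integer
  functions on \<open>T\<close> that sum to zero over each class of the labels \<open>\<kappa> ({..p} - {k})\<close>. This goes by
  induction on \<open>p\<close>: the pair of the space and its last face \<open>{x. x p = 0}\<close> has the same relative
  homology as the pair obtained by replacing \<open>\<kappa> F\<close> by \<open>\<kappa> (insert p F)\<close>, which is a disjoint union of
  cones over its last face.

  A maximal graph is a cyclic arrangement of colours and legs. Exactly two of them agree after the
  collapse of a given edge; they differ by the exchange of the legs at its ends. So a cycle is
  determined by its value at one arrangement of the legs for each of the \<open>(s - 1)! / 2\<close> cyclic orders
  of the colours, and it alternates in the legs.
\<close>

section \<open>Gluing simplices\<close>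

text \<open>Away from the last face only labels of sets containing \<open>p\<close> occur. Replacing
  \<open>\<kappa> F\<close> by \<open>\<kappa> (insert p F)\<close> therefore undoes just the extra
  identifications on that face, and excision hides these from the homology of the pair. Call the new
  pair \<open>(X', Y')\<close> and the old one \<open>(X, Y)\<close>. As \<open>X'\<close> consists
  of cones, the boundary map embeds its relative homology in positive degrees into the homology of
  \<open>Y'\<close>, a glued space of one dimension less with other labels; so the induction ranges
  over all labelings. A relative class of \<open>(X', Y')\<close> comes from an absolute class of
  \<open>X\<close> iff its boundary dies in \<open>Y\<close>. To read this off as a balance
  condition at the last face, the induction also carries a detection statement: if a chain of top
  simplices bounds, its sums over equal full labels vanish.

  Coordinates are indexed by colour, so neighbouring maximal simplices meet with equal orientation
  and their coefficients in a cycle add to zero. The exchanges of legs around the circle, including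
  the one that closes it, are transpositions of distinct positions and hence odd; so the sign of the
  leg permutation is a consistent solution.\<close>

definition image_topology :: "'a topology \<Rightarrow> ('a \<Rightarrow> 'b) \<Rightarrow> 'b topology" where
  "image_topology X f =
     topology (\<lambda>W. W \<subseteq> f ` topspace X \<and> openin X {x \<in> topspace X. f x \<in> W})"

lemma openin_image_topology:
  "openin (image_topology X f) W \<longleftrightarrow> W \<subseteq> f ` topspace X \<and> openin X {x \<in> topspace X. f x \<in> W}"
proof -
  have "istopology (\<lambda>W. W \<subseteq> f ` topspace X \<and> openin X {x \<in> topspace X. f x \<in> W})"
    unfolding istopology_def
  proof (intro conjI allI impI)
    fix S T
    assume *: "S \<subseteq> f ` topspace X \<and> openin X {x \<in> topspace X. f x \<in> S}"
      "T \<subseteq> f ` topspace X \<and> openin X {x \<in> topspace X. f x \<in> T}"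
    have "{x \<in> topspace X. f x \<in> S \<inter> T} =
        {x \<in> topspace X. f x \<in> S} \<inter> {x \<in> topspace X. f x \<in> T}" by blast
    with * show "openin X {x \<in> topspace X. f x \<in> S \<inter> T}" by auto
    show "S \<inter> T \<subseteq> f ` topspace X" using * by blast
  next
    fix K
    assume *: "\<forall>S\<in>K. S \<subseteq> f ` topspace X \<and> openin X {x \<in> topspace X. f x \<in> S}"
    have "{x \<in> topspace X. f x \<in> \<Union>K} = (\<Union>S\<in>K. {x \<in> topspace X. f x \<in> S})" by blast
    with * show "openin X {x \<in> topspace X. f x \<in> \<Union>K}" by auto
    show "\<Union>K \<subseteq> f ` topspace X" using * by blast
  qed
  then show ?thesis
    unfolding image_topology_def by (simp add: topology_inverse')
qed

lemma topspace_image_topology [simp]: "topspace (image_topology X f) = f ` topspace X"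
proof
  show "topspace (image_topology X f) \<subseteq> f ` topspace X"
    using openin_image_topology[of X f] openin_topspace by blast
  have "{x \<in> topspace X. f x \<in> f ` topspace X} = topspace X" by blast
  then have "openin (image_topology X f) (f ` topspace X)"
    by (simp add: openin_image_topology)
  then show "f ` topspace X \<subseteq> topspace (image_topology X f)"
    by (rule openin_subset)
qed

lemma quotient_map_image_topology: "quotient_map X (image_topology X f) f"
  unfolding quotient_map_def by (auto simp: openin_image_topology)

lemma quotient_map_unique:
  assumes "quotient_map X Y f" "quotient_map X Y' f"
  shows "Y = Y'"
proof -
  have "topspace Y = topspace Y'"
    using assms by (simp add: quotient_map_def)
  then have "openin Y U \<longleftrightarrow> openin Y' U" for U
    using assms unfolding quotient_map_def by (metis openin_subset)
  then show ?thesis by (simp add: topology_eq)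
qed

section \<open>Quotients of a family of simplices by labels of faces\<close>

abbreviation rsub :: "(nat \<Rightarrow> real) set \<Rightarrow> (nat \<Rightarrow> real) topology" where
  "rsub S \<equiv> subtopology (powertop_real UNIV) S"

definition supp :: "(nat \<Rightarrow> real) \<Rightarrow> nat set" where
  "supp x = {i. x i \<noteq> 0}"

definition glue_map :: "(nat set \<Rightarrow> 'a \<Rightarrow> 'b) \<Rightarrow> (nat \<Rightarrow> real) \<times> 'a \<Rightarrow> (nat \<Rightarrow> real) \<times> 'b" where
  "glue_map \<kappa> = (\<lambda>(x, t). (x, \<kappa> (supp x) t))"

text \<open>Points are pairs of coordinates and a label, so that equality of points is equality of
  labels and no equivalence classes appear. \<open>S\<close> need not be the whole simplex, because
  the collar and excision arguments work with open and closed pieces of it.\<close>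

definition glued_space ::
    "'a set \<Rightarrow> (nat set \<Rightarrow> 'a \<Rightarrow> 'b) \<Rightarrow> (nat \<Rightarrow> real) set \<Rightarrow> ((nat \<Rightarrow> real) \<times> 'b) topology" where
  "glued_space T \<kappa> S = image_topology (prod_topology (rsub S) (discrete_topology T)) (glue_map \<kappa>)"

lemma topspace_glued_space: "topspace (glued_space T \<kappa> S) = glue_map \<kappa> ` (S \<times> T)"
  by (simp add: glued_space_def)

lemma quotient_glue_map:
  "quotient_map (prod_topology (rsub S) (discrete_topology T)) (glued_space T \<kappa> S) (glue_map \<kappa>)"
  by (simp add: glued_space_def quotient_map_image_topology)

lemma continuous_glue_map:
  "continuous_map (prod_topology (rsub S) (discrete_topology T)) (glued_space T \<kappa> S) (glue_map \<kappa>)"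
  using quotient_glue_map quotient_imp_continuous_map by blast

lemma continuous_map_prod_discrete:
  "continuous_map (prod_topology X (discrete_topology T)) Y f \<longleftrightarrow>
     (\<forall>t\<in>T. continuous_map X Y (\<lambda>x. f (x, t)))"
proof
  assume f: "continuous_map (prod_topology X (discrete_topology T)) Y f"
  show "\<forall>t\<in>T. continuous_map X Y (\<lambda>x. f (x, t))"
  proof
    fix t assume "t \<in> T"
    then have "continuous_map X (prod_topology X (discrete_topology T)) (\<lambda>x. (x, t))"
      by (intro continuous_map_pairedI) auto
    from continuous_map_compose[OF this f] show "continuous_map X Y (\<lambda>x. f (x, t))"
      by (simp add: o_def)
  qed
next
  assume f: "\<forall>t\<in>T. continuous_map X Y (\<lambda>x. f (x, t))"
  show "continuous_map (prod_topology X (discrete_topology T)) Y f"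
    unfolding continuous_map_def
  proof (intro conjI allI impI)
    show "f \<in> topspace (prod_topology X (discrete_topology T)) \<rightarrow> topspace Y"
      using f by (fastforce simp: continuous_map_def Pi_iff)
    fix U assume U: "openin Y U"
    have "{z \<in> topspace (prod_topology X (discrete_topology T)). f z \<in> U} =
        (\<Union>t\<in>T. {x \<in> topspace X. f (x, t) \<in> U} \<times> {t})" by auto
    moreover have "openin (prod_topology X (discrete_topology T)) ({x \<in> topspace X. f (x, t) \<in> U} \<times> {t})"
      if "t \<in> T" for t
      using f that U by (auto simp: openin_prod_Times_iff continuous_map_def)
    ultimately show "openin (prod_topology X (discrete_topology T))
        {z \<in> topspace (prod_topology X (discrete_topology T)). f z \<in> U}"
      by auto
  qed
qed

lemma continuous_map_from_glued:
  "continuous_map (glued_space T \<kappa> S) Y f \<longleftrightarrow>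
     (\<forall>t\<in>T. continuous_map (rsub S) Y (\<lambda>x. f (x, \<kappa> (supp x) t)))"
  by (simp add: continuous_map_prod_discrete glue_map_def
      flip: continuous_compose_quotient_map_eq[OF quotient_glue_map])

lemma continuous_map_into_glued:
  assumes "t \<in> T" "continuous_map X (rsub S) g"
  shows "continuous_map X (glued_space T \<kappa> S) (\<lambda>x. (g x, \<kappa> (supp (g x)) t))"
proof -
  have "continuous_map (rsub S) (glued_space T \<kappa> S) (\<lambda>x. (x, \<kappa> (supp x) t))"
    using continuous_glue_map[of S T \<kappa>] assms(1)
    by (simp add: continuous_map_prod_discrete glue_map_def)
  from continuous_map_compose[OF assms(2) this] show ?thesis by (simp add: o_def)
qed

lemma subtopology_prod_Times_discrete:
  "subtopology (prod_topology X (discrete_topology T)) (S \<times> T) =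
   prod_topology (subtopology X S) (discrete_topology T)"
  by (simp add: prod_topology_subtopology subtopology_subtopology Int_def flip: subtopology_Times)

lemma glue_map_preimage:
  "S' \<subseteq> S \<Longrightarrow>
   {z \<in> topspace (prod_topology (rsub S) (discrete_topology T)). glue_map \<kappa> z \<in> glue_map \<kappa> ` (S' \<times> T)} = S' \<times> T"
  by (auto simp: glue_map_def)

lemma openin_glue_map_image:
  assumes "openin (rsub S) S'"
  shows "openin (glued_space T \<kappa> S) (glue_map \<kappa> ` (S' \<times> T))"
proof -
  let ?P = "prod_topology (rsub S) (discrete_topology T)"
  have S': "S' \<subseteq> S" using openin_subset[OF assms] by simp
  then have V: "glue_map \<kappa> ` (S' \<times> T) \<subseteq> topspace (glued_space T \<kappa> S)"
    by (auto simp: topspace_glued_space)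
  have "openin ?P {z \<in> topspace ?P. glue_map \<kappa> z \<in> glue_map \<kappa> ` (S' \<times> T)} =
      openin (glued_space T \<kappa> S) (glue_map \<kappa> ` (S' \<times> T))"
    using quotient_glue_map V unfolding quotient_map_def by blast
  moreover have "openin ?P (S' \<times> T)"
    using assms by (simp add: openin_prod_Times_iff)
  ultimately show ?thesis unfolding glue_map_preimage[OF S'] by simp
qed

lemma closedin_glue_map_image:
  assumes "closedin (rsub S) S'"
  shows "closedin (glued_space T \<kappa> S) (glue_map \<kappa> ` (S' \<times> T))"
proof -
  let ?P = "prod_topology (rsub S) (discrete_topology T)"
  have S': "S' \<subseteq> S" using closedin_subset[OF assms] by simp
  then have V: "glue_map \<kappa> ` (S' \<times> T) \<subseteq> topspace (glued_space T \<kappa> S)"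
    by (auto simp: topspace_glued_space)
  have "closedin ?P {z \<in> topspace ?P. glue_map \<kappa> z \<in> glue_map \<kappa> ` (S' \<times> T)} =
      closedin (glued_space T \<kappa> S) (glue_map \<kappa> ` (S' \<times> T))"
    using quotient_glue_map V unfolding quotient_map_closedin by blast
  moreover have "closedin ?P (S' \<times> T)"
    using assms by (simp add: closedin_prod_Times_iff)
  ultimately show ?thesis unfolding glue_map_preimage[OF S'] by simp
qed

text \<open>\<open>glue_map\<close> keeps the coordinates, so \<open>S' \<times> T\<close> is
  saturated; a quotient map restricts to a quotient map over an open or closed set, which is where
  the assumption enters.\<close>

lemma subtopology_glued_space:
  assumes "openin (rsub S) S' \<or> closedin (rsub S) S'"
  shows "subtopology (glued_space T \<kappa> S) (glue_map \<kappa> ` (S' \<times> T)) = glued_space T \<kappa> S'"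
proof -
  let ?P = "prod_topology (rsub S) (discrete_topology T)"
  let ?G = "glued_space T \<kappa> S"
  let ?V = "glue_map \<kappa> ` (S' \<times> T)"
  have S': "S' \<subseteq> S"
    using assms openin_subset[of "rsub S" S'] closedin_subset[of "rsub S" S'] by auto
  have "openin ?G ?V \<or> closedin ?G ?V"
    using assms openin_glue_map_image closedin_glue_map_image by blast
  from quotient_map_restriction[OF quotient_glue_map glue_map_preimage[OF S'] this]
  have "quotient_map (subtopology ?P (S' \<times> T)) (subtopology ?G ?V) (glue_map \<kappa>)" .
  moreover have "subtopology ?P (S' \<times> T) = prod_topology (rsub S') (discrete_topology T)"
    using S' by (simp add: subtopology_prod_Times_discrete subtopology_subtopology Int_absorb1)
  ultimately show ?thesis
    using quotient_glue_map quotient_map_unique by metis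
qed

text \<open>The choice of \<open>t\<close> is immaterial only if \<open>label_compat\<close> below holds.\<close>

definition glued_map ::
    "'a set \<Rightarrow> (nat set \<Rightarrow> 'a \<Rightarrow> 'b) \<Rightarrow> (nat set \<Rightarrow> 'a \<Rightarrow> 'c) \<Rightarrow>
     ((nat \<Rightarrow> real) \<Rightarrow> (nat \<Rightarrow> real)) \<Rightarrow> (nat \<Rightarrow> real) \<times> 'b \<Rightarrow> (nat \<Rightarrow> real) \<times> 'c" where
  "glued_map T \<kappa> \<kappa>' g = (\<lambda>(x, b). (g x, \<kappa>' (supp (g x)) (SOME t. t \<in> T \<and> \<kappa> (supp x) t = b)))"

definition label_compat where
  "label_compat T \<kappa> \<kappa>' S g \<longleftrightarrow>
     (\<forall>x\<in>S. \<forall>t\<in>T. \<forall>t'\<in>T. \<kappa> (supp x) t = \<kappa> (supp x) t' \<longrightarrow>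
        \<kappa>' (supp (g x)) t = \<kappa>' (supp (g x)) t')"

lemma glued_map_eq:
  assumes "label_compat T \<kappa> \<kappa>' S g" "x \<in> S" "t \<in> T"
  shows "glued_map T \<kappa> \<kappa>' g (x, \<kappa> (supp x) t) = (g x, \<kappa>' (supp (g x)) t)"
proof -
  let ?t = "SOME t'. t' \<in> T \<and> \<kappa> (supp x) t' = \<kappa> (supp x) t"
  have "?t \<in> T \<and> \<kappa> (supp x) ?t = \<kappa> (supp x) t"
    by (rule someI[of _ t]) (simp add: assms)
  then have "\<kappa>' (supp (g x)) ?t = \<kappa>' (supp (g x)) t"
    using assms unfolding label_compat_def by blast
  then show ?thesis by (simp add: glued_map_def)
qed

lemma continuous_glued_map:
  assumes "label_compat T \<kappa> \<kappa>' S g" "continuous_map (rsub S) (rsub S') g"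
  shows "continuous_map (glued_space T \<kappa> S) (glued_space T \<kappa>' S') (glued_map T \<kappa> \<kappa>' g)"
  unfolding continuous_map_from_glued
proof
  fix t assume t: "t \<in> T"
  from continuous_map_into_glued[OF t assms(2)]
  have "continuous_map (rsub S) (glued_space T \<kappa>' S') (\<lambda>x. (g x, \<kappa>' (supp (g x)) t))" .
  then show "continuous_map (rsub S) (glued_space T \<kappa>' S')
      (\<lambda>x. glued_map T \<kappa> \<kappa>' g (x, \<kappa> (supp x) t))"
    by (rule continuous_map_eq) (simp add: glued_map_eq[OF assms(1)] t)
qed

text \<open>The product of a quotient map with the compact Hausdorff interval is again a quotient
  map, so a homotopy given on coordinates descends. The predicate \<open>P\<close> carries the
  invariance of a subspace when pairs are compared.\<close>

lemma homotopic_glued_map: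
  fixes h :: "real \<Rightarrow> (nat \<Rightarrow> real) \<Rightarrow> nat \<Rightarrow> real"
  assumes h: "continuous_map (prod_topology (top_of_set {0..1}) (rsub S)) (rsub S') (\<lambda>(u, x). h u x)"
    and compat: "\<And>u. u \<in> {0..1} \<Longrightarrow> label_compat T \<kappa> \<kappa>' S (h u)"
    and P: "\<And>u. u \<in> {0..1} \<Longrightarrow> P (glued_map T \<kappa> \<kappa>' (h u))"
  shows "homotopic_with P (glued_space T \<kappa> S) (glued_space T \<kappa>' S')
           (glued_map T \<kappa> \<kappa>' (h 0)) (glued_map T \<kappa> \<kappa>' (h 1))"
  unfolding homotopic_with_def
proof (intro exI[of _ "\<lambda>(u, y). glued_map T \<kappa> \<kappa>' (h u) y"] conjI allI ballI)
  let ?I = "top_of_set {0..1::real}"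
  let ?P = "prod_topology (rsub S) (discrete_topology T)"
  have Icompact: "compact_space ?I"
    by (simp add: compact_space_subtopology compactin_euclidean_iff)
  have Ihaus: "Hausdorff_space ?I"
    by (simp add: Hausdorff_space_subtopology)
  have quot: "quotient_map (prod_topology ?I ?P) (prod_topology ?I (glued_space T \<kappa> S))
      (\<lambda>(u, z). (u, glue_map \<kappa> z))"
    using quotient_map_prod_right[OF _ _ quotient_glue_map] Icompact Ihaus
      compact_imp_locally_compact_space by blast
  have "continuous_map (prod_topology ?I ?P) (glued_space T \<kappa>' S')
      (\<lambda>(u, x, t). (h u x, \<kappa>' (supp (h u x)) t))"
  proof -
    have "continuous_map (prod_topology ?I ?P) (rsub S') (\<lambda>(u, x, t). h u x)"
    proof -
      have "continuous_map (prod_topology ?I ?P) (prod_topology ?I (rsub S)) (\<lambda>(u, x, t). (u, x))"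
        unfolding case_prod_unfold
        by (intro continuous_map_pairedI continuous_map_fst continuous_map_compose[OF continuous_map_snd, unfolded o_def])
      from continuous_map_compose[OF this h] show ?thesis
        by (simp add: o_def case_prod_unfold)
    qed
    then have "continuous_map (prod_topology ?I ?P) (prod_topology (rsub S') (discrete_topology T))
        (\<lambda>(u, x, t). (h u x, t))"
      unfolding case_prod_unfold
      by (intro continuous_map_pairedI continuous_map_compose[OF continuous_map_snd, unfolded o_def] continuous_map_snd)
    from continuous_map_compose[OF this continuous_glue_map] show ?thesis
      by (simp add: o_def case_prod_unfold glue_map_def)
  qed
  then have "continuous_map (prod_topology ?I ?P) (glued_space T \<kappa>' S')
      ((\<lambda>(u, y). glued_map T \<kappa> \<kappa>' (h u) y) \<circ> (\<lambda>(u, z). (u, glue_map \<kappa> z)))"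
    by (rule continuous_map_eq) (auto simp: glue_map_def glued_map_eq[OF compat])
  then show "continuous_map (prod_topology ?I (glued_space T \<kappa> S)) (glued_space T \<kappa>' S')
      (\<lambda>(u, y). glued_map T \<kappa> \<kappa>' (h u) y)"
    using continuous_compose_quotient_map[OF quot] by blast
qed (use P in auto)

text \<open>Abstracts the fact that collapsing further only forgets. The empty set is left out: it
  is not the support of any point of the simplex, and all edges of a graph can never be
  collapsed.\<close>

definition coherent :: "nat \<Rightarrow> 'a set \<Rightarrow> (nat set \<Rightarrow> 'a \<Rightarrow> 'b) \<Rightarrow> bool" where
  "coherent p T \<kappa> \<longleftrightarrow>
     (\<forall>F F' t t'. F \<noteq> {} \<longrightarrow> F \<subseteq> F' \<longrightarrow> F' \<subseteq> {..p} \<longrightarrow> t \<in> T \<longrightarrow> t' \<in> T \<longrightarrow>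
        \<kappa> F' t = \<kappa> F' t' \<longrightarrow> \<kappa> F t = \<kappa> F t')"

lemma coherentD:
  assumes "coherent p T \<kappa>" "\<kappa> F' t = \<kappa> F' t'" "F \<noteq> {}" "F \<subseteq> F'" "F' \<subseteq> {..p}" "t \<in> T" "t' \<in> T"
  shows "\<kappa> F t = \<kappa> F t'"
  using assms unfolding coherent_def by blast

lemma coherent_mono: "coherent p T \<kappa> \<Longrightarrow> n \<le> p \<Longrightarrow> coherent n T \<kappa>"
  unfolding coherent_def by (meson atMost_subset_iff order_trans)

lemma coherent_insert: "coherent p T \<kappa> \<Longrightarrow> j \<le> p \<Longrightarrow> coherent p T (\<lambda>F. \<kappa> (insert j F))"
  unfolding coherent_def by (metis atMost_iff empty_not_insert insert_mono insert_subset)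

section \<open>Supports, faces and straight-line homotopies in the standard simplex\<close>

lemma supp_subset: "x \<in> standard_simplex p \<Longrightarrow> supp x \<subseteq> {..p}"
  unfolding standard_simplex_def supp_def by auto (metis leI)

lemma supp_nonempty:
  assumes "x \<in> standard_simplex p" shows "supp x \<noteq> {}"
proof
  assume "supp x = {}"
  then have "(\<Sum>i\<le>p. x i) = 0" by (simp add: supp_def)
  then show False using assms by (simp add: standard_simplex_def)
qed

lemma standard_simplexI:
  assumes "\<And>i. i \<le> p \<Longrightarrow> 0 \<le> x i" "\<And>i. i > p \<Longrightarrow> x i = 0" "(\<Sum>i\<le>p. x i) = 1"
  shows "x \<in> standard_simplex p"
proof -
  have "x i \<le> 1" for i
  proof (cases "i \<le> p")
    case True
    then have "x i \<le> (\<Sum>i\<le>p. x i)" by (intro member_le_sum) (auto simp: assms)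
    then show ?thesis by (simp add: assms)
  qed (simp add: assms)
  then show ?thesis
    using assms by (auto simp: standard_simplex_def) (metis leI order_refl)
qed

lemma face_standard_simplex:
  "{x \<in> standard_simplex (Suc n). x (Suc n) = 0} = standard_simplex n"
proof
  show "{x \<in> standard_simplex (Suc n). x (Suc n) = 0} \<subseteq> standard_simplex n"
    unfolding standard_simplex_def by auto (metis Suc_lessI)
  show "standard_simplex n \<subseteq> {x \<in> standard_simplex (Suc n). x (Suc n) = 0}"
    using standard_simplex_mono[of n "Suc n"] by (auto simp: standard_simplex_def)
qed

lemma continuous_rsub_component [continuous_intros]:
  "continuous_map X (rsub S) f \<Longrightarrow> continuous_map X euclideanreal (\<lambda>x. f x i)"
  using continuous_map_product_projection[of i UNIV "\<lambda>_. euclideanreal"]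
  by (auto simp: continuous_map_in_subtopology dest: continuous_map_compose[where g="\<lambda>x. x i"] simp: o_def)

lemma continuous_rsub_projection: "continuous_map (rsub S) euclideanreal (\<lambda>x. x i)"
  using continuous_map_product_projection[of i UNIV "\<lambda>_. euclideanreal"]
  by (simp add: continuous_map_from_subtopology)

lemma continuous_map_into_rsub:
  assumes "\<And>i. continuous_map X euclideanreal (\<lambda>x. f x i)" "\<And>x. x \<in> topspace X \<Longrightarrow> f x \<in> S"
  shows "continuous_map X (rsub S) f"
  using assms by (auto simp: continuous_map_in_subtopology continuous_map_componentwise_UNIV)

lemma closedin_face: "closedin (rsub (standard_simplex (Suc n))) (standard_simplex n)"
proof -
  let ?X = "rsub (standard_simplex (Suc n))"
  have "continuous_map ?X euclideanreal (\<lambda>x. x (Suc n))"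
    by (rule continuous_rsub_projection)
  from closedin_continuous_map_preimage[OF this, of "{0}"]
  have "closedin ?X {x \<in> topspace ?X. x (Suc n) \<in> {0}}" by simp
  then show ?thesis by (simp add: face_standard_simplex)
qed

lemma openin_simplex_halfspace:
  assumes "open U"
  shows "openin (rsub (standard_simplex p)) {x \<in> standard_simplex p. x j \<in> U}"
proof -
  let ?X = "rsub (standard_simplex p)"
  have "continuous_map ?X euclideanreal (\<lambda>x. x j)"
    by (rule continuous_rsub_projection)
  from openin_continuous_map_preimage[OF this, of U] assms
  show ?thesis by simp
qed

lemma homotopic_glued_map_id:
  assumes g: "continuous_map (rsub (standard_simplex p)) (rsub (standard_simplex p)) g"
    and compat: "\<And>u. u \<in> {0..1} \<Longrightarrow>
      label_compat T \<kappa> \<kappa> (standard_simplex p) (\<lambda>x i. (1 - u) * x i + u * g x i)"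
    and P: "\<And>u. u \<in> {0..1} \<Longrightarrow> P (glued_map T \<kappa> \<kappa> (\<lambda>x i. (1 - u) * x i + u * g x i))"
    and Peq: "\<And>h k. (\<And>x. x \<in> topspace (glued_space T \<kappa> (standard_simplex p)) \<Longrightarrow> h x = k x) \<Longrightarrow> P h = P k"
  shows "homotopic_with P (glued_space T \<kappa> (standard_simplex p)) (glued_space T \<kappa> (standard_simplex p))
           (glued_map T \<kappa> \<kappa> g) id"
proof -
  let ?S = "standard_simplex p" and ?X = "glued_space T \<kappa> (standard_simplex p)"
  define h where "h = (\<lambda>(u::real) x i. (1 - u) * x i + u * g x i)"
  have gS: "g x \<in> ?S" if "x \<in> ?S" for x
    using g that by (auto simp: continuous_map_def)
  have "continuous_map (prod_topology (top_of_set {0..1}) (rsub ?S)) (rsub ?S) (\<lambda>(u, x). h u x)"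
  proof (rule continuous_map_into_rsub)
    let ?P = "prod_topology (top_of_set {0..1::real}) (rsub ?S)"
    have 1: "continuous_map ?P euclideanreal fst"
      using continuous_map_fst[of "top_of_set {0..1::real}" "rsub ?S"]
      by (simp add: continuous_map_in_subtopology)
    have 2: "continuous_map ?P (rsub ?S) snd" by (rule continuous_map_snd)
    have 3: "continuous_map ?P (rsub ?S) (\<lambda>z. g (snd z))"
      using continuous_map_compose[OF 2 g] by (simp add: o_def)
    fix i
    show "continuous_map ?P euclideanreal (\<lambda>z. (case z of (u, x) \<Rightarrow> h u x) i)"
      unfolding h_def case_prod_unfold
      by (intro continuous_map_add continuous_map_real_mult continuous_map_diff 1
          continuous_rsub_component[OF 2] continuous_rsub_component[OF 3] continuous_map_const[THEN iffD2]) auto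
  next
    fix z assume "z \<in> topspace (prod_topology (top_of_set {0..1::real}) (rsub ?S))"
    then show "(case z of (u, x) \<Rightarrow> h u x) \<in> ?S"
      using convex_standard_simplex gS by (auto simp: h_def)
  qed
  from homotopic_glued_map[of ?S ?S h T \<kappa> \<kappa> P, OF this] compat P
  have "homotopic_with P ?X ?X (glued_map T \<kappa> \<kappa> (h 0)) (glued_map T \<kappa> \<kappa> (h 1))"
    by (simp add: h_def)
  then have hom0: "homotopic_with P ?X ?X (glued_map T \<kappa> \<kappa> g) (glued_map T \<kappa> \<kappa> (h 0))"
    using homotopic_with_symD by (auto simp: h_def)
  \<comment> \<open>Time 0 gives the identity only on points of the space; elsewhere the choice in
    \<open>glued_map\<close> is arbitrary. This is why \<open>P\<close> must depend only on values
    there.\<close>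
  have id: "id y = glued_map T \<kappa> \<kappa> (h 0) y" if y: "y \<in> topspace ?X" for y
  proof -
    obtain x t where y: "y = (x, \<kappa> (supp x) t)" "x \<in> ?S" "t \<in> T"
      using y by (auto simp: topspace_glued_space glue_map_def)
    have "label_compat T \<kappa> \<kappa> ?S (h 0)" using compat[of 0] by (simp add: h_def)
    from glued_map_eq[OF this y(2,3)] show ?thesis by (simp add: y h_def)
  qed
  show ?thesis
    by (rule homotopic_with_eq[OF hom0 refl id Peq])
qed

text \<open>Pushes the collar \<open>{x. x p < 1/2}\<close> of the last face into that face and stretches the rest.\<close>

definition squash :: "nat \<Rightarrow> (nat \<Rightarrow> real) \<Rightarrow> nat \<Rightarrow> real" where
  "squash p x = (\<lambda>i. if i = p then 1 - (1 - x p) / max (1/2) (1 - x p) else x i / max (1/2) (1 - x p))"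

text \<open>The coordinates other than the last sum to \<open>1 - x p\<close>. Dividing them by
  \<open>1 - x p\<close> in the collar is the projection from vertex \<open>p\<close> to the
  opposite face; beyond it the divisor stays at \<open>1/2\<close>, which keeps the map continuous.
  The last coordinate is whatever restores the sum 1.\<close>

lemma squash_in_simplex:
  assumes "x \<in> standard_simplex (Suc n)"
  shows "squash (Suc n) x \<in> standard_simplex (Suc n)"
proof (rule standard_simplexI)
  define m where "m = max (1/2) (1 - x (Suc n))"
  have m: "m > 0" "1 - x (Suc n) \<le> m" by (auto simp: m_def)
  have x: "0 \<le> x i" "i > Suc n \<Longrightarrow> x i = 0" "(\<Sum>i\<le>n. x i) = 1 - x (Suc n)" for i
    using assms by (auto simp: standard_simplex_def)
  show "0 \<le> squash (Suc n) x i" for i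
    using m x(1) by (auto simp: squash_def simp flip: m_def)
  show "squash (Suc n) x i = 0" if "i > Suc n" for i
    using that x by (auto simp: squash_def)
  have "(\<Sum>i\<le>n. squash (Suc n) x i) = (\<Sum>i\<le>n. x i / m)"
    by (rule sum.cong) (auto simp: squash_def m_def)
  also have "\<dots> = (1 - x (Suc n)) / m"
    by (simp add: x flip: sum_divide_distrib)
  finally show "(\<Sum>i\<le>Suc n. squash (Suc n) x i) = 1"
    by (simp add: squash_def m_def)
qed

lemma continuous_squash:
  "continuous_map (rsub (standard_simplex (Suc n))) (rsub (standard_simplex (Suc n))) (squash (Suc n))"
proof (rule continuous_map_into_rsub)
  let ?X = "rsub (standard_simplex (Suc n))"
  have c: "continuous_map ?X euclideanreal (\<lambda>x. x i)" for i
    by (rule continuous_rsub_projection)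
  have m: "continuous_map ?X euclideanreal (\<lambda>x. max (1/2) (1 - x (Suc n)))"
    by (intro continuous_map_real_max continuous_map_diff c) auto
  fix i
  show "continuous_map ?X euclideanreal (\<lambda>x. squash (Suc n) x i)"
  proof (cases "i = Suc n")
    case True
    then show ?thesis
      unfolding squash_def
      by simp (intro continuous_map_diff continuous_map_real_divide c m, auto simp: max_def)
  next
    case False
    then show ?thesis
      unfolding squash_def
      by simp (intro continuous_map_diff continuous_map_real_divide c m, auto simp: max_def)
  qed
qed (simp add: squash_in_simplex)

text \<open>The straight line from \<open>x\<close> to its image stays in the closed face carrying
  \<open>x\<close>, so coherence makes the whole homotopy compatible with the labels.\<close>

lemma supp_squash: "supp (\<lambda>i. (1 - u) * x i + u * squash p x i) \<subseteq> supp x"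
  by (auto simp: supp_def squash_def)

lemma squash_face: "x p < 1/2 \<Longrightarrow> squash p x p = 0"
  by (simp add: squash_def max_def)

text \<open>\<open>squash\<close> sends the collar \<open>V\<close> into the face \<open>Y\<close>,
  and the straight-line homotopy from it to the identity preserves both \<open>Y\<close> and
  \<open>V\<close>. So the inclusion of pairs is a homotopy equivalence.\<close>

lemma collar_iso:
  assumes "coherent (Suc n) T \<kappa>"
  defines "X \<equiv> glued_space T \<kappa> (standard_simplex (Suc n))"
    and "Y \<equiv> glue_map \<kappa> ` (standard_simplex n \<times> T)"
    and "V \<equiv> glue_map \<kappa> ` ({x \<in> standard_simplex (Suc n). x (Suc n) < 1/2} \<times> T)"
  shows "hom_induced q X Y X V id \<in> iso (relative_homology_group q X Y) (relative_homology_group q X V)"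
proof -
  let ?S = "standard_simplex (Suc n)" and ?g = "squash (Suc n)"
  define k where "k = (\<lambda>u x i. (1 - u) * x i + u * squash (Suc n) x i)"
  have kS: "k u x \<in> ?S" if "x \<in> ?S" "u \<in> {0..1}" for u x
    using that convex_standard_simplex[OF that(1) squash_in_simplex[OF that(1)], of u] by (simp add: k_def)
  have compat: "label_compat T \<kappa> \<kappa> ?S (k u)" if "u \<in> {0..1}" for u
    unfolding label_compat_def
  proof (intro ballI impI)
    fix x t t'
    assume *: "x \<in> ?S" "t \<in> T" "t' \<in> T" "\<kappa> (supp x) t = \<kappa> (supp x) t'"
    show "\<kappa> (supp (k u x)) t = \<kappa> (supp (k u x)) t'"
    proof (rule coherentD[OF assms(1) *(4)])
      show "supp (k u x) \<noteq> {}" using supp_nonempty[OF kS[OF *(1) that]] .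
      show "supp (k u x) \<subseteq> supp x" unfolding k_def by (rule supp_squash)
    qed (use * supp_subset in auto)
  qed
  have k1: "k 1 = ?g" by (simp add: k_def)
  have compat1: "label_compat T \<kappa> \<kappa> ?S ?g" using compat[of 1] k1 by simp
  have mapk: "glued_map T \<kappa> \<kappa> (k u) \<in> glue_map \<kappa> ` (A \<times> T) \<rightarrow> glue_map \<kappa> ` (B \<times> T)"
    if "u \<in> {0..1}" "A \<subseteq> ?S" "\<And>x. x \<in> A \<Longrightarrow> k u x \<in> B" for u A B
  proof
    fix y assume "y \<in> glue_map \<kappa> ` (A \<times> T)"
    then obtain x t where y: "y = (x, \<kappa> (supp x) t)" "x \<in> A" "t \<in> T"
      by (auto simp: glue_map_def)
    then have "glued_map T \<kappa> \<kappa> (k u) y = glue_map \<kappa> (k u x, t)"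
      using that glued_map_eq[OF compat[OF that(1)]] by (auto simp: glue_map_def)
    then show "glued_map T \<kappa> \<kappa> (k u) y \<in> glue_map \<kappa> ` (B \<times> T)"
      using that y by auto
  qed
  have YX: "Y \<subseteq> topspace X" "V \<subseteq> topspace X"
    using standard_simplex_mono[of n "Suc n"] by (auto simp: X_def Y_def V_def topspace_glued_space)
  have face: "standard_simplex n = {x \<in> ?S. x (Suc n) = 0}" by (simp add: face_standard_simplex)
  have kY: "glued_map T \<kappa> \<kappa> (k u) \<in> Y \<rightarrow> Y" if "u \<in> {0..1}" for u
    unfolding Y_def face
    by (rule mapk[OF that]) (use kS[OF _ that] in \<open>auto simp: k_def squash_def\<close>)
  have kV: "glued_map T \<kappa> \<kappa> (k u) \<in> V \<rightarrow> V" if "u \<in> {0..1}" for u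
    unfolding V_def
  proof (rule mapk[OF that])
    fix x assume x: "x \<in> {x \<in> ?S. x (Suc n) < 1/2}"
    then have "x (Suc n) \<ge> 0" by (auto simp: standard_simplex_def)
    \<comment> \<open>Inside the collar the squashed point has last coordinate 0, so the homotopy
      can only shrink \<open>x (Suc n)\<close>.\<close>
    then have "(1 - u) * x (Suc n) \<le> 1 * x (Suc n)"
      using that by (intro mult_right_mono) auto
    then have "k u x (Suc n) < 1/2"
      using x by (simp add: k_def squash_face)
    then show "k u x \<in> {x \<in> ?S. x (Suc n) < 1/2}" using x kS that by auto
  qed auto
  have gVY: "glued_map T \<kappa> \<kappa> ?g \<in> V \<rightarrow> Y"
    unfolding V_def Y_def face k1[symmetric]
    by (rule mapk) (use kS[of _ 1] k1 in \<open>auto simp: squash_face\<close>)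
  have VY: "id \<in> Y \<rightarrow> V"
    unfolding V_def Y_def face by auto
  have hom: "homotopic_with (\<lambda>h. h \<in> A \<rightarrow> A) X X (glued_map T \<kappa> \<kappa> ?g) id"
    if "A \<subseteq> topspace X" "\<And>u. u \<in> {0..1} \<Longrightarrow> glued_map T \<kappa> \<kappa> (k u) \<in> A \<rightarrow> A" for A
    unfolding X_def
  proof (rule homotopic_glued_map_id)
    show "(h \<in> A \<rightarrow> A) = (h' \<in> A \<rightarrow> A)"
      if "\<And>x. x \<in> topspace (glued_space T \<kappa> ?S) \<Longrightarrow> h x = h' x" for h h'
      using that \<open>A \<subseteq> topspace X\<close> unfolding X_def by (auto simp: Pi_iff subset_iff)
  qed (use compat that(2) in \<open>auto simp: continuous_squash k_def\<close>)
  show ?thesis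
  proof (rule homotopy_equivalence_relative_homology_group_isomorphism)
    show "continuous_map X X (glued_map T \<kappa> \<kappa> ?g)"
      unfolding X_def by (rule continuous_glued_map[OF compat1 continuous_squash])
    show "homotopic_with (\<lambda>h. h \<in> Y \<rightarrow> Y) X X (glued_map T \<kappa> \<kappa> ?g \<circ> id) id"
      using hom[OF YX(1) kY] by simp
    show "homotopic_with (\<lambda>k. k \<in> V \<rightarrow> V) X X (id \<circ> glued_map T \<kappa> \<kappa> ?g) id"
      using hom[OF YX(2) kV] by simp
  qed (use VY gVY in auto)
qed

section \<open>Homology of disjoint unions of cones\<close>

lemma trivial_homology_discrete:
  assumes "q \<noteq> 0"
  shows "trivial_group (homology_group q (discrete_topology U))"
proof -
  let ?X = "discrete_topology U" and ?\<U> = "(\<lambda>x. {x}) ` U"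
  interpret comm_group "homology_group q ?X" by (rule abelian_homology_group)
  have iso: "(\<lambda>x. gfinprod (homology_group q ?X)
      (\<lambda>v. hom_induced q (subtopology ?X v) {} ?X {} id (x v)) ?\<U>)
     \<in> iso (sum_group ?\<U> (\<lambda>S. homology_group q (subtopology ?X S))) (homology_group q ?X)"
    by (rule homology_additivity_axiom) (auto simp: pairwise_def)
  have triv: "trivial_group (homology_group q (subtopology ?X v))" if "v \<in> ?\<U>" for v
    using that assms by (auto intro!: homology_dimension_axiom)
  have "c = \<one>\<^bsub>homology_group q ?X\<^esub>" if c: "c \<in> carrier (homology_group q ?X)" for c
  proof -
    obtain x where x: "x \<in> carrier (sum_group ?\<U> (\<lambda>S. homology_group q (subtopology ?X S)))"
      and cx: "c = gfinprod (homology_group q ?X)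
      (\<lambda>v. hom_induced q (subtopology ?X v) {} ?X {} id (x v)) ?\<U>"
      using iso c by (auto simp: iso_def bij_betw_def)
    have "hom_induced q (subtopology ?X v) {} ?X {} id (x v) = \<one>\<^bsub>homology_group q ?X\<^esub>"
      if "v \<in> ?\<U>" for v
    proof -
      have "x v \<in> carrier (homology_group q (subtopology ?X v))"
        using x that by (auto simp: carrier_sum_group PiE_iff)
      then have "x v = \<one>\<^bsub>homology_group q (subtopology ?X v)\<^esub>"
        using triv[OF that] by (auto simp: trivial_group_def)
      then show ?thesis
        using hom_one[OF hom_induced_empty_hom] by simp
    qed
    then show ?thesis unfolding cx by (simp add: gfinprod_def cong: conj_cong)
  qed
  then show ?thesis
    unfolding trivial_group_def using one_closed by (auto simp: is_group)
qed

lemma discrete_glued_space_singleton: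
  "glued_space T \<kappa> {e} = discrete_topology (glue_map \<kappa> ` ({e} \<times> T))"
proof -
  have "openin (glued_space T \<kappa> {e}) W \<longleftrightarrow> W \<subseteq> glue_map \<kappa> ` ({e} \<times> T)" for W
  proof -
    have "openin (prod_topology (rsub {e}) (discrete_topology T)) A"
      if "A \<subseteq> {e} \<times> T" for A
    proof -
      have "A = {e} \<times> snd ` A" using that by force
      moreover have "openin (prod_topology (rsub {e}) (discrete_topology T)) ({e} \<times> snd ` A)"
        using that openin_topspace[of "rsub {e}"] by (auto simp: openin_prod_Times_iff)
      ultimately show ?thesis by simp
    qed
    then show ?thesis
      by (auto simp: glued_space_def openin_image_topology)
  qed
  then show ?thesis by (simp add: topology_eq)
qed

text \<open>If every label contains the vertex \<open>p\<close>, the space is a disjoint union of cones.\<close>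

lemma trivial_homology_cones:
  assumes "coherent p T \<kappa>" "q \<noteq> 0"
  shows "trivial_group (homology_group q (glued_space T (\<lambda>F. \<kappa> (insert p F)) (standard_simplex p)))"
proof -
  let ?S = "standard_simplex p"
  let ?k = "\<lambda>F. \<kappa> (insert p F)"
  let ?X = "glued_space T ?k ?S"
  define e where "e = (\<lambda>j. if j = p then 1 else 0 :: real)"
  have e: "e \<in> ?S" by (simp add: e_def)
  let ?D = "glued_space T ?k {e}"
  let ?g = "\<lambda>_::nat \<Rightarrow> real. e"
  have g: "continuous_map (rsub ?S) (rsub ?S) ?g" "continuous_map (rsub ?S) (rsub {e}) ?g"
    using e by auto
  have compat: "label_compat T ?k ?k ?S (\<lambda>x i. (1 - u) * x i + u * e i)" if "u \<in> {0..1}" for u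
    unfolding label_compat_def
  proof (intro ballI impI)
    fix x t t'
    assume *: "x \<in> ?S" "t \<in> T" "t' \<in> T" "?k (supp x) t = ?k (supp x) t'"
    \<comment> \<open>Moving towards the vertex \<open>p\<close> adds at most \<open>p\<close> to
      the support, and every label already takes \<open>p\<close> into account.\<close>
    have "insert p (supp (\<lambda>i. (1 - u) * x i + u * e i)) \<subseteq> insert p (supp x)"
      by (auto simp: supp_def e_def)
    then show "?k (supp (\<lambda>i. (1 - u) * x i + u * e i)) t = ?k (supp (\<lambda>i. (1 - u) * x i + u * e i)) t'"
      using * supp_subset[OF *(1)] by (intro coherentD[OF assms(1) *(4)]) auto
  qed
  have compat1: "label_compat T ?k ?k ?S ?g" using compat[of 1] by simp
  let ?r = "glued_map T ?k ?k ?g"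
  have r: "continuous_map ?X ?D ?r"
    by (rule continuous_glued_map[OF compat1 g(2)])
  have s: "continuous_map ?D ?X id"
    unfolding continuous_map_from_glued
  proof
    fix t assume t: "t \<in> T"
    have "continuous_map (rsub {e}) (rsub ?S) (\<lambda>x. x)"
      using e by (auto simp: continuous_map_in_subtopology)
    from continuous_map_into_glued[OF t this, of ?k]
    show "continuous_map (rsub {e}) ?X (\<lambda>x. id (x, ?k (supp x) t))" by simp
  qed
  have "homotopic_with (\<lambda>h. True) ?X ?X ?r id"
    by (rule homotopic_glued_map_id[OF g(1)]) (use compat in auto)
  moreover have "homotopic_with (\<lambda>h. True) ?D ?D (?r \<circ> id) id"
  proof (rule homotopic_with_equal)
    show "(?r \<circ> id) y = id y" if y: "y \<in> topspace ?D" for y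
    proof -
      obtain t where "y = (e, ?k (supp e) t)" "t \<in> T"
        using y by (auto simp: topspace_glued_space glue_map_def)
      then show ?thesis using glued_map_eq[OF compat1 e] by simp
    qed
    show "continuous_map ?D ?D (?r \<circ> id)" using continuous_map_compose[OF s r] .
  qed auto
  ultimately have "?X homotopy_equivalent_space ?D"
    unfolding homotopy_equivalent_space_def using r s by (intro exI[of _ ?r] exI[of _ id]) simp
  then have "homology_group q ?X \<cong> homology_group q ?D"
    by (rule homotopy_equivalent_space_imp_isomorphic_homology_groups)
  then show ?thesis
    using trivial_homology_discrete[OF assms(2)] isomorphic_group_triviality
    by (metis discrete_glued_space_singleton group_relative_homology_group)
qed

section \<open>Chains of glued simplices\<close>

text \<open>On \<open>A\<close> the map \<open>g\<close> factors through \<open>f\<close>, and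
  pushing a chain forward along a composition means pushing it twice.\<close>

lemma frag_push_eq_0:
  assumes a: "Poly_Mapping.keys a \<subseteq> A" and "frag_extend (\<lambda>t. frag_of (f t)) a = 0"
    and fg: "\<And>t t'. t \<in> A \<Longrightarrow> t' \<in> A \<Longrightarrow> f t = f t' \<Longrightarrow> g t = g t'"
  shows "frag_extend (\<lambda>t. frag_of (g t)) a = 0"
proof -
  let ?h = "\<lambda>y. g (inv_into A f y)"
  have "?h (f t) = g t" if "t \<in> A" for t
    using that by (intro fg) (auto simp: inv_into_into f_inv_into_f)
  then have "frag_extend (\<lambda>t. frag_of (g t)) a = frag_extend (\<lambda>t. frag_of (?h (f t))) a"
    using a by (intro frag_extend_eq) auto
  also have "\<dots> = frag_extend (\<lambda>y. frag_of (?h y)) (frag_extend (\<lambda>t. frag_of (f t)) a)"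
    using frag_extend_compose[of "\<lambda>y. frag_of (?h y)" f a] by (simp add: o_def)
  finally show ?thesis using assms by simp
qed

lemma frag_push_surj:
  assumes "Poly_Mapping.keys c \<subseteq> f ` A"
  obtains a where "Poly_Mapping.keys a \<subseteq> A" "c = frag_extend (\<lambda>t. frag_of (f t)) a"
proof
  let ?a = "frag_extend (frag_of \<circ> inv_into A f) c"
  show "Poly_Mapping.keys ?a \<subseteq> A"
    using keys_frag_extend[of "frag_of \<circ> inv_into A f" c] assms by (fastforce simp: inv_into_into)
  have "frag_extend (\<lambda>t. frag_of (f t)) ?a = frag_extend (\<lambda>y. frag_of (f (inv_into A f y))) c"
    using frag_extend_compose[of "\<lambda>t. frag_of (f t)" "inv_into A f" c] by (simp add: o_def)
  also have "\<dots> = frag_extend frag_of c"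
    using assms by (intro frag_extend_eq) (auto simp: f_inv_into_f)
  finally show "c = frag_extend (\<lambda>t. frag_of (f t)) ?a"
    using frag_expansion[of c] by simp
qed

lemma frag_sum_disjoint_eq_0:
  assumes "finite I" "(\<Sum>k\<in>I. z k) = (0 :: 'a \<Rightarrow>\<^sub>0 int)"
    and disj: "\<And>k l. k \<in> I \<Longrightarrow> l \<in> I \<Longrightarrow> k \<noteq> l \<Longrightarrow> Poly_Mapping.keys (z k) \<inter> Poly_Mapping.keys (z l) = {}"
    and "k \<in> I"
  shows "z k = 0"
proof (rule poly_mapping_eqI)
  fix y
  show "poly_mapping.lookup (z k) y = poly_mapping.lookup 0 y"
  proof (rule ccontr)
    assume "poly_mapping.lookup (z k) y \<noteq> poly_mapping.lookup 0 y"
    then have y: "y \<in> Poly_Mapping.keys (z k)" by (simp add: in_keys_iff)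
    have "0 = (\<Sum>l\<in>I. poly_mapping.lookup (z l) y)"
      using assms(2) by (metis lookup_sum lookup_zero)
    also have "\<dots> = (\<Sum>l\<in>I. if l = k then poly_mapping.lookup (z k) y else 0)"
    proof (rule sum.cong)
      fix l assume "l \<in> I"
      then have "l \<noteq> k \<Longrightarrow> y \<notin> Poly_Mapping.keys (z l)"
        using y disj[OF \<open>k \<in> I\<close>, of l] by blast
      then show "poly_mapping.lookup (z l) y = (if l = k then poly_mapping.lookup (z k) y else 0)"
        by (simp add: in_keys_iff)
    qed simp
    also have "\<dots> = poly_mapping.lookup (z k) y"
      using assms by simp
    finally show False using y by (simp add: in_keys_iff)
  qed
qed

section \<open>Singular chains spanned by the glued simplices\<close>

definition glued_simplex where
  "glued_simplex p \<kappa> t = restrict (\<lambda>x. (x, \<kappa> (supp x) t)) (standard_simplex p)"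

definition glued_chain where
  "glued_chain p \<kappa> a = frag_extend (\<lambda>t. frag_of (glued_simplex p \<kappa> t)) a"

text \<open>Push-forward of coefficients: the value at a label is the sum of \<open>a\<close> over
  all elements with that label. Its vanishing is the balance condition at the face
  \<open>F\<close>.\<close>

definition label_chain where
  "label_chain \<kappa> F a = frag_extend (\<lambda>t. frag_of (\<kappa> F t)) a"

text \<open>A point of full support: evaluating a face of a singular simplex here reads off the
  label of that entire face.\<close>

definition barycentre :: "nat \<Rightarrow> nat \<Rightarrow> real" where
  "barycentre p i = (if i \<le> p then 1 / real (Suc p) else 0)"

lemma barycentre: "barycentre p \<in> standard_simplex p"
  by (rule standard_simplexI) (auto simp: barycentre_def)

lemma supp_face: "supp (simplical_face k x) \<subseteq> - {k}"
  by (auto simp: supp_def simplical_face_def)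

lemma supp_face_barycentre: "k \<le> Suc n \<Longrightarrow> supp (simplical_face k (barycentre n)) = {..Suc n} - {k}"
  by (auto simp: supp_def simplical_face_def barycentre_def split: if_splits)

lemma singular_simplex_glued_simplex:
  "t \<in> T \<Longrightarrow> singular_simplex p (glued_space T \<kappa> (standard_simplex p)) (glued_simplex p \<kappa> t)"
  unfolding singular_simplex_def
proof
  assume t: "t \<in> T"
  from continuous_map_into_glued[OF t continuous_map_id, of "standard_simplex p" \<kappa>]
  show "continuous_map (rsub (standard_simplex p)) (glued_space T \<kappa> (standard_simplex p)) (glued_simplex p \<kappa> t)"
    by (rule continuous_map_eq) (simp add: glued_simplex_def)
qed (simp add: glued_simplex_def)

lemma singular_chain_glued_chain:
  "Poly_Mapping.keys a \<subseteq> T \<Longrightarrow> singular_chain p (glued_space T \<kappa> (standard_simplex p)) (glued_chain p \<kappa> a)"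
  unfolding glued_chain_def
  by (rule singular_chain_extend) (auto simp: singular_chain_of singular_simplex_glued_simplex)

lemma face_glued_simplex:
  assumes "k \<le> Suc n"
  shows "singular_face (Suc n) k (glued_simplex (Suc n) \<kappa> t) =
    restrict (\<lambda>x. (simplical_face k x, \<kappa> (supp (simplical_face k x)) t)) (standard_simplex n)"
  using assms by (auto simp: singular_face_def glued_simplex_def simplical_face_in_standard_simplex)

text \<open>The value at the barycentre of the face shows its label; conversely coherence passes
  equality of that label on to all smaller supports.\<close>

lemma face_glued_simplex_eq_iff:
  assumes "coherent (Suc n) T \<kappa>" "t \<in> T" "t' \<in> T" "k \<le> Suc n"
  shows "singular_face (Suc n) k (glued_simplex (Suc n) \<kappa> t) =
      singular_face (Suc n) k (glued_simplex (Suc n) \<kappa> t') \<longleftrightarrow>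
     \<kappa> ({..Suc n} - {k}) t = \<kappa> ({..Suc n} - {k}) t'"
  unfolding face_glued_simplex[OF assms(4)]
proof
  let ?f = "\<lambda>t. restrict (\<lambda>x. (simplical_face k x, \<kappa> (supp (simplical_face k x)) t)) (standard_simplex n)"
  assume "?f t = ?f t'"
  from fun_cong[OF this, of "barycentre n"]
  show "\<kappa> ({..Suc n} - {k}) t = \<kappa> ({..Suc n} - {k}) t'"
    by (simp add: barycentre supp_face_barycentre assms)
next
  let ?f = "\<lambda>t. restrict (\<lambda>x. (simplical_face k x, \<kappa> (supp (simplical_face k x)) t)) (standard_simplex n)"
  assume *: "\<kappa> ({..Suc n} - {k}) t = \<kappa> ({..Suc n} - {k}) t'"
  show "?f t = ?f t'"
  proof (rule restrict_ext)
    fix x assume "x \<in> standard_simplex n"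
    then have x: "simplical_face k x \<in> standard_simplex (Suc n)"
      using simplical_face_in_standard_simplex[of "Suc n" k x] assms by simp
    have "\<kappa> (supp (simplical_face k x)) t = \<kappa> (supp (simplical_face k x)) t'"
      by (rule coherentD[OF assms(1) *])
        (use supp_nonempty[OF x] supp_subset[OF x] supp_face[of k x] assms in auto)
    then show "(simplical_face k x, \<kappa> (supp (simplical_face k x)) t) =
        (simplical_face k x, \<kappa> (supp (simplical_face k x)) t')" by simp
  qed
qed

text \<open>Points of \<open>standard_simplex n\<close> vanish beyond \<open>n\<close>, so the
  inclusion of the last face leaves coordinates unchanged. Peeling off the last coordinate therefore
  needs no renumbering of labels.\<close>

lemma last_face_glued_simplex:
  "singular_face (Suc n) (Suc n) (glued_simplex (Suc n) \<kappa> t) = glued_simplex n \<kappa> t"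
proof -
  have "simplical_face (Suc n) x = x" if "x \<in> standard_simplex n" for x
    using that unfolding simplical_face_def standard_simplex_def by (auto simp: fun_eq_iff)
  then have "restrict (\<lambda>x. (simplical_face (Suc n) x, \<kappa> (supp (simplical_face (Suc n) x)) t)) (standard_simplex n)
      = glued_simplex n \<kappa> t"
    unfolding glued_simplex_def by (intro restrict_ext) simp
  then show ?thesis by (simp add: face_glued_simplex)
qed

definition face_chain where
  "face_chain n k \<kappa> a = frag_extend (\<lambda>t. frag_of (singular_face (Suc n) k (glued_simplex (Suc n) \<kappa> t))) a"

lemma last_face_chain: "face_chain n (Suc n) \<kappa> a = glued_chain n \<kappa> a"
  by (simp add: face_chain_def glued_chain_def last_face_glued_simplex)

lemma face_chain_eq_0_iff:
  assumes "coherent (Suc n) T \<kappa>" "Poly_Mapping.keys a \<subseteq> T" "k \<le> Suc n"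
  shows "face_chain n k \<kappa> a = 0 \<longleftrightarrow> label_chain \<kappa> ({..Suc n} - {k}) a = 0"
  using frag_push_eq_0[OF assms(2), of "\<lambda>t. singular_face (Suc n) k (glued_simplex (Suc n) \<kappa> t)" "\<kappa> ({..Suc n} - {k})"]
    frag_push_eq_0[OF assms(2), of "\<kappa> ({..Suc n} - {k})" "\<lambda>t. singular_face (Suc n) k (glued_simplex (Suc n) \<kappa> t)"]
    face_glued_simplex_eq_iff[OF assms(1) _ _ assms(3)]
  unfolding face_chain_def label_chain_def by blast

lemma frag_cmul_diff_distrib2: "frag_cmul c (a - b) = frag_cmul c a - frag_cmul c b"
  by (simp add: poly_mapping_eqI lookup_minus right_diff_distrib)

lemma chain_boundary_glued_chain:
  "chain_boundary (Suc n) (glued_chain (Suc n) \<kappa> a) =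
     (\<Sum>k\<le>Suc n. frag_cmul ((-1) ^ k) (face_chain n k \<kappa> a))"
proof -
  have "Poly_Mapping.keys a \<subseteq> UNIV" by simp
  then show ?thesis
    by (induction a rule: frag_induction)
      (simp_all add: glued_chain_def face_chain_def frag_extend_diff chain_boundary_diff
        chain_boundary_of frag_cmul_diff_distrib2 sum_subtractf)
qed


lemma keys_face_chain:
  "Poly_Mapping.keys (face_chain n k \<kappa> a) \<subseteq>
     (\<lambda>t. singular_face (Suc n) k (glued_simplex (Suc n) \<kappa> t)) ` Poly_Mapping.keys a"
  unfolding face_chain_def
  using keys_frag_extend[of "\<lambda>t. frag_of (singular_face (Suc n) k (glued_simplex (Suc n) \<kappa> t))" a] by auto

text \<open>Faces opposite to different vertices have different images, so the boundary vanishes only if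
  each of its face parts does.\<close>

lemma face_chain_eq_0_of_cycle:
  assumes "chain_boundary (Suc n) (glued_chain (Suc n) \<kappa> a) = 0" "k \<le> Suc n"
  shows "face_chain n k \<kappa> a = 0"
proof -
  have "frag_cmul ((-1) ^ k) (face_chain n k \<kappa> a) = 0"
  proof (rule frag_sum_disjoint_eq_0[where z = "\<lambda>k. frag_cmul ((-1) ^ k) (face_chain n k \<kappa> a)"])
    show "(\<Sum>k\<le>Suc n. frag_cmul ((-1) ^ k) (face_chain n k \<kappa> a)) = 0"
      using assms(1) by (simp add: chain_boundary_glued_chain)
    fix k l assume kl: "k \<in> {..Suc n}" "l \<in> {..Suc n}" "k \<noteq> l"
    have "singular_face (Suc n) k (glued_simplex (Suc n) \<kappa> t) \<noteq>
        singular_face (Suc n) l (glued_simplex (Suc n) \<kappa> t')" for t t'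
    proof
      assume "singular_face (Suc n) k (glued_simplex (Suc n) \<kappa> t) =
        singular_face (Suc n) l (glued_simplex (Suc n) \<kappa> t')"
      from fun_cong[OF this, of "barycentre n"]
      have "simplical_face k (barycentre n) = simplical_face l (barycentre n)"
        using kl by (simp add: face_glued_simplex barycentre)
      then have "{..Suc n} - {k} = {..Suc n} - {l}"
        using kl supp_face_barycentre by (metis atMost_iff)
      then show False using kl by blast
    qed
    then show "Poly_Mapping.keys (frag_cmul ((-1) ^ k) (face_chain n k \<kappa> a)) \<inter>
        Poly_Mapping.keys (frag_cmul ((-1) ^ l) (face_chain n l \<kappa> a)) = {}"
      using keys_face_chain[of n k \<kappa> a] keys_face_chain[of n l \<kappa> a] by fastforce
  qed (use assms in auto)
  then show ?thesis by simp
qed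

lemma chain_boundary_glued_chain_last:
  assumes "\<And>k. k \<le> n \<Longrightarrow> face_chain n k \<kappa> a = 0"
  shows "chain_boundary (Suc n) (glued_chain (Suc n) \<kappa> a) = frag_cmul ((-1) ^ Suc n) (glued_chain n \<kappa> a)"
  using assms by (simp add: chain_boundary_glued_chain last_face_chain)

lemma glued_chain_cmul: "glued_chain p \<kappa> (frag_cmul c a) = frag_cmul c (glued_chain p \<kappa> a)"
  by (simp add: glued_chain_def frag_extend_cmul)

lemma label_chain_cmul: "label_chain \<kappa> F (frag_cmul c a) = frag_cmul c (label_chain \<kappa> F a)"
  by (simp add: label_chain_def frag_extend_cmul)

text \<open>A map to a discrete space is constant on every singular 1-simplex, because that simplex
  is connected; its two ends cancel. This detects homology in degree 0.\<close>

lemma boundary_push_discrete: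
  assumes "singular_relboundary 0 X {} c" and r: "continuous_map X (discrete_topology U) r"
  shows "frag_extend (\<lambda>f. frag_of (r (f (\<lambda>j. if j = 0 then 1 else 0)))) c = 0"
proof -
  let ?e = "\<lambda>i j. if j = i then 1 else 0 :: real"
  obtain d where d: "singular_chain (Suc 0) X d" "c = chain_boundary (Suc 0) d"
    using assms(1) by (auto simp: singular_boundary)
  from d(1) have "Poly_Mapping.keys d \<subseteq> singular_simplex_set (Suc 0) X"
    by (simp add: singular_chain_def)
  then have "frag_extend (\<lambda>f. frag_of (r (f (?e 0)))) (chain_boundary (Suc 0) d) = 0"
  proof (induction d rule: frag_induction)
    case (one f)
    then have f: "continuous_map (rsub (standard_simplex (Suc 0))) X f"
      by (simp add: singular_simplex_def)
    have "connectedin (discrete_topology U) ((r \<circ> f) ` standard_simplex (Suc 0))"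
      using connectedin_continuous_map_image[OF continuous_map_compose[OF f r]]
        connectedin_standard_simplex
      by (simp add: connectedin_subtopology)
    then obtain u where u: "(r \<circ> f) ` standard_simplex (Suc 0) \<subseteq> {u}"
      by (auto simp: connectedin_discrete_topology)
    have face: "simplical_face 0 (?e 0) = ?e 1" "simplical_face (Suc 0) (?e 0) = ?e 0"
      by (auto simp: simplical_face_def fun_eq_iff)
    have "?e 0 \<in> standard_simplex (Suc 0)" "?e 1 \<in> standard_simplex (Suc 0)" by simp_all
    with u have "(r \<circ> f) (?e 0) \<in> {u}" "(r \<circ> f) (?e 1) \<in> {u}" by blast+
    then have "r (f (?e 0)) = u" "r (f (?e 1)) = u" by simp_all
    then show ?case
      using face basis_in_standard_simplex[of 0 0]
      by (simp add: chain_boundary_of frag_extend_diff singular_face_def)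
  qed (simp_all add: chain_boundary_diff frag_extend_diff)
  then show ?thesis by (simp add: d)
qed

section \<open>Comparison of pairs by excision\<close>

lemma image_topology_cong:
  assumes "\<And>x. x \<in> topspace X \<Longrightarrow> f x = g x"
  shows "image_topology X f = image_topology X g"
proof -
  have "f ` topspace X = g ` topspace X" using assms by auto
  moreover have "{x \<in> topspace X. f x \<in> W} = {x \<in> topspace X. g x \<in> W}" for W using assms by auto
  ultimately show ?thesis by (simp add: image_topology_def)
qed

lemma iso_cancel_right:
  assumes "f \<in> iso A B" "h \<in> iso A C" "g \<in> hom B C" "\<And>x. x \<in> carrier A \<Longrightarrow> g (f x) = h x"
  shows "g \<in> iso B C"
proof -
  have "bij_betw (g \<circ> f) (carrier A) (carrier C)"
    using assms(2,4) bij_betw_cong[of "carrier A" "g \<circ> f" h] by (simp add: iso_def)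
  then show ?thesis
    using assms(1,3) bij_betw_comp_iff[of f "carrier A" "carrier B" g] by (simp add: iso_def)
qed

lemma iso_cancel_left:
  assumes "g \<in> iso B C" "h \<in> iso A C" "f \<in> hom A B" "\<And>x. x \<in> carrier A \<Longrightarrow> g (f x) = h x"
  shows "f \<in> iso A B"
proof -
  have "bij_betw (g \<circ> f) (carrier A) (carrier C)"
    using assms(2,4) bij_betw_cong[of "carrier A" "g \<circ> f" h] by (simp add: iso_def)
  moreover have "f ` carrier A \<subseteq> carrier B"
    using assms(3) by (auto simp: hom_def)
  ultimately show ?thesis
    using assms(1,3) bij_betw_comp_iff2[of g "carrier B" "carrier C" f "carrier A"] by (simp add: iso_def)
qed

text \<open>The last face is closed and lies in its open collar, so it can be cut out. What remains
  has \<open>x (Suc n) > 0\<close>, where all supports contain \<open>Suc n\<close>.\<close>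

lemma excision_glued:
  assumes "coherent (Suc n) T \<kappa>"
  defines "S \<equiv> standard_simplex (Suc n)"
  defines "X \<equiv> glued_space T \<kappa> S"
    and "V \<equiv> glue_map \<kappa> ` ({x \<in> S. x (Suc n) < 1/2} \<times> T)"
  shows "hom_induced q (glued_space T \<kappa> {x \<in> S. x (Suc n) > 0})
           (glue_map \<kappa> ` ({x \<in> S. x (Suc n) > 0 \<and> x (Suc n) < 1/2} \<times> T)) X V id
         \<in> iso (relative_homology_group q (glued_space T \<kappa> {x \<in> S. x (Suc n) > 0})
           (glue_map \<kappa> ` ({x \<in> S. x (Suc n) > 0 \<and> x (Suc n) < 1/2} \<times> T))) (relative_homology_group q X V)"
proof -
  define Y where "Y = glue_map \<kappa> ` (standard_simplex n \<times> T)"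
  have face: "standard_simplex n = {x \<in> S. x (Suc n) = 0}" by (simp add: face_standard_simplex S_def)
  have nonneg: "x (Suc n) \<ge> 0" if "x \<in> S" for x
    using that by (simp add: S_def standard_simplex_def)
  have Y: "closedin X Y"
    unfolding X_def Y_def S_def by (rule closedin_glue_map_image[OF closedin_face])
  have V: "openin X V"
    unfolding X_def V_def S_def
    using openin_glue_map_image openin_simplex_halfspace[of "{..<1/2}" "Suc n" "Suc n"] by simp
  have "Y \<subseteq> V" unfolding Y_def V_def face by auto
  then have "X closure_of Y \<subseteq> X interior_of V"
    using Y V by (simp add: closure_of_closedin interior_of_openin)
  moreover have "V \<subseteq> topspace X" using openin_subset[OF V] .
  ultimately have "hom_induced q (subtopology X (topspace X - Y)) (V - Y) (subtopology X (topspace X)) V id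
     \<in> iso (relative_homology_group q (subtopology X (topspace X - Y)) (V - Y))
           (relative_homology_group q (subtopology X (topspace X)) V)"
    by (rule homology_excision_axiom)
  moreover have "topspace X - Y = glue_map \<kappa> ` ({x \<in> S. x (Suc n) > 0} \<times> T)"
    unfolding X_def Y_def topspace_glued_space face
    using nonneg by (force simp: glue_map_def)
  moreover have "V - Y = glue_map \<kappa> ` ({x \<in> S. x (Suc n) > 0 \<and> x (Suc n) < 1/2} \<times> T)"
    unfolding V_def Y_def face using nonneg by (force simp: glue_map_def)
  moreover have "subtopology X (glue_map \<kappa> ` ({x \<in> S. x (Suc n) > 0} \<times> T)) =
      glued_space T \<kappa> {x \<in> S. x (Suc n) > 0}"
    unfolding X_def S_def
    using openin_simplex_halfspace[of "{0<..}" "Suc n" "Suc n"]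
    by (intro subtopology_glued_space disjI1) simp
  ultimately show ?thesis by simp
qed

lemma label_compat_cone:
  assumes "coherent p T \<kappa>" "j \<le> p"
  shows "label_compat T (\<lambda>F. \<kappa> (insert j F)) \<kappa> (standard_simplex p) (\<lambda>x. x)"
  unfolding label_compat_def
proof (intro ballI impI)
  fix x t t'
  assume *: "x \<in> standard_simplex p" "t \<in> T" "t' \<in> T" "\<kappa> (insert j (supp x)) t = \<kappa> (insert j (supp x)) t'"
  show "\<kappa> (supp x) t = \<kappa> (supp x) t'"
    by (rule coherentD[OF assms(1) *(4)]) (use * supp_subset[OF *(1)] supp_nonempty assms in auto)
qed

text \<open>Away from the last face both spaces agree, so that excision compares the two pairs.\<close>

lemma cone_pair_iso:
  assumes coh: "coherent (Suc n) T \<kappa>"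
  defines "\<kappa>' \<equiv> \<lambda>F. \<kappa> (insert (Suc n) F)"
  defines "X \<equiv> glued_space T \<kappa> (standard_simplex (Suc n))"
    and "X' \<equiv> glued_space T \<kappa>' (standard_simplex (Suc n))"
    and "Y \<equiv> glue_map \<kappa> ` (standard_simplex n \<times> T)"
    and "Y' \<equiv> glue_map \<kappa>' ` (standard_simplex n \<times> T)"
    and "h \<equiv> glued_map T \<kappa>' \<kappa> (\<lambda>x. x)"
  shows "continuous_map X' X h" "h \<in> Y' \<rightarrow> Y"
    "hom_induced q X' Y' X Y h \<in> iso (relative_homology_group q X' Y') (relative_homology_group q X Y)"
proof -
  let ?S = "standard_simplex (Suc n)"
  have coh': "coherent (Suc n) T \<kappa>'" unfolding \<kappa>'_def by (rule coherent_insert[OF coh]) simp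
  have compat: "label_compat T \<kappa>' \<kappa> ?S (\<lambda>x. x)"
    unfolding \<kappa>'_def by (rule label_compat_cone[OF coh]) simp
  show h: "continuous_map X' X h"
    unfolding X'_def X_def h_def by (rule continuous_glued_map[OF compat]) simp
  have hmap: "h \<in> glue_map \<kappa>' ` (A \<times> T) \<rightarrow> glue_map \<kappa> ` (A \<times> T)" if "A \<subseteq> ?S" for A
  proof
    fix y assume "y \<in> glue_map \<kappa>' ` (A \<times> T)"
    then obtain x t where y: "y = (x, \<kappa>' (supp x) t)" "x \<in> A" "t \<in> T"
      by (auto simp: glue_map_def)
    then have "h y = glue_map \<kappa> (x, t)"
      using that glued_map_eq[OF compat] by (auto simp: glue_map_def h_def)
    then show "h y \<in> glue_map \<kappa> ` (A \<times> T)" using y by auto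
  qed
  have face: "standard_simplex n = {x \<in> ?S. x (Suc n) = 0}" by (simp add: face_standard_simplex)
  show hY: "h \<in> Y' \<rightarrow> Y" unfolding Y_def Y'_def face by (rule hmap) auto
  define V where "V = glue_map \<kappa> ` ({x \<in> ?S. x (Suc n) < 1/2} \<times> T)"
  define V' where "V' = glue_map \<kappa>' ` ({x \<in> ?S. x (Suc n) < 1/2} \<times> T)"
  define U where "U = glued_space T \<kappa> {x \<in> ?S. x (Suc n) > 0}"
  define W where "W = glue_map \<kappa> ` ({x \<in> ?S. x (Suc n) > 0 \<and> x (Suc n) < 1/2} \<times> T)"
  have hV: "h \<in> V' \<rightarrow> V" unfolding V_def V'_def by (rule hmap) auto
  \<comment> \<open>With \<open>x (Suc n) > 0\<close> the support already contains
    \<open>Suc n\<close>, so inserting it changes no label.\<close>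
  have same: "glue_map \<kappa>' (x, t) = glue_map \<kappa> (x, t)" if "x (Suc n) > 0" for x t
    using that by (auto simp: glue_map_def \<kappa>'_def insert_absorb supp_def)
  have U': "U = glued_space T \<kappa>' {x \<in> ?S. x (Suc n) > 0}"
    unfolding U_def glued_space_def by (rule image_topology_cong) (auto simp: same)
  have W': "W = glue_map \<kappa>' ` ({x \<in> ?S. x (Suc n) > 0 \<and> x (Suc n) < 1/2} \<times> T)"
    unfolding W_def by (rule image_cong) (auto simp: same)
  have exc: "hom_induced q U W X V id \<in> iso (relative_homology_group q U W) (relative_homology_group q X V)"
    unfolding U_def W_def X_def V_def by (rule excision_glued[OF coh])
  have exc': "hom_induced q U W X' V' id \<in> iso (relative_homology_group q U W) (relative_homology_group q X' V')"
    unfolding U' W' X'_def V'_def by (rule excision_glued[OF coh'])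
  have Uc: "continuous_map U X' id"
  proof -
    have "openin (rsub ?S) {x \<in> ?S. x (Suc n) > 0}"
      using openin_simplex_halfspace[of "{0<..}" "Suc n" "Suc n"] by simp
    then have "U = subtopology X' (glue_map \<kappa>' ` ({x \<in> ?S. x (Suc n) > 0} \<times> T))"
      unfolding U' X'_def by (simp add: subtopology_glued_space)
    then show ?thesis by (simp add: continuous_map_from_subtopology)
  qed
  have WV: "id \<in> W \<rightarrow> V'" unfolding W' V'_def by auto
  \<comment> \<open>Both collar pairs excise to the same pair \<open>(U, W)\<close>, on which
    \<open>h\<close> is the identity.\<close>
  have "hom_induced q X' V' X V h \<in> iso (relative_homology_group q X' V') (relative_homology_group q X V)"
  proof (rule iso_cancel_right[OF exc' exc hom_induced_hom])
    fix x
    have "hom_induced q X' V' X V h (hom_induced q U W X' V' id x) = hom_induced q U W X V (h \<circ> id) x"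
      by (rule hom_induced_compose'[OF Uc WV h hV])
    also have "hom_induced q U W X V (h \<circ> id) = hom_induced q U W X V id"
    proof (rule hom_induced_eq)
      fix y assume "y \<in> topspace U"
      then obtain x t where y: "y = (x, \<kappa>' (supp x) t)" "x \<in> ?S" "x (Suc n) > 0" "t \<in> T"
        unfolding U' by (auto simp: topspace_glued_space glue_map_def)
      then show "(h \<circ> id) y = id y"
        using glued_map_eq[OF compat y(2,4)] same[of x t] by (simp add: h_def glue_map_def)
    qed
    finally show "hom_induced q X' V' X V h (hom_induced q U W X' V' id x) = hom_induced q U W X V id x" .
  qed
  moreover have "hom_induced q X' Y' X' V' id \<in> iso (relative_homology_group q X' Y') (relative_homology_group q X' V')"
    unfolding X'_def Y'_def V'_def by (rule collar_iso[OF coh'])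
  ultimately have 1: "hom_induced q X' V' X V h \<circ> hom_induced q X' Y' X' V' id
      \<in> iso (relative_homology_group q X' Y') (relative_homology_group q X V)"
    using iso_set_trans by blast
  have 2: "hom_induced q X Y X V id \<in> iso (relative_homology_group q X Y) (relative_homology_group q X V)"
    unfolding X_def Y_def V_def by (rule collar_iso[OF coh])
  have YV: "id \<in> Y \<rightarrow> V" and YV': "id \<in> Y' \<rightarrow> V'"
    unfolding Y_def V_def Y'_def V'_def face by auto
  show "hom_induced q X' Y' X Y h \<in> iso (relative_homology_group q X' Y') (relative_homology_group q X Y)"
  proof (rule iso_cancel_left[OF 2 1 hom_induced_hom])
    fix x
    have "hom_induced q X Y X V id (hom_induced q X' Y' X Y h x) = hom_induced q X' Y' X V (id \<circ> h) x"
      by (rule hom_induced_compose'[OF h hY continuous_map_id YV])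
    also have "\<dots> = hom_induced q X' Y' X V (h \<circ> id) x" by simp
    also have "\<dots> = hom_induced q X' V' X V h (hom_induced q X' Y' X' V' id x)"
      by (rule hom_induced_compose'[OF continuous_map_id YV' h hV, symmetric])
    finally show "hom_induced q X Y X V id (hom_induced q X' Y' X Y h x) =
        (hom_induced q X' V' X V h \<circ> hom_induced q X' Y' X' V' id) x" by simp
  qed
qed

section \<open>The top homology of a glued space\<close>

lemma inj_hom_of_trivial_kernel:
  assumes "group G" "group H" "f \<in> hom G H" "kernel G H f \<subseteq> {\<one>\<^bsub>G\<^esub>}"
  shows "inj_on f (carrier G)"
proof -
  interpret group_hom G H f using assms by (simp add: group_hom_def group_hom_axioms_def)
  show ?thesis
    using assms(4) inj_iff_trivial_ker by (auto simp: kernel_def)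
qed

lemma inj_one:
  assumes "group G" "group H" "f \<in> hom G H" "inj_on f (carrier G)" "x \<in> carrier G" "f x = \<one>\<^bsub>H\<^esub>"
  shows "x = \<one>\<^bsub>G\<^esub>"
proof -
  have "f x = f \<one>\<^bsub>G\<^esub>" using assms hom_one[OF assms(3)] by simp
  then show ?thesis
    using assms by (meson group.is_monoid inj_onD monoid.one_closed)
qed

lemma trivial_group_of_inj:
  assumes "inj_on f (carrier G)" "f \<in> hom G H" "trivial_group H" "group G" "group H"
  shows "trivial_group G"
proof -
  have "x = \<one>\<^bsub>G\<^esub>" if x: "x \<in> carrier G" for x
  proof (rule inj_one[OF assms(4,5,2,1) x])
    show "f x = \<one>\<^bsub>H\<^esub>"
      using hom_in_carrier[OF assms(2) x] assms(3) by (simp add: trivial_group_def)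
  qed
  moreover have "\<one>\<^bsub>G\<^esub> \<in> carrier G" by (rule monoid.one_closed[OF group.is_monoid[OF assms(4)]])
  ultimately have "carrier G = {\<one>\<^bsub>G\<^esub>}" by blast
  with assms(4) show ?thesis by (simp add: trivial_group_def)
qed

lemma iso_surj: "f \<in> iso G H \<Longrightarrow> y \<in> carrier H \<Longrightarrow> \<exists>x\<in>carrier G. f x = y"
  unfolding iso_def bij_betw_def by (simp add: set_eq_iff image_iff) metis

lemma iso_inj: "f \<in> iso G H \<Longrightarrow> inj_on f (carrier G)"
  by (auto simp: iso_def bij_betw_def)

lemma inj_relativization:
  assumes "trivial_group (homology_group q (subtopology X S))"
  shows "inj_on (hom_induced q X {} X S id) (carrier (homology_group q X))"
proof (rule inj_hom_of_trivial_kernel[OF _ _ hom_induced_hom])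
  have "kernel (homology_group q X) (relative_homology_group q X S) (hom_induced q X {} X S id) =
      hom_induced q (subtopology X S) {} X {} id ` carrier (homology_group q (subtopology X S))"
    using homology_exactness_axiom_3[of q X S] by simp
  also have "\<dots> \<subseteq> {\<one>\<^bsub>homology_group q X\<^esub>}"
    using assms hom_one[OF hom_induced_empty_hom[of q "subtopology X S" X id]]
    by (simp add: trivial_group_def)
  finally show "kernel (homology_group q X) (relative_homology_group q X S) (hom_induced q X {} X S id)
      \<subseteq> {\<one>\<^bsub>homology_group q X\<^esub>}" .
qed auto

lemma inj_hom_boundary:
  assumes "trivial_group (homology_group q X)"
  shows "inj_on (hom_boundary q X S) (carrier (relative_homology_group q X S))"
proof (rule inj_hom_of_trivial_kernel[OF _ _ hom_boundary_hom])
  have "kernel (relative_homology_group q X S) (homology_group (q - 1) (subtopology X S)) (hom_boundary q X S) =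
      hom_induced q X {} X S id ` carrier (homology_group q X)"
    using homology_exactness_axiom_1[of q X S] by simp
  also have "\<dots> \<subseteq> {\<one>\<^bsub>relative_homology_group q X S\<^esub>}"
    using assms hom_one[OF hom_induced_hom[of q X "{}" X S id]] by (simp add: trivial_group_def)
  finally show "kernel (relative_homology_group q X S) (homology_group (q - 1) (subtopology X S)) (hom_boundary q X S)
      \<subseteq> {\<one>\<^bsub>relative_homology_group q X S\<^esub>}" .
qed auto

text \<open>The guard \<open>p > 0\<close> is needed since every 0-chain is a cycle, whereas the
  formula would impose a condition at the empty face.\<close>

definition label_cycle :: "nat \<Rightarrow> 'a set \<Rightarrow> (nat set \<Rightarrow> 'a \<Rightarrow> 'b) \<Rightarrow> ('a \<Rightarrow>\<^sub>0 int) \<Rightarrow> bool" where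
  "label_cycle p T \<kappa> a \<longleftrightarrow> Poly_Mapping.keys a \<subseteq> T \<and>
     (p > 0 \<longrightarrow> (\<forall>k\<le>p. label_chain \<kappa> ({..p} - {k}) a = 0))"

lemma label_cycle_iff:
  assumes "coherent p T \<kappa>" "Poly_Mapping.keys a \<subseteq> T"
  shows "label_cycle p T \<kappa> a \<longleftrightarrow> singular_relcycle p (glued_space T \<kappa> (standard_simplex p)) {} (glued_chain p \<kappa> a)"
proof (cases p)
  case 0
  then show ?thesis
    using assms singular_chain_glued_chain[OF assms(2)]
    by (simp add: label_cycle_def singular_cycle chain_boundary_def)
next
  case (Suc n)
  have *: "label_chain \<kappa> ({..Suc n} - {k}) a = 0 \<longleftrightarrow> face_chain n k \<kappa> a = 0" if "k \<le> Suc n" for k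
    using face_chain_eq_0_iff[OF assms[unfolded Suc] that] by simp
  have "chain_boundary (Suc n) (glued_chain (Suc n) \<kappa> a) = 0 \<longleftrightarrow> (\<forall>k\<le>Suc n. face_chain n k \<kappa> a = 0)"
  proof
    assume "\<forall>k\<le>Suc n. face_chain n k \<kappa> a = 0"
    then show "chain_boundary (Suc n) (glued_chain (Suc n) \<kappa> a) = 0"
      unfolding chain_boundary_glued_chain by (intro sum.neutral) simp
  qed (use face_chain_eq_0_of_cycle[of n \<kappa> a] in blast)
  then show ?thesis
    using assms(2) singular_chain_glued_chain[OF assms(2), of "Suc n" \<kappa>] *
    unfolding Suc label_cycle_def singular_cycle by blast
qed

lemma chain_map_glued_chain:
  assumes "label_compat T \<kappa>' \<kappa> (standard_simplex p) (\<lambda>x. x)" "Poly_Mapping.keys a \<subseteq> T"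
  shows "chain_map p (glued_map T \<kappa>' \<kappa> (\<lambda>x. x)) (glued_chain p \<kappa>' a) = glued_chain p \<kappa> a"
proof -
  have "simplex_map p (glued_map T \<kappa>' \<kappa> (\<lambda>x. x)) (glued_simplex p \<kappa>' t) = glued_simplex p \<kappa> t" if "t \<in> T" for t
    unfolding simplex_map_def glued_simplex_def
    by (rule restrict_ext) (use that in \<open>simp add: glued_map_eq[OF assms(1)]\<close>)
  then have "frag_extend (\<lambda>t. frag_of (simplex_map p (glued_map T \<kappa>' \<kappa> (\<lambda>x. x)) (glued_simplex p \<kappa>' t))) a =
      glued_chain p \<kappa> a"
    unfolding glued_chain_def using assms(2) by (intro frag_extend_eq) auto
  then show ?thesis
    unfolding chain_map_def glued_chain_def
    using frag_extend_compose[of "frag_of \<circ> simplex_map p (glued_map T \<kappa>' \<kappa> (\<lambda>x. x))" "glued_simplex p \<kappa>'" a]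
    by (simp add: o_def)
qed

text \<open>The three parts of the induction hypothesis. Vanishing above degree \<open>p\<close>
  makes the passage to relative homology injective; the second part supplies explicit
  representatives; the third is the detection statement. As the full label may fail to be injective,
  only its sums can be detected.\<close>

definition top_homology_labels :: "nat \<Rightarrow> 'a set \<Rightarrow> (nat set \<Rightarrow> 'a \<Rightarrow> 'b) \<Rightarrow> bool" where
  "top_homology_labels p T \<kappa> \<longleftrightarrow>
     (let X = glued_space T \<kappa> (standard_simplex p) in
      (\<forall>q>int p. trivial_group (homology_group q X)) \<and>
      (\<forall>c\<in>carrier (homology_group (int p) X). \<exists>a. label_cycle p T \<kappa> a \<and>
         c = homologous_rel_set p X {} (glued_chain p \<kappa> a)) \<and>
      (\<forall>a. Poly_Mapping.keys a \<subseteq> T \<longrightarrow> singular_relboundary p X {} (glued_chain p \<kappa> a) \<longrightarrow>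
         label_chain \<kappa> {..p} a = 0))"

lemma top_homology_labelsD:
  assumes "top_homology_labels p T \<kappa>"
  shows "\<And>q. q > int p \<Longrightarrow> trivial_group (homology_group q (glued_space T \<kappa> (standard_simplex p)))"
    and "\<And>c. c \<in> carrier (homology_group (int p) (glued_space T \<kappa> (standard_simplex p))) \<Longrightarrow>
      \<exists>a. label_cycle p T \<kappa> a \<and>
        c = homologous_rel_set p (glued_space T \<kappa> (standard_simplex p)) {} (glued_chain p \<kappa> a)"
    and "\<And>a. Poly_Mapping.keys a \<subseteq> T \<Longrightarrow>
      singular_relboundary p (glued_space T \<kappa> (standard_simplex p)) {} (glued_chain p \<kappa> a) \<Longrightarrow>
      label_chain \<kappa> {..p} a = 0"
  using assms unfolding top_homology_labels_def Let_def by simp_all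

section \<open>Induction on the dimension\<close>

lemma top_homology_labels_0: "top_homology_labels 0 T \<kappa>"
proof -
  define e where "e = (\<lambda>j::nat. if j = 0 then 1 else 0 :: real)"
  let ?X = "glued_space T \<kappa> (standard_simplex 0)"
  have S: "standard_simplex 0 = {e}" by (simp add: standard_simplex_0 e_def)
  have X: "?X = discrete_topology (glue_map \<kappa> ` ({e} \<times> T))"
    unfolding S by (rule discrete_glued_space_singleton)
  have se: "supp e = {0}" by (auto simp: supp_def e_def)
  have 1: "trivial_group (homology_group q ?X)" if "q > 0" for q
    unfolding X by (rule trivial_homology_discrete) (use that in simp)
  have 2: "\<exists>a. label_cycle 0 T \<kappa> a \<and> c = homologous_rel_set 0 ?X {} (glued_chain 0 \<kappa> a)"
    if "c \<in> carrier (homology_group 0 ?X)" for c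
  proof -
    obtain z where z: "singular_relcycle 0 ?X {} z" "c = homologous_rel_set 0 ?X {} z"
      using \<open>c \<in> carrier (homology_group 0 ?X)\<close> by (auto simp: carrier_relative_homology_group_0)
    \<comment> \<open>In dimension 0 a singular simplex is just a point of the space, and each such
      point lies on a glued simplex.\<close>
    have "f \<in> glued_simplex 0 \<kappa> ` T" if "singular_simplex 0 ?X f" for f
    proof -
      have f: "continuous_map (rsub {e}) ?X f" "f \<in> extensional {e}"
        using that by (simp_all add: singular_simplex_def S)
      then have "f e \<in> topspace ?X" using continuous_map_image_subset_topspace by fastforce
      then obtain t where t: "t \<in> T" "f e = (e, \<kappa> (supp e) t)"
        by (auto simp: topspace_glued_space glue_map_def S)
      then have "f = glued_simplex 0 \<kappa> t"
        using f(2) by (simp add: glued_simplex_def S extensional_def restrict_def fun_eq_iff[of f])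
      then show ?thesis using t by blast
    qed
    then have "Poly_Mapping.keys z \<subseteq> glued_simplex 0 \<kappa> ` T"
      using z(1) by (auto simp: singular_cycle singular_chain_def)
    then obtain a where "Poly_Mapping.keys a \<subseteq> T" "z = glued_chain 0 \<kappa> a"
      unfolding glued_chain_def by (rule frag_push_surj)
    then show ?thesis using z by (auto simp: label_cycle_def)
  qed
  have 3: "label_chain \<kappa> {..0} a = 0"
    if a: "Poly_Mapping.keys a \<subseteq> T" and "singular_relboundary 0 ?X {} (glued_chain 0 \<kappa> a)" for a
  proof -
    have "continuous_map ?X (discrete_topology (glue_map \<kappa> ` ({e} \<times> T))) id" unfolding X by simp
    from boundary_push_discrete[OF that(2) this]
    have "frag_extend (\<lambda>f. frag_of (f e)) (glued_chain 0 \<kappa> a) = 0" by (simp add: e_def)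
    then have "frag_extend (\<lambda>t. frag_of (glued_simplex 0 \<kappa> t e)) a = 0"
      using frag_extend_compose[of "\<lambda>f. frag_of (f e)" "glued_simplex 0 \<kappa>" a]
      by (simp add: glued_chain_def o_def)
    then have "frag_extend (\<lambda>t. frag_of (e, \<kappa> {0} t)) a = 0"
      by (simp add: glued_simplex_def S se)
    from frag_push_eq_0[OF a this, of "\<kappa> {0}"] show ?thesis by (simp add: label_chain_def)
  qed
  show ?thesis unfolding top_homology_labels_def Let_def using 1 2 3 by simp
qed

text \<open>The step from \<open>n\<close> to \<open>Suc n\<close>. \<open>Y\<close> and
  \<open>Y'\<close> are themselves glued spaces over \<open>standard_simplex n\<close>, so the
  induction hypothesis applies to them with labels \<open>\<kappa>\<close> and
  \<open>\<kappa>'\<close>.\<close>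

locale cone_step =
  fixes n :: nat and T :: "'a set" and \<kappa> :: "nat set \<Rightarrow> 'a \<Rightarrow> 'b"
  assumes coh: "coherent (Suc n) T \<kappa>"
begin

abbreviation (input) "\<kappa>' \<equiv> \<lambda>F. \<kappa> (insert (Suc n) F)"
abbreviation (input) "X \<equiv> glued_space T \<kappa> (standard_simplex (Suc n))"
abbreviation (input) "X' \<equiv> glued_space T \<kappa>' (standard_simplex (Suc n))"
abbreviation (input) "Y \<equiv> glue_map \<kappa> ` (standard_simplex n \<times> T)"
abbreviation (input) "Y' \<equiv> glue_map \<kappa>' ` (standard_simplex n \<times> T)"
abbreviation (input) "h \<equiv> glued_map T \<kappa>' \<kappa> (\<lambda>x. x)"

lemma coherent_cone: "coherent (Suc n) T \<kappa>'"
  by (rule coherent_insert[OF coh]) simp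

lemma sub_Y: "subtopology X Y = glued_space T \<kappa> (standard_simplex n)"
  using subtopology_glued_space closedin_face by blast

lemma sub_Y': "subtopology X' Y' = glued_space T \<kappa>' (standard_simplex n)"
  using subtopology_glued_space closedin_face by blast

lemma compat_face: "label_compat T \<kappa>' \<kappa> (standard_simplex n) (\<lambda>x. x)"
  using label_compat_cone[OF coh order_refl] standard_simplex_mono[OF le_SucI[OF order_refl[of n]]]
  unfolding label_compat_def by blast

lemma label_chain_cone: "k \<le> n \<Longrightarrow> label_chain \<kappa>' (A - {k}) a = label_chain \<kappa> (insert (Suc n) A - {k}) a"
  by (simp add: label_chain_def insert_Diff_if)

text \<open>Balance at the faces \<open>k \<le> n\<close> kills every part of the boundary except
  the last face, which enters with sign \<open>(-1) ^ Suc n\<close>. The factor in \<open>b\<close>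
  cancels this sign, so the coned chain bounds exactly the given chain of \<open>Y'\<close>.\<close>

lemma cone_relcycle:
  assumes a: "Poly_Mapping.keys a \<subseteq> T" and "\<And>k. k \<le> n \<Longrightarrow> label_chain \<kappa> ({..Suc n} - {k}) a = 0"
  defines "b \<equiv> frag_cmul ((-1) ^ Suc n) a"
  shows "chain_boundary (Suc n) (glued_chain (Suc n) \<kappa>' b) = glued_chain n \<kappa>' a"
    and "singular_relcycle (Suc n) X' Y' (glued_chain (Suc n) \<kappa>' b)"
proof -
  have "label_chain \<kappa>' ({..Suc n} - {k}) a = 0" if "k \<le> n" for k
    using assms(2)[OF that] label_chain_cone[OF that, of "{..Suc n}" a] by (simp add: insert_absorb)
  then have "face_chain n k \<kappa>' a = 0" if "k \<le> n" for k
    using face_chain_eq_0_iff[OF coherent_cone a, of k] that by simp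
  then have "chain_boundary (Suc n) (glued_chain (Suc n) \<kappa>' a) = frag_cmul ((-1) ^ Suc n) (glued_chain n \<kappa>' a)"
    by (rule chain_boundary_glued_chain_last)
  moreover have "(-1) ^ Suc n * (-1) ^ Suc n = (1::int)"
    by (simp flip: power_mult_distrib)
  ultimately show *: "chain_boundary (Suc n) (glued_chain (Suc n) \<kappa>' b) = glued_chain n \<kappa>' a"
    by (simp only: b_def glued_chain_cmul chain_boundary_cmul frag_cmul_cmul frag_cmul_one)
  have "Poly_Mapping.keys b \<subseteq> T" using a keys_cmul[of _ a] by (auto simp: b_def)
  then show "singular_relcycle (Suc n) X' Y' (glued_chain (Suc n) \<kappa>' b)"
    using singular_chain_glued_chain[of b T "Suc n" \<kappa>'] singular_chain_glued_chain[OF a, of n \<kappa>']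
    by (simp add: singular_relcycle * sub_Y')
qed

text \<open>The group embeds into \<open>H_q(X, Y)\<close>, as \<open>H_q(Y)\<close> vanishes; this
  is isomorphic to \<open>H_q(X', Y')\<close>, which the boundary map embeds into
  \<open>H_(q-1)(Y') = 0\<close>.\<close>

lemma top_homology_labels_Suc_trivial:
  assumes IH: "top_homology_labels n T \<kappa>" and IH': "top_homology_labels n T \<kappa>'" and q: "q > int (Suc n)"
  shows "trivial_group (homology_group q X)"
proof -
  note cone = cone_pair_iso[OF coh]
  have tY: "trivial_group (homology_group q (subtopology X Y))"
    using top_homology_labelsD(1)[OF IH] q unfolding sub_Y by simp
  have tY': "trivial_group (homology_group (q - 1) (subtopology X' Y'))"
    using top_homology_labelsD(1)[OF IH'] q unfolding sub_Y' by simp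
  have tX': "trivial_group (homology_group q X')"
    by (rule trivial_homology_cones[OF coh]) (use q in simp)
  have "trivial_group (relative_homology_group q X' Y')"
    using trivial_group_of_inj[OF inj_hom_boundary[OF tX'] hom_boundary_hom tY'] by simp
  then have "trivial_group (relative_homology_group q X Y)"
    using cone(3) isomorphic_group_triviality is_isoI by (metis group_relative_homology_group)
  then show ?thesis
    using trivial_group_of_inj[OF inj_relativization[OF tY] hom_induced_hom] by simp
qed

text \<open>A bounding chain is zero in \<open>H(X, Y)\<close>, hence its lift is zero in
  \<open>H(X', Y')\<close>, hence the boundary of the lift bounds in \<open>Y'\<close>. Detection
  there concerns \<open>\<kappa>'\<close> at \<open>{..n}\<close>, which is \<open>\<kappa>\<close>
  at \<open>{..Suc n}\<close>.\<close>

lemma top_homology_labels_Suc_inj: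
  assumes IH': "top_homology_labels n T \<kappa>'"
    and a: "Poly_Mapping.keys a \<subseteq> T" and bd: "singular_relboundary (Suc n) X {} (glued_chain (Suc n) \<kappa> a)"
  shows "label_chain \<kappa> {..Suc n} a = 0"
proof -
  note cone = cone_pair_iso[OF coh]
  have "singular_relcycle (Suc n) X {} (glued_chain (Suc n) \<kappa> a)"
    using bd singular_relboundary_imp_relcycle by blast
  then have "label_cycle (Suc n) T \<kappa> a" using label_cycle_iff[OF coh a] by simp
  then have lc: "label_chain \<kappa> ({..Suc n} - {k}) a = 0" if "k \<le> n" for k
    using that by (simp add: label_cycle_def)
  define b where "b = frag_cmul ((-1) ^ Suc n) a"
  have b: "Poly_Mapping.keys b \<subseteq> T" using a keys_cmul[of _ a] by (auto simp: b_def)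
  note rc = cone_relcycle[OF a lc, folded b_def]
  have "singular_relboundary (Suc n) X {} (glued_chain (Suc n) \<kappa> b)"
    unfolding b_def glued_chain_cmul by (rule singular_relboundary_cmul[OF bd])
  then have bdY: "singular_relboundary (Suc n) X Y (glued_chain (Suc n) \<kappa> b)"
    using singular_relboundary_chain_map[of "Suc n" X "{}" _ X id Y]
      chain_map_ident[OF singular_relboundary_imp_chain] by (metis Pi_empty UNIV_I continuous_map_id)
  let ?c = "homologous_rel_set (Suc n) X' Y' (glued_chain (Suc n) \<kappa>' b)"
  have c: "?c \<in> carrier (relative_homology_group (int (Suc n)) X' Y')"
    using rc(2) by (auto simp del: of_nat_Suc simp: carrier_relative_homology_group)
  have "hom_induced (int (Suc n)) X' Y' X Y h ?c =
      homologous_rel_set (Suc n) X Y (chain_map (Suc n) h (glued_chain (Suc n) \<kappa>' b))"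
    by (rule hom_induced_chain_map[OF cone(1,2) rc(2)])
  also have "\<dots> = \<one>\<^bsub>relative_homology_group (int (Suc n)) X Y\<^esub>"
    unfolding chain_map_glued_chain[OF label_compat_cone[OF coh order_refl] b] one_relative_homology_group
    using bdY by (simp add: homologous_rel_set_eq_relboundary)
  finally have "hom_induced (int (Suc n)) X' Y' X Y h ?c = \<one>\<^bsub>relative_homology_group (int (Suc n)) X Y\<^esub>" .
  then have c1: "?c = \<one>\<^bsub>relative_homology_group (int (Suc n)) X' Y'\<^esub>"
    by (rule inj_one[OF _ _ hom_induced_hom iso_inj[OF cone(3)] c, rotated 2]) auto
  have "homologous_rel_set n (subtopology X' Y') {} (glued_chain n \<kappa>' a) = hom_boundary (int (Suc n)) X' Y' ?c"
    using hom_boundary_chain_boundary[OF rc(2)] rc(1) by simp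
  also have "\<dots> = \<one>\<^bsub>homology_group (int (Suc n) - 1) (subtopology X' Y')\<^esub>"
    unfolding c1 by (rule hom_one[OF hom_boundary_hom]) auto
  also have "\<dots> = singular_relboundary_set n (subtopology X' Y') {}" by simp
  finally have "singular_relboundary n (subtopology X' Y') {} (glued_chain n \<kappa>' a)"
    by (simp add: homologous_rel_set_eq_relboundary)
  then have "label_chain \<kappa>' {..n} a = 0"
    using top_homology_labelsD(3)[OF IH' a] unfolding sub_Y' by simp
  then show ?thesis by (simp add: label_chain_def atMost_Suc)
qed

text \<open>A substitute for reduced homology when the base has dimension 0: collapsing each cone to
  its apex maps to a discrete space, so a boundary has coefficient sum zero on each cone, and the
  cones are indexed by the labels of \<open>{Suc n}\<close>.\<close>

lemma cone_zero_chain: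
  assumes a: "Poly_Mapping.keys a \<subseteq> T" and "singular_relboundary 0 X' {} (glued_chain 0 \<kappa>' a)"
  shows "label_chain \<kappa> {Suc n} a = 0"
proof -
  define e where "e = (\<lambda>j. if j = Suc n then 1 else 0 :: real)"
  define e0 where "e0 = (\<lambda>j::nat. if j = 0 then 1 else 0 :: real)"
  have e: "e \<in> standard_simplex (Suc n)" by (simp add: e_def)
  have e0: "e0 \<in> standard_simplex (Suc n)" "e0 \<in> standard_simplex 0" by (simp_all add: e0_def)
  have se: "supp e = {Suc n}" by (auto simp: supp_def e_def)
  have compat: "label_compat T \<kappa>' \<kappa>' (standard_simplex (Suc n)) (\<lambda>_. e)"
    unfolding label_compat_def
  proof (intro ballI impI)
    fix x t t' assume *: "x \<in> standard_simplex (Suc n)" "t \<in> T" "t' \<in> T" "\<kappa>' (supp x) t = \<kappa>' (supp x) t'"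
    show "\<kappa>' (supp e) t = \<kappa>' (supp e) t'"
      by (rule coherentD[OF coh *(4)]) (use * supp_subset[OF *(1)] se in auto)
  qed
  have "continuous_map X' (glued_space T \<kappa>' {e}) (glued_map T \<kappa>' \<kappa>' (\<lambda>_. e))"
    by (rule continuous_glued_map[OF compat]) simp
  then have "frag_extend (\<lambda>f. frag_of (glued_map T \<kappa>' \<kappa>' (\<lambda>_. e) (f e0))) (glued_chain 0 \<kappa>' a) = 0"
    using boundary_push_discrete[OF assms(2)] unfolding discrete_glued_space_singleton e0_def by blast
  then have "frag_extend (\<lambda>t. frag_of (glued_map T \<kappa>' \<kappa>' (\<lambda>_. e) (glued_simplex 0 \<kappa>' t e0))) a = 0"
    using frag_extend_compose[of "\<lambda>f. frag_of (glued_map T \<kappa>' \<kappa>' (\<lambda>_. e) (f e0))" "glued_simplex 0 \<kappa>'" a]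
    by (simp add: glued_chain_def o_def)
  from frag_push_eq_0[OF a this, of "\<lambda>t. \<kappa> {Suc n} t"]
  show ?thesis
    using glued_map_eq[OF compat e0(1)] e0 by (simp add: label_chain_def glued_simplex_def se)
qed

text \<open>Move \<open>c\<close> to a class \<open>u\<close> of \<open>(X', Y')\<close> and write
  its boundary \<open>v\<close> in \<open>Y'\<close> as a label cycle \<open>a\<close>. Being a
  cycle for \<open>\<kappa>'\<close> gives balance at the old faces, dying in \<open>Y\<close> gives
  it at the last face, and \<open>a\<close> up to sign then represents \<open>c\<close>.\<close>

lemma top_homology_labels_Suc_surj:
  assumes IH: "top_homology_labels n T \<kappa>" and IH': "top_homology_labels n T \<kappa>'"
    and c: "c \<in> carrier (homology_group (int (Suc n)) X)"
  shows "\<exists>a. label_cycle (Suc n) T \<kappa> a \<and> c = homologous_rel_set (Suc n) X {} (glued_chain (Suc n) \<kappa> a)"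
proof -
  let ?p = "int (Suc n)"
  have p1: "?p - 1 = int n" by simp
  note cone = cone_pair_iso[OF coh]
  let ?j = "hom_induced ?p X {} X Y id" and ?h = "hom_induced ?p X' Y' X Y h"
  have "?j c \<in> carrier (relative_homology_group ?p X Y)" by (rule hom_induced_carrier)
  then obtain u where u: "u \<in> carrier (relative_homology_group ?p X' Y')" "?h u = ?j c"
    using iso_surj[OF cone(3)] by blast
  define v where "v = hom_boundary ?p X' Y' u"
  have v: "v \<in> carrier (homology_group (int n) (glued_space T \<kappa>' (standard_simplex n)))"
    using hom_boundary_carrier[of ?p X' Y' u] unfolding v_def sub_Y' p1 .
  then obtain a where a: "label_cycle n T \<kappa>' a"
    and va: "v = homologous_rel_set n (glued_space T \<kappa>' (standard_simplex n)) {} (glued_chain n \<kappa>' a)"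
    using top_homology_labelsD(2)[OF IH' v] by blast
  have aT: "Poly_Mapping.keys a \<subseteq> T" using a by (simp add: label_cycle_def)
  have acyc: "singular_relcycle n (glued_space T \<kappa>' (standard_simplex n)) {} (glued_chain n \<kappa>' a)"
    using a label_cycle_iff[OF coherent_mono[OF coherent_cone] aT] by simp
  \<comment> \<open>A class coming from \<open>X\<close> has zero boundary in \<open>Y\<close>. By
    naturality this is the image of \<open>v\<close>, so the chain of \<open>a\<close> bounds in
    \<open>Y\<close> and detection yields balance at the last face.\<close>
  have "?j c \<in> kernel (relative_homology_group ?p X Y) (homology_group (?p - 1) (subtopology X Y))
      (hom_boundary ?p X Y)"
    using homology_exactness_axiom_1[of ?p X Y] c by (simp del: of_nat_Suc)
  then have e1: "hom_boundary ?p X Y (?j c) = \<one>\<^bsub>homology_group (int n) (subtopology X Y)\<^esub>"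
    unfolding p1 kernel_def by simp
  have e2: "hom_boundary ?p X Y (?j c) =
      hom_induced (int n) (subtopology X' Y') {} (subtopology X Y) {} h v"
    using fun_cong[OF naturality_hom_induced[OF cone(1,2)], of ?p u] u p1 by (simp add: v_def)
  have e3: "hom_induced (int n) (subtopology X' Y') {} (subtopology X Y) {} h v =
      homologous_rel_set n (subtopology X Y) {} (chain_map n h (glued_chain n \<kappa>' a))"
    unfolding va sub_Y sub_Y'
    by (rule hom_induced_chain_map[OF continuous_glued_map[OF compat_face] _ acyc]) auto
  have "homologous_rel_set n (subtopology X Y) {} (chain_map n h (glued_chain n \<kappa>' a)) =
      singular_relboundary_set n (subtopology X Y) {}"
    unfolding e3[symmetric] e2[symmetric] e1 by simp
  then have "singular_relboundary n (subtopology X Y) {} (chain_map n h (glued_chain n \<kappa>' a))"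
    unfolding homologous_rel_set_eq_relboundary .
  then have "label_chain \<kappa> {..n} a = 0"
    unfolding chain_map_glued_chain[OF compat_face aT] sub_Y
    using top_homology_labelsD(3)[OF IH aT] by simp
  then have last: "label_chain \<kappa> ({..Suc n} - {Suc n}) a = 0"
    by (simp add: atMost_Suc)
  have others: "label_chain \<kappa> ({..Suc n} - {k}) a = 0" if "k \<le> n" for k
  proof (cases "n > 0")
    case True
    then have "label_chain \<kappa>' ({..n} - {k}) a = 0" using a that by (simp add: label_cycle_def)
    then show ?thesis using label_chain_cone[OF that, of "{..n}" a] by (simp add: atMost_Suc)
  next
    \<comment> \<open>For \<open>n = 0\<close> the cycle condition on \<open>a\<close> is empty. The
      missing balance at the face opposite 0 comes from exactness instead: \<open>v\<close> is a
      boundary from the pair and so vanishes in \<open>H_0(X')\<close>.\<close>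
    case False
    have "v \<in> kernel (homology_group (?p - 1) (subtopology X' Y')) (homology_group (?p - 1) X')
        (hom_induced (?p - 1) (subtopology X' Y') {} X' {} id)"
      using homology_exactness_axiom_2[of ?p X' Y'] u(1) by (simp add: v_def del: of_nat_Suc)
    then have f1: "hom_induced (int n) (subtopology X' Y') {} X' {} id v = \<one>\<^bsub>homology_group (int n) X'\<^esub>"
      unfolding p1 kernel_def by simp
    have f2: "hom_induced (int n) (subtopology X' Y') {} X' {} id v =
      homologous_rel_set n X' {} (chain_map n id (glued_chain n \<kappa>' a))"
      unfolding va sub_Y'[symmetric]
    proof (rule hom_induced_chain_map)
      show "continuous_map (subtopology X' Y') X' id"
        by (rule continuous_map_from_subtopology[OF continuous_map_id])
      show "singular_relcycle n (subtopology X' Y') {} (glued_chain n \<kappa>' a)"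
        unfolding sub_Y' by (rule acyc)
    qed simp
    have "homologous_rel_set n X' {} (chain_map n id (glued_chain n \<kappa>' a)) = singular_relboundary_set n X' {}"
      unfolding f2[symmetric] f1 by simp
    then have "singular_relboundary n X' {} (chain_map n id (glued_chain n \<kappa>' a))"
      unfolding homologous_rel_set_eq_relboundary .
    then have "singular_relboundary 0 X' {} (glued_chain 0 \<kappa>' a)"
      using chain_map_ident[OF singular_chain_glued_chain[OF aT, of 0 \<kappa>']] False by simp
    from cone_zero_chain[OF aT this] show ?thesis using False that by (simp add: atMost_Suc insert_Diff_if)
  qed
  define b where "b = frag_cmul ((-1) ^ Suc n) a"
  have b: "Poly_Mapping.keys b \<subseteq> T" using aT keys_cmul[of _ a] by (auto simp: b_def)
  note rc = cone_relcycle[OF aT others, folded b_def]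
  have "label_chain \<kappa> ({..Suc n} - {k}) b = 0" if "k \<le> Suc n" for k
    using last others[of k] that unfolding b_def label_chain_cmul by (cases "k = Suc n") auto
  then have bcyc: "label_cycle (Suc n) T \<kappa> b" using b by (simp add: label_cycle_def)
  then have bc: "singular_relcycle (Suc n) X {} (glued_chain (Suc n) \<kappa> b)"
    using label_cycle_iff[OF coh b] by simp
  let ?b = "homologous_rel_set (Suc n) X {} (glued_chain (Suc n) \<kappa> b)"
  let ?b' = "homologous_rel_set (Suc n) X' Y' (glued_chain (Suc n) \<kappa>' b)"
  have bC: "?b \<in> carrier (homology_group ?p X)" "?b' \<in> carrier (relative_homology_group ?p X' Y')"
    using bc rc(2) by (auto simp del: of_nat_Suc simp: carrier_relative_homology_group)
  have "hom_boundary ?p X' Y' ?b' = v"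
    using hom_boundary_chain_boundary[OF rc(2)] rc(1) va sub_Y' by simp
  \<comment> \<open>The cones have no homology in degree \<open>Suc n\<close>, so the boundary map
    is injective and identifies \<open>u\<close> with the class of the explicit chain.\<close>
  then have ub: "u = ?b'"
    using inj_hom_boundary[OF trivial_homology_cones[OF coh, of ?p], of Y'] bC(2) u(1)
    by (auto simp: v_def inj_on_def)
  have "?j c = ?h ?b'" using u(2) ub by simp
  also have "\<dots> = homologous_rel_set (Suc n) X Y (chain_map (Suc n) h (glued_chain (Suc n) \<kappa>' b))"
    by (rule hom_induced_chain_map[OF cone(1,2) rc(2)])
  also have "\<dots> = homologous_rel_set (Suc n) X Y (glued_chain (Suc n) \<kappa> b)"
    unfolding chain_map_glued_chain[OF label_compat_cone[OF coh order_refl] b] ..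
  also have "\<dots> = ?j ?b"
  proof -
    have "?j ?b = homologous_rel_set (Suc n) X Y (chain_map (Suc n) id (glued_chain (Suc n) \<kappa> b))"
      by (rule hom_induced_chain_map[OF continuous_map_id _ bc]) auto
    then show ?thesis using chain_map_ident[OF singular_chain_glued_chain[OF b, of "Suc n" \<kappa>]] by simp
  qed
  finally have "?j c = ?j ?b" .
  moreover have "trivial_group (homology_group ?p (subtopology X Y))"
    using top_homology_labelsD(1)[OF IH] unfolding sub_Y by simp
  ultimately have "c = ?b"
    using inj_relativization[of ?p X Y] c bC(1) by (meson inj_onD)
  then show ?thesis using bcyc by blast
qed

end

text \<open>\<open>\<kappa>\<close> is generalised in the induction because the hypothesis is used
  for \<open>\<kappa>\<close> and for \<open>\<kappa>'\<close>.\<close>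

theorem top_homology_labels: "coherent p T \<kappa> \<Longrightarrow> top_homology_labels p T \<kappa>"
proof (induction p arbitrary: \<kappa>)
  case 0
  show ?case by (rule top_homology_labels_0)
next
  case (Suc n)
  interpret cone_step n T \<kappa> using Suc.prems by unfold_locales
  have IH: "top_homology_labels n T \<kappa>"
    using Suc.IH coherent_mono[OF coh] by simp
  have IH': "top_homology_labels n T \<kappa>'"
    using Suc.IH coherent_mono[OF coherent_cone] by simp
  show ?case
    unfolding top_homology_labels_def[of "Suc n"] Let_def
    using top_homology_labels_Suc_trivial[OF IH IH'] top_homology_labels_Suc_surj[OF IH IH']
      top_homology_labels_Suc_inj[OF IH'] by blast
qed

section \<open>Alternating functions on cyclic arrangements\<close>

lemma hom_homologous_rel_set:
  "homologous_rel_set p X S \<in> hom (relcycle_group p X S) (relative_homology_group (int p) X S)"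
  using normal.r_coset_hom_Mod[OF normal_subgroup_singular_relboundary_relcycle[of p X S]]
  by (simp add: right_coset_singular_relboundary nontrivial_relative_homology_group)

lemma label_chain_add: "label_chain \<kappa> F (a + b) = label_chain \<kappa> F a + label_chain \<kappa> F b"
  by (simp add: label_chain_def frag_extend_add)

lemma glued_chain_diff: "glued_chain p \<kappa> (a - b) = glued_chain p \<kappa> a - glued_chain p \<kappa> b"
  by (simp add: glued_chain_def frag_extend_diff)

lemma glued_chain_add: "glued_chain p \<kappa> (a + b) = glued_chain p \<kappa> a + glued_chain p \<kappa> b"
  by (simp add: glued_chain_def frag_extend_add)

lemma label_cycle_add: "label_cycle p T \<kappa> a \<Longrightarrow> label_cycle p T \<kappa> b \<Longrightarrow> label_cycle p T \<kappa> (a + b)"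
  using keys_add[of a b] by (auto simp: label_cycle_def label_chain_add)

text \<open>Since the full label is injective, detection says that homologous cycles are equal, so
  top homology is the group of label cycles. The values at the points \<open>b i\<close> serve as
  free coordinates on that group.\<close>

theorem top_homology_iso:
  fixes T :: "'a set" and I :: "'c set"
  assumes coh: "coherent p T \<kappa>" and inj: "inj_on (\<kappa> {..p}) T"
    and bij: "bij_betw (\<lambda>a. \<lambda>i\<in>I. poly_mapping.lookup a (b i)) {a. label_cycle p T \<kappa> a} (I \<rightarrow>\<^sub>E (UNIV :: int set))"
  shows "homology_group (int p) (glued_space T \<kappa> (standard_simplex p)) \<cong> product_group I (\<lambda>_. integer_group)"
proof -
  let ?X = "glued_space T \<kappa> (standard_simplex p)"
  let ?H = "homology_group (int p) ?X" and ?P = "product_group I (\<lambda>_. integer_group)"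
  let ?Z = "{a. label_cycle p T \<kappa> a}"
  note top = top_homology_labelsD[OF top_homology_labels[OF coh]]
  define E :: "('a \<Rightarrow>\<^sub>0 int) \<Rightarrow> 'c \<Rightarrow> int" where "E = (\<lambda>a. \<lambda>i\<in>I. poly_mapping.lookup a (b i))"
  have E: "bij_betw E ?Z (carrier ?P)" using bij by (simp add: E_def)
  define D where "D = inv_into ?Z E"
  have D: "bij_betw D (carrier ?P) ?Z" unfolding D_def by (rule bij_betw_inv_into[OF E])
  have ED: "E (D f) = f" if "f \<in> carrier ?P" for f
    unfolding D_def by (rule bij_betw_inv_into_right[OF E that])
  have DZ: "label_cycle p T \<kappa> (D f)" if "f \<in> carrier ?P" for f
    using bij_betwE[OF D] that by blast
  interpret P: group ?P by simp
  have D_add: "D (f \<otimes>\<^bsub>?P\<^esub> g) = D f + D g" if fg: "f \<in> carrier ?P" "g \<in> carrier ?P" for f g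
  proof -
    have "E (D (f \<otimes>\<^bsub>?P\<^esub> g)) = f \<otimes>\<^bsub>?P\<^esub> g" using fg by (intro ED P.m_closed)
    also have "\<dots> = (\<lambda>i\<in>I. f i + g i)" by simp
    also have "\<dots> = (\<lambda>i\<in>I. E (D f) i + E (D g) i)" using ED fg by simp
    also have "\<dots> = E (D f + D g)" by (auto simp: E_def lookup_add)
    finally show ?thesis
      using inj_onD[OF bij_betw_imp_inj_on[OF E]] DZ[OF P.m_closed[OF fg]]
        label_cycle_add[OF DZ[OF fg(1)] DZ[OF fg(2)]] by blast
  qed
  define \<phi> where "\<phi> = (\<lambda>f. homologous_rel_set p ?X {} (glued_chain p \<kappa> (D f)))"
  have cyc: "singular_relcycle p ?X {} (glued_chain p \<kappa> (D f))" if "f \<in> carrier ?P" for f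
    using DZ[OF that] label_cycle_iff[OF coh, of "D f"] unfolding label_cycle_def by blast
  have "\<phi> \<in> hom ?P ?H"
  proof (rule homI)
    fix f g assume fg: "f \<in> carrier ?P" "g \<in> carrier ?P"
    show "\<phi> f \<in> carrier ?H"
      using cyc[OF fg(1)] by (auto simp: \<phi>_def carrier_relative_homology_group)
    show "\<phi> (f \<otimes>\<^bsub>?P\<^esub> g) = \<phi> f \<otimes>\<^bsub>?H\<^esub> \<phi> g"
      using hom_mult[OF hom_homologous_rel_set[of p ?X "{}"]] cyc fg
      by (simp only: \<phi>_def D_add[OF fg] glued_chain_add carrier_relcycle_group mem_Collect_eq mult_relcycle_group)
  qed
  moreover have "inj_on \<phi> (carrier ?P)"
  proof
    fix f g assume fg: "f \<in> carrier ?P" "g \<in> carrier ?P" and "\<phi> f = \<phi> g"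
    then have "homologous_rel p ?X {} (glued_chain p \<kappa> (D f)) (glued_chain p \<kappa> (D g))"
      unfolding \<phi>_def homologous_rel_set_eq by simp
    then have "singular_relboundary p ?X {} (glued_chain p \<kappa> (D f - D g))"
      by (simp add: homologous_rel_def glued_chain_diff)
    moreover have keys: "Poly_Mapping.keys (D f - D g) \<subseteq> T"
      using keys_diff[of "D f" "D g"] DZ[OF fg(1)] DZ[OF fg(2)] by (auto simp: label_cycle_def)
    ultimately have "label_chain \<kappa> {..p} (D f - D g) = 0" by (intro top(3))
    then have "frag_extend (\<lambda>t. frag_of t) (D f - D g) = 0"
      unfolding label_chain_def by (rule frag_push_eq_0[OF keys]) (use inj in \<open>auto dest: inj_onD\<close>)
    then have "D f = D g" using frag_expansion[of "D f - D g"] by simp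
    then show "f = g" using bij_betw_imp_inj_on[OF D] fg by (auto dest: inj_onD)
  qed
  moreover have "carrier ?H \<subseteq> \<phi> ` carrier ?P"
  proof
    fix c assume "c \<in> carrier ?H"
    then obtain a where a: "label_cycle p T \<kappa> a" "c = homologous_rel_set p ?X {} (glued_chain p \<kappa> a)"
      using top(2) by blast
    then obtain f where "f \<in> carrier ?P" "a = D f"
      using bij_betw_imp_surj_on[OF D] by blast
    then show "c \<in> \<phi> ` carrier ?P" using a by (simp add: \<phi>_def)
  qed
  ultimately have "\<phi> \<in> iso ?P ?H"
    by (auto simp: iso_def bij_betw_def hom_def)
  then show ?thesis
    using P.iso_sym is_isoI by blast
qed

text \<open>Every cyclic order of the colours \<open>{..<s}\<close> up to rotation and reflection is represented once, by
  the one that starts at colour \<open>0\<close> and leaves it towards its smaller neighbour.\<close>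

definition cyclic_colourings :: "nat \<Rightarrow> (nat \<Rightarrow> nat) set" where
  "cyclic_colourings s = {c. c permutes {1..<s} \<and> c 1 < c (s - 1)}"

lemma finite_cyclic_colourings: "finite (cyclic_colourings s)"
  using finite_permutations[of "{1..<s}"] by (rule rev_finite_subset) (auto simp: cyclic_colourings_def)

text \<open>Reflecting the cycle exchanges the neighbours \<open>c 1\<close> and \<open>c (s - 1)\<close> of colour \<open>0\<close>.\<close>

lemma card_cyclic_colourings:
  assumes "s \<ge> 3"
  shows "card (cyclic_colourings s) = fact (s - 1) div 2"
proof -
  let ?P = "{c. c permutes {1..<s}}"
  let ?B = "{c. c permutes {1..<s} \<and> c (s - 1) < c 1}"
  define r where "r = (\<lambda>i. if i \<in> {1..<s} then s - i else i)"
  have rr: "r (r i) = i" for i by (auto simp: r_def)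
  have r: "r permutes {1..<s}"
    by (rule bij_imp_permutes) (auto simp: r_def intro!: bij_betwI[where g = r])
  have rs: "r 1 = s - 1" "r (s - 1) = 1" using assms by (auto simp: r_def)
  have "bij_betw (\<lambda>c. c \<circ> r) (cyclic_colourings s) ?B"
    by (rule bij_betwI[where g = "\<lambda>c. c \<circ> r"])
      (use rr rs permutes_compose[OF r] in
        \<open>auto simp: cyclic_colourings_def fun_eq_iff simp del: One_nat_def\<close>)
  then have "card (cyclic_colourings s) = card ?B" by (rule bij_betw_same_card)
  moreover have "?P = cyclic_colourings s \<union> ?B"
  proof -
    have "c 1 \<noteq> c (s - 1)" if "c permutes {1..<s}" for c :: "nat \<Rightarrow> nat"
      using inj_eq[OF permutes_inj[OF that], of 1 "s - 1"] assms by simp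
    then show ?thesis
      unfolding cyclic_colourings_def by (auto simp: neq_iff simp del: One_nat_def)
  qed
  moreover have "card (cyclic_colourings s \<union> ?B) = card (cyclic_colourings s) + card ?B"
    by (rule card_Un_disjoint)
      (auto simp: cyclic_colourings_def intro: finite_subset[OF _ finite_permutations[of "{1..<s}"]])
  moreover have "card ?P = fact (s - 1)" by (rule card_permutations) auto
  ultimately show ?thesis by simp
qed

text \<open>In \<open>(c, l)\<close> the edge from vertex \<open>j\<close> to its successor has
  colour \<open>c j\<close>, and leg number \<open>i\<close> sits at vertex \<open>l i\<close>, both
  numbered from 0. Normalising the colours uses up the dihedral symmetry of the cycle, so the legs
  may be placed freely.\<close>

definition cyclic_arrangements :: "nat \<Rightarrow> ((nat \<Rightarrow> nat) \<times> (nat \<Rightarrow> nat)) set" where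
  "cyclic_arrangements s = cyclic_colourings s \<times> {l. l permutes {..<s}}"

lemma finite_cyclic_arrangements: "finite (cyclic_arrangements s)"
  by (simp add: cyclic_arrangements_def finite_cyclic_colourings finite_permutations)

text \<open>Acts on vertices, exchanging the ends of edge \<open>j\<close>; hence it is composed on
  the left of the map \<open>l\<close> from legs to vertices.\<close>

definition swap_at :: "nat \<Rightarrow> nat \<Rightarrow> nat \<Rightarrow> nat" where
  "swap_at s j = Transposition.transpose j (Suc j mod s)"

lemma lookup_label_chain:
  assumes "finite T" "Poly_Mapping.keys a \<subseteq> T"
  shows "poly_mapping.lookup (label_chain \<kappa> F a) y = (\<Sum>t\<in>{t\<in>T. \<kappa> F t = y}. poly_mapping.lookup a t)"
proof -
  have "poly_mapping.lookup (label_chain \<kappa> F a) y =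
      (\<Sum>t\<in>Poly_Mapping.keys a. if \<kappa> F t = y then poly_mapping.lookup a t else 0)"
    unfolding label_chain_def frag_extend_def lookup_sum
    by (rule sum.cong) auto
  also have "\<dots> = (\<Sum>t\<in>T. if \<kappa> F t = y then poly_mapping.lookup a t else 0)"
    by (rule sum.mono_neutral_left) (use assms in \<open>auto simp: in_keys_iff\<close>)
  also have "\<dots> = (\<Sum>t\<in>{t\<in>T. \<kappa> F t = y}. poly_mapping.lookup a t)"
    using assms by (simp add: sum.inter_filter)
  finally show ?thesis .
qed

text \<open>Separates the count from the graphs: each face of codimension one lies in exactly two
  maximal simplices, with known partner.\<close>

locale cyclic_labels =
  fixes s :: nat and \<kappa> :: "nat set \<Rightarrow> (nat \<Rightarrow> nat) \<times> (nat \<Rightarrow> nat) \<Rightarrow> 'b"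
  assumes s3: "s \<ge> 3"
    and label_eq_iff: "\<And>j c l c' l'. j < s \<Longrightarrow> (c, l) \<in> cyclic_arrangements s \<Longrightarrow> (c', l') \<in> cyclic_arrangements s \<Longrightarrow>
      \<kappa> ({..s - 1} - {c j}) (c, l) = \<kappa> ({..s - 1} - {c j}) (c', l') \<longleftrightarrow>
      c' = c \<and> (l' = l \<or> l' = swap_at s j \<circ> l)"
begin

lemma swap_at_permutes: "j < s \<Longrightarrow> swap_at s j permutes {..<s}"
  unfolding swap_at_def by (rule permutes_swap_id) auto

lemma sign_swap_at: "j < s \<Longrightarrow> sign (swap_at s j) = -1"
  using s3 by (auto simp: swap_at_def sign_swap_id mod_Suc split: if_splits)

lemma sign_swap_at_compose:
  assumes "j < s" "l permutes {..<s}"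
  shows "sign (swap_at s j \<circ> l) = - sign l"
proof -
  have "permutation (swap_at s j)" "permutation l"
    using assms swap_at_permutes permutes_imp_permutation by blast+
  then show ?thesis using sign_swap_at[OF assms(1)] by (simp add: sign_compose)
qed

lemma colour_permutes: "(c, l) \<in> cyclic_arrangements s \<Longrightarrow> c permutes {..<s}"
  by (rule permutes_subset[of c "{1..<s}"]) (auto simp: cyclic_arrangements_def cyclic_colourings_def)

lemma colour_surj: "(c, l) \<in> cyclic_arrangements s \<Longrightarrow> k < s \<Longrightarrow> \<exists>j<s. c j = k"
  using permutes_image[OF colour_permutes] by (metis imageE lessThan_iff)

lemma colour_less: "(c, l) \<in> cyclic_arrangements s \<Longrightarrow> j < s \<Longrightarrow> c j < s"
  using permutes_in_image[OF colour_permutes] by (metis lessThan_iff)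

lemma swap_at_arrangement:
  "j < s \<Longrightarrow> (c, l) \<in> cyclic_arrangements s \<Longrightarrow> (c, swap_at s j \<circ> l) \<in> cyclic_arrangements s"
  using permutes_compose swap_at_permutes by (auto simp: cyclic_arrangements_def)

lemma label_fiber:
  assumes "j < s" "(c, l) \<in> cyclic_arrangements s"
  shows "{t \<in> cyclic_arrangements s. \<kappa> ({..s - 1} - {c j}) t = \<kappa> ({..s - 1} - {c j}) (c, l)} =
    {(c, l), (c, swap_at s j \<circ> l)}"
  using label_eq_iff[OF assms] assms swap_at_arrangement[OF assms] by (auto simp: eq_commute[of "\<kappa> _ (_, _)" "\<kappa> _ (c, l)"])

lemma swap_at_neq: "j < s \<Longrightarrow> (c, l) \<in> cyclic_arrangements s \<Longrightarrow> swap_at s j \<circ> l \<noteq> l"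
  using sign_swap_at_compose[of j l] by (auto simp: cyclic_arrangements_def)

text \<open>Each class of a codimension-one label is a pair, so its balance condition says that two
  coefficients are opposite. Every colour is \<open>c j\<close> for some edge \<open>j\<close>, so
  running over edges reaches every face.\<close>

lemma label_cycle_iff_alternating:
  "label_cycle (s - 1) (cyclic_arrangements s) \<kappa> a \<longleftrightarrow>
     Poly_Mapping.keys a \<subseteq> cyclic_arrangements s \<and>
     (\<forall>(c, l)\<in>cyclic_arrangements s. \<forall>j<s.
        poly_mapping.lookup a (c, swap_at s j \<circ> l) = - poly_mapping.lookup a (c, l))"
proof (cases "Poly_Mapping.keys a \<subseteq> cyclic_arrangements s")
  case keys: True
  note look = lookup_label_chain[OF finite_cyclic_arrangements keys, of \<kappa>]
  have *: "poly_mapping.lookup (label_chain \<kappa> ({..s - 1} - {c j}) a) (\<kappa> ({..s - 1} - {c j}) (c, l)) =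
      poly_mapping.lookup a (c, l) + poly_mapping.lookup a (c, swap_at s j \<circ> l)"
    if "j < s" "(c, l) \<in> cyclic_arrangements s" for c l j
    unfolding look label_fiber[OF that] using swap_at_neq[OF that] by simp
  show ?thesis
  proof (intro iffI conjI keys ballI)
    assume L: "label_cycle (s - 1) (cyclic_arrangements s) \<kappa> a"
    show "case t of (c, l) \<Rightarrow> \<forall>j<s. poly_mapping.lookup a (c, swap_at s j \<circ> l) = - poly_mapping.lookup a (c, l)"
      if t: "t \<in> cyclic_arrangements s" for t
    proof (clarify)
      fix c l j assume cl: "t = (c, l)" "j < s"
      then have "label_chain \<kappa> ({..s - 1} - {c j}) a = 0"
        using L s3 colour_less[of c l j] t by (auto simp: label_cycle_def)
      then show "poly_mapping.lookup a (c, swap_at s j \<circ> l) = - poly_mapping.lookup a (c, l)"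
        using *[of j c l] cl t by simp
    qed
  next
    assume R: "Poly_Mapping.keys a \<subseteq> cyclic_arrangements s \<and>
     (\<forall>(c, l)\<in>cyclic_arrangements s. \<forall>j<s.
        poly_mapping.lookup a (c, swap_at s j \<circ> l) = - poly_mapping.lookup a (c, l))"
    have "label_chain \<kappa> ({..s - 1} - {k}) a = 0" if k: "k \<le> s - 1" for k
    proof (rule poly_mapping_eqI)
      fix y
      show "poly_mapping.lookup (label_chain \<kappa> ({..s - 1} - {k}) a) y = poly_mapping.lookup 0 y"
      proof (cases "\<exists>t\<in>cyclic_arrangements s. \<kappa> ({..s - 1} - {k}) t = y")
        case True
        then obtain c l where cl: "(c, l) \<in> cyclic_arrangements s" "y = \<kappa> ({..s - 1} - {k}) (c, l)" by auto
        obtain j where j: "j < s" "c j = k" using colour_surj[OF cl(1), of k] k s3 by fastforce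
        show ?thesis using *[OF j(1) cl(1)] R cl j by auto
      next
        case False
        then have e: "{t \<in> cyclic_arrangements s. \<kappa> ({..s - 1} - {k}) t = y} = {}" by blast
        show ?thesis unfolding look e by simp
      qed
    qed
    then show "label_cycle (s - 1) (cyclic_arrangements s) \<kappa> a"
      using keys by (simp add: label_cycle_def)
  qed
qed (simp add: label_cycle_def)

text \<open>Conjugating the transposition of \<open>i\<close> and \<open>i + d\<close> by the
  adjacent exchange at \<open>i + d\<close> moves its far end one step on. The three factors
  contribute three changes of sign, that is, one.\<close>

lemma alternating_transpose:
  assumes alt: "\<And>l j. l permutes {..<s} \<Longrightarrow> j < s \<Longrightarrow> f (swap_at s j \<circ> l) = - f l"
    and "i + d < s" "d > 0" "l permutes {..<s}"
  shows "f (Transposition.transpose i (i + d) \<circ> l) = - (f l :: int)"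
  using assms(2-4)
proof (induction d arbitrary: l)
  case (Suc d)
  let ?\<sigma> = "swap_at s (i + d)"
  have sw: "?\<sigma> = Transposition.transpose (i + d) (i + Suc d)"
    using Suc.prems by (simp add: swap_at_def)
  have \<sigma>: "?\<sigma> permutes {..<s}" using Suc.prems by (intro swap_at_permutes) auto
  show ?case
  proof (cases "d = 0")
    case True
    then have "Transposition.transpose i (i + Suc d) = swap_at s i" using sw by simp
    moreover have "f (swap_at s i \<circ> l) = - f l" using Suc.prems by (intro alt) auto
    ultimately show ?thesis by (simp only:)
  next
    case False
    have \<sigma>l: "?\<sigma> \<circ> l permutes {..<s}" by (rule permutes_compose[OF Suc.prems(3) \<sigma>])
    have \<tau>: "Transposition.transpose i (i + d) \<circ> (?\<sigma> \<circ> l) permutes {..<s}"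
      using Suc.prems by (intro permutes_compose[OF \<sigma>l] permutes_swap_id) auto
    have "Transposition.transpose i (i + Suc d) = ?\<sigma> \<circ> Transposition.transpose i (i + d) \<circ> ?\<sigma>"
      unfolding sw using False by (auto simp: fun_eq_iff Transposition.transpose_def)
    then have "f (Transposition.transpose i (i + Suc d) \<circ> l) = f (?\<sigma> \<circ> (Transposition.transpose i (i + d) \<circ> (?\<sigma> \<circ> l)))"
      by (simp add: o_assoc)
    also have "\<dots> = - f (Transposition.transpose i (i + d) \<circ> (?\<sigma> \<circ> l))"
      using Suc.prems by (intro alt[OF \<tau>]) auto
    also have "f (Transposition.transpose i (i + d) \<circ> (?\<sigma> \<circ> l)) = - f (?\<sigma> \<circ> l)"
      by (rule Suc.IH[OF _ _ \<sigma>l]) (use Suc.prems False in auto)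
    also have "- (- f (?\<sigma> \<circ> l)) = f (?\<sigma> \<circ> l)" by simp
    also have "\<dots> = - f l" using Suc.prems by (intro alt) auto
    finally show ?thesis .
  qed
qed simp

lemma alternating_sign:
  assumes alt: "\<And>l j. l permutes {..<s} \<Longrightarrow> j < s \<Longrightarrow> f (swap_at s j \<circ> l) = - f l"
    and l: "l permutes {..<s}"
  shows "f l = sign l * (f id :: int)"
  using l finite_lessThan
proof (induction l rule: permutes_induct)
  case (swap a b p)
  then have p: "p permutes {..<s}" by simp
  have "f (Transposition.transpose a b \<circ> p) = - f p"
  proof (cases "a < b")
    case True
    then show ?thesis using alternating_transpose[of f a "b - a" p] alt swap by simp
  next
    case False
    then show ?thesis using alternating_transpose[of f b "a - b" p] alt swap
      by (simp add: transpose_commute)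
  qed
  moreover have "sign (Transposition.transpose a b \<circ> p) = - sign p"
    using swap permutes_imp_permutation[OF _ p] by (simp add: sign_compose permutation_swap_id sign_swap_id)
  moreover have "f p = sign p * f id" by fact
  ultimately show ?case by (simp only: mult_minus_left)
qed auto

theorem top_homology_cyclic:
  assumes coh: "coherent (s - 1) (cyclic_arrangements s) \<kappa>"
    and inj: "inj_on (\<kappa> {..s - 1}) (cyclic_arrangements s)"
  shows "homology_group (int s - 1) (glued_space (cyclic_arrangements s) \<kappa> (standard_simplex (s - 1)))
           \<cong> product_group {..<fact (s - 1) div 2 :: nat} (\<lambda>_. integer_group)"
proof -
  let ?N = "fact (s - 1) div 2 :: nat" and ?T = "cyclic_arrangements s"
  obtain e where e: "bij_betw e {..<?N} (cyclic_colourings s)"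
    using ex_bij_betw_nat_finite[OF finite_cyclic_colourings] card_cyclic_colourings[OF s3]
    by (metis atLeast0LessThan)
  let ?E = "\<lambda>a. \<lambda>i\<in>{..<?N}. poly_mapping.lookup a (e i, id)"
  let ?Z = "{a. label_cycle (s - 1) ?T \<kappa> a}"
  have sgn: "poly_mapping.lookup a (c, l) = sign l * poly_mapping.lookup a (c, id)"
    if "label_cycle (s - 1) ?T \<kappa> a" "(c, l) \<in> ?T" for a c l
  proof (rule alternating_sign[of "\<lambda>l. poly_mapping.lookup a (c, l)"])
    fix l j assume "l permutes {..<s}" "j < s"
    moreover have "c \<in> cyclic_colourings s" using that(2) by (simp add: cyclic_arrangements_def)
    ultimately have "(c, l) \<in> ?T" by (simp add: cyclic_arrangements_def)
    then show "poly_mapping.lookup a (c, swap_at s j \<circ> l) = - poly_mapping.lookup a (c, l)"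
      using that(1) \<open>j < s\<close> unfolding label_cycle_iff_alternating by blast
  qed (use that(2) in \<open>simp add: cyclic_arrangements_def\<close>)
  have "bij_betw ?E ?Z ({..<?N} \<rightarrow>\<^sub>E UNIV)"
    unfolding bij_betw_def
  proof
    show "inj_on ?E ?Z"
    proof (rule inj_onI)
      fix a b assume ab: "a \<in> ?Z" "b \<in> ?Z" "?E a = ?E b"
      show "a = b"
      proof (rule poly_mapping_eqI)
        fix t
        show "poly_mapping.lookup a t = poly_mapping.lookup b t"
        proof (cases "t \<in> ?T")
          case True
          then obtain c l where t: "t = (c, l)" "c \<in> cyclic_colourings s" by (auto simp: cyclic_arrangements_def)
          then obtain i where i: "i < ?N" "c = e i" using bij_betw_imp_surj_on[OF e] by auto
          have "poly_mapping.lookup a (c, id) = poly_mapping.lookup b (c, id)"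
            using fun_cong[OF ab(3), of i] i by simp
          then show ?thesis using sgn[of a c l] sgn[of b c l] ab True t by simp
        next
          case False
          then have "t \<notin> Poly_Mapping.keys a" "t \<notin> Poly_Mapping.keys b"
            using ab by (auto simp: label_cycle_def)
          then show ?thesis by (simp add: in_keys_iff)
        qed
      qed
    qed
    show "?E ` ?Z = ({..<?N} \<rightarrow>\<^sub>E UNIV)"
    proof
      show "({..<?N} \<rightarrow>\<^sub>E UNIV) \<subseteq> ?E ` ?Z"
      proof
        fix f :: "nat \<Rightarrow> int" assume f: "f \<in> {..<?N} \<rightarrow>\<^sub>E UNIV"
        \<comment> \<open>The inverse of evaluation at \<open>id\<close>: spread the prescribed
          value over all arrangements of the legs by the sign.\<close>
        define g where "g = (\<lambda>(c, l). if (c, l) \<in> ?T then sign l * f (inv_into {..<?N} e c) else 0)"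
        define a where "a = Abs_poly_mapping g"
        have "finite {t. g t \<noteq> 0}"
          by (rule finite_subset[OF _ finite_cyclic_arrangements[of s]]) (auto simp: g_def split: if_splits)
        then have a: "poly_mapping.lookup a = g" by (simp add: a_def)
        have "Poly_Mapping.keys a \<subseteq> ?T" by (auto simp: in_keys_iff a g_def split: if_splits)
        moreover have "\<forall>(c, l)\<in>?T. \<forall>j<s.
            poly_mapping.lookup a (c, swap_at s j \<circ> l) = - poly_mapping.lookup a (c, l)"
          unfolding a g_def using sign_swap_at_compose swap_at_arrangement
          by (auto simp: cyclic_arrangements_def)
        ultimately have "a \<in> ?Z" unfolding mem_Collect_eq label_cycle_iff_alternating by blast
        moreover have "?E a = f"
        proof
          fix i
          show "?E a i = f i"
          proof (cases "i < ?N")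
            case True
            then have "(e i, id) \<in> ?T"
              using bij_betwE[OF e] by (auto simp: cyclic_arrangements_def permutes_id)
            then show ?thesis
              using True bij_betw_inv_into_left[OF e] by (simp add: a g_def)
          next
            case False
            then show ?thesis using f by (auto simp: PiE_def extensional_def)
          qed
        qed
        ultimately show "f \<in> ?E ` ?Z" by blast
      qed
    qed (auto split: if_splits)
  qed
  from top_homology_iso[OF coh inj this]
  have "homology_group (int (s - 1)) (glued_space ?T \<kappa> (standard_simplex (s - 1)))
           \<cong> product_group {..<?N} (\<lambda>_. integer_group)" .
  then show ?thesis using s3 by (simp add: of_nat_diff)
qed

end

section \<open>Contractions of coloured graphs\<close>

text \<open>Comparing sets of ends makes the generating relation symmetric, so its closure relates
  the vertices in one component of the subgraph with edge set \<open>A\<close>.\<close>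

definition conn :: "('v, 'e, 'x) legged_graph_scheme \<Rightarrow> 'e set \<Rightarrow> ('v \<times> 'v) set" where
  "conn G A = {(u, v). \<exists>e\<in>A. set_uprod (ends G e) = {u, v}}\<^sup>*"

lemma conn_refl [simp]: "(u, u) \<in> conn G A"
  by (simp add: conn_def)

lemma conn_trans: "(u, v) \<in> conn G A \<Longrightarrow> (v, w) \<in> conn G A \<Longrightarrow> (u, w) \<in> conn G A"
  unfolding conn_def by (rule rtrancl_trans)

lemma conn_mono: "A \<subseteq> B \<Longrightarrow> conn G A \<subseteq> conn G B"
  unfolding conn_def by (rule rtrancl_mono) blast

lemma set_uprod_doubleton: obtains a b where "set_uprod p = {a, b}" "p = Upair a b"
  by (cases p) auto

lemma uprod_eqI: "set_uprod p = set_uprod p' \<Longrightarrow> p = p'"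
  by (cases p; cases p') (auto simp: doubleton_eq_iff)

lemma conn_edge:
  assumes "e \<in> A" "a \<in> set_uprod (ends G e)" "b \<in> set_uprod (ends G e)"
  shows "(a, b) \<in> conn G A"
proof (cases "a = b")
  case False
  then have "set_uprod (ends G e) = {a, b}"
    using assms set_uprod_doubleton[of "ends G e"] by (metis insertE insert_commute singletonD)
  then show ?thesis
    using assms(1) unfolding conn_def by (intro r_into_rtrancl) blast
qed simp

text \<open>Legs, weight and incident colours of the vertex that the component of \<open>v\<close>
  turns into when \<open>A\<close> is collapsed. No vertex or edge is named, so blocks of different
  graphs can be compared without constructing the collapsed graph.\<close>

definition block :: "nat \<Rightarrow> ('v, 'e) coloured_graph \<Rightarrow> 'e set \<Rightarrow> 'v \<Rightarrow> nat set \<times> nat set \<times> nat set" where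
  "block s G A v =
     ({i \<in> {1..s}. (v, leg G i) \<in> conn G A},
      (\<Union>u\<in>{u \<in> verts G. (v, u) \<in> conn G A}. wt G u) \<union>
        col G ` {e \<in> A. \<exists>u\<in>set_uprod (ends G e). (v, u) \<in> conn G A},
      col G ` {e \<in> edges G - A. \<exists>u\<in>set_uprod (ends G e). (v, u) \<in> conn G A})"

definition blocks where
  "blocks s G A = block s G A ` verts G"

definition wf_graph :: "nat \<Rightarrow> ('v, 'e, 'x) legged_graph_scheme \<Rightarrow> bool" where
  "wf_graph s G \<longleftrightarrow> (\<forall>e\<in>edges G. set_uprod (ends G e) \<subseteq> verts G) \<and> (\<forall>i\<in>{1..s}. leg G i \<in> verts G)"

text \<open>Covers isomorphisms (\<open>Z = {}\<close>) and collapses of one edge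
  (\<open>g = id\<close>) alike, so that one invariance proof serves both, as well as the expansion
  of a vertex read backwards.\<close>

definition contraction ::
    "nat \<Rightarrow> ('v \<Rightarrow> 'w) \<Rightarrow> ('e \<Rightarrow> 'f) \<Rightarrow> 'e set \<Rightarrow> ('v, 'e) coloured_graph \<Rightarrow> ('w, 'f) coloured_graph \<Rightarrow> bool" where
  "contraction s q g Z G H \<longleftrightarrow>
     Z \<subseteq> edges G \<and> q ` verts G = verts H \<and> bij_betw g (edges G - Z) (edges H) \<and>
     (\<forall>e\<in>edges G - Z. set_uprod (ends H (g e)) = q ` set_uprod (ends G e) \<and> col H (g e) = col G e) \<and>
     (\<forall>i\<in>{1..s}. leg H i = q (leg G i)) \<and>
     (\<forall>y\<in>verts H. wt H y = (\<Union>u\<in>{u \<in> verts G. q u = y}. wt G u) \<union>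
        col G ` {e \<in> Z. y \<in> q ` set_uprod (ends G e)}) \<and>
     (\<forall>e\<in>Z. \<forall>a\<in>set_uprod (ends G e). \<forall>b\<in>set_uprod (ends G e). q a = q b) \<and>
     (\<forall>u\<in>verts G. \<forall>v\<in>verts G. q u = q v \<longrightarrow> (u, v) \<in> conn G Z)"

context
  fixes s q g Z and G :: "('v, 'e) coloured_graph" and H :: "('w, 'f) coloured_graph" and A
  assumes wf: "wf_graph s G" and con: "contraction s q g Z G H" and A: "Z \<subseteq> A" "A \<subseteq> edges G"
begin

lemma conn_contraction:
  assumes "u \<in> verts G" "v \<in> verts G"
  shows "(q u, q v) \<in> conn H (g ` (A - Z)) \<longleftrightarrow> (u, v) \<in> conn G A"
proof
  have ends: "set_uprod (ends H (g e)) = q ` set_uprod (ends G e)" if "e \<in> A - Z" for e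
    using con A that by (auto simp: contraction_def)
  show "(q u, q v) \<in> conn H (g ` (A - Z))" if "(u, v) \<in> conn G A"
    using that unfolding conn_def[of G]
  proof (induction rule: rtrancl_induct)
    case (step a b)
    then obtain e where e: "e \<in> A" "set_uprod (ends G e) = {a, b}" by auto
    have "(q a, q b) \<in> conn H (g ` (A - Z))"
    proof (cases "e \<in> Z")
      case True
      then have "q a = q b" using con e by (auto simp: contraction_def)
      then show ?thesis by simp
    next
      case False
      then show ?thesis
        using e ends[of e] by (intro conn_edge[of "g e"]) auto
    qed
    with step.IH show ?case by (rule conn_trans)
  qed simp
  have fibre: "(a, b) \<in> conn G A" if "a \<in> verts G" "b \<in> verts G" "q a = q b" for a b
  proof -
    have "(a, b) \<in> conn G Z" using con that by (simp add: contraction_def)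
    then show ?thesis using conn_mono[OF A(1), of G] by (rule rev_subsetD)
  qed
  \<comment> \<open>Paths lift because fibres of \<open>q\<close> are connected by edges of
    \<open>Z\<close>. The claim covers every lift of the end point so that the induction can change
    lifts between edges.\<close>
  have "\<forall>v\<in>verts G. q v = y \<longrightarrow> (u, v) \<in> conn G A" if "(q u, y) \<in> conn H (g ` (A - Z))" for y
    using that unfolding conn_def[of H]
  proof (induction rule: rtrancl_induct)
    case base
    then show ?case using fibre assms(1) by auto
  next
    case (step y z)
    then obtain e where e: "e \<in> A - Z" "q ` set_uprod (ends G e) = {y, z}" using ends by auto
    then have "y \<in> q ` set_uprod (ends G e)" "z \<in> q ` set_uprod (ends G e)" by auto
    then obtain a b where ab: "a \<in> set_uprod (ends G e)" "b \<in> set_uprod (ends G e)" "q a = y" "q b = z"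
      by blast
    have "a \<in> verts G" "b \<in> verts G" using wf A e ab by (auto simp: wf_graph_def)
    moreover have "(a, b) \<in> conn G A" using e ab by (intro conn_edge) auto
    ultimately have "(u, b) \<in> conn G A" using step.IH ab conn_trans by metis
    then show ?case using fibre[OF \<open>b \<in> verts G\<close>] ab conn_trans by metis
  qed
  then show "(u, v) \<in> conn G A" if "(q u, q v) \<in> conn H (g ` (A - Z))"
    using that assms by blast
qed

lemma block_contraction:
  assumes v: "v \<in> verts G"
  shows "block s H (g ` (A - Z)) (q v) = block s G A v"
proof -
  let ?A' = "g ` (A - Z)"
  note conn = conn_contraction[OF v]
  have bij: "bij_betw g (edges G - Z) (edges H)" using con by (simp add: contraction_def)
  have ends: "set_uprod (ends H (g e)) = q ` set_uprod (ends G e)" "col H (g e) = col G e" if "e \<in> edges G - Z" for e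
    using con that by (auto simp: contraction_def)
  have sub: "set_uprod (ends G e) \<subseteq> verts G" if "e \<in> edges G" for e
    using wf that by (auto simp: wf_graph_def)
  have touch: "(\<exists>u\<in>set_uprod (ends H (g e)). (q v, u) \<in> conn H ?A') \<longleftrightarrow>
      (\<exists>u\<in>set_uprod (ends G e). (v, u) \<in> conn G A)" if "e \<in> edges G - Z" for e
    using ends[OF that] sub[of e] that conn by (auto simp: subset_iff)
  have colg: "col H ` g ` E = col G ` E" if "E \<subseteq> edges G - Z" for E
    using ends(2) that by (force simp: image_iff)
  have 1: "{i \<in> {1..s}. (q v, leg H i) \<in> conn H ?A'} = {i \<in> {1..s}. (v, leg G i) \<in> conn G A}"
    using con wf conn by (auto simp: contraction_def wf_graph_def)
  have edgesH: "edges H - ?A' = g ` (edges G - A)"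
  proof -
    have "edges G - A = (edges G - Z) - (A - Z)" using A by blast
    then have "g ` (edges G - A) = g ` (edges G - Z) - g ` (A - Z)"
      using bij A by (metis (no_types, lifting) Diff_mono bij_betw_def equalityD1 inj_on_image_set_diff Diff_subset)
    then show ?thesis using bij by (simp add: bij_betw_def)
  qed
  have 3: "col H ` {e \<in> edges H - ?A'. \<exists>u\<in>set_uprod (ends H e). (q v, u) \<in> conn H ?A'} =
      col G ` {e \<in> edges G - A. \<exists>u\<in>set_uprod (ends G e). (v, u) \<in> conn G A}"
  proof -
    have "{e \<in> edges H - ?A'. \<exists>u\<in>set_uprod (ends H e). (q v, u) \<in> conn H ?A'} =
        g ` {e \<in> edges G - A. \<exists>u\<in>set_uprod (ends G e). (v, u) \<in> conn G A}"
      unfolding edgesH Compr_image_eq using touch A by (intro arg_cong[where f = "image g"] Collect_cong) blast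
    then show ?thesis using A by (simp only:) (intro colg, blast)
  qed
  have wtH: "wt H y = (\<Union>u\<in>{u \<in> verts G. q u = y}. wt G u) \<union> col G ` {e \<in> Z. y \<in> q ` set_uprod (ends G e)}"
    if "y \<in> verts H" for y
    using con that by (auto simp: contraction_def)
  have vH: "verts H = q ` verts G" using con by (simp add: contraction_def)
  have Z: "Z \<subseteq> edges G" using A by blast
  \<comment> \<open>Weights in \<open>H\<close> already contain the colours of \<open>Z\<close>.
    Together with the colours of \<open>A - Z\<close> they account for those of \<open>A\<close> in
    the block of \<open>G\<close>.\<close>
  have "(\<Union>u\<in>{u \<in> verts H. (q v, u) \<in> conn H ?A'}. wt H u) =
      (\<Union>u\<in>{u \<in> verts G. (v, u) \<in> conn G A}. wt G u) \<union>
        col G ` {e \<in> Z. \<exists>u\<in>set_uprod (ends G e). (v, u) \<in> conn G A}" (is "?L = ?R")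
  proof
    show "?L \<subseteq> ?R"
    proof
      fix x assume "x \<in> ?L"
      then obtain u0 where u0: "u0 \<in> verts G" "(v, u0) \<in> conn G A" "x \<in> wt H (q u0)"
        using conn vH by auto
      from u0(3) consider u where "u \<in> verts G" "q u = q u0" "x \<in> wt G u"
        | e u where "e \<in> Z" "x = col G e" "u \<in> set_uprod (ends G e)" "q u = q u0"
        using wtH[of "q u0"] u0(1) vH by auto
      then show "x \<in> ?R"
      proof cases
        case 1
        then have "(v, u) \<in> conn G A" using conn u0 by metis
        then show ?thesis using 1 by blast
      next
        case 2
        then have "u \<in> verts G" using sub Z by blast
        then have "(v, u) \<in> conn G A" using conn u0 2 by metis
        then show ?thesis using 2 by blast
      qed
    qed
    show "?R \<subseteq> ?L"
    proof
      fix x assume "x \<in> ?R"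
      then consider u where "u \<in> verts G" "(v, u) \<in> conn G A" "x \<in> wt G u"
        | e u where "e \<in> Z" "x = col G e" "u \<in> set_uprod (ends G e)" "(v, u) \<in> conn G A"
        by blast
      then show "x \<in> ?L"
      proof cases
        case 1
        then have "q u \<in> verts H" "(q v, q u) \<in> conn H ?A'" "x \<in> wt H (q u)"
          using vH conn wtH[of "q u"] by auto
        then show ?thesis by blast
      next
        case 2
        then have "u \<in> verts G" using sub Z by blast
        then have "q u \<in> verts H" "(q v, q u) \<in> conn H ?A'" "x \<in> wt H (q u)"
          using vH conn wtH[of "q u"] 2 by auto
        then show ?thesis by blast
      qed
    qed
  qed
  moreover have "col H ` {e \<in> ?A'. \<exists>u\<in>set_uprod (ends H e). (q v, u) \<in> conn H ?A'} =
      col G ` {e \<in> A - Z. \<exists>u\<in>set_uprod (ends G e). (v, u) \<in> conn G A}"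
  proof -
    have "{e \<in> ?A'. \<exists>u\<in>set_uprod (ends H e). (q v, u) \<in> conn H ?A'} =
        g ` {e \<in> A - Z. \<exists>u\<in>set_uprod (ends G e). (v, u) \<in> conn G A}"
      unfolding Compr_image_eq using touch A by (intro arg_cong[where f = "image g"] Collect_cong) blast
    then show ?thesis using A by (simp only:) (intro colg, blast)
  qed
  moreover have "{e \<in> A. \<exists>u\<in>set_uprod (ends G e). (v, u) \<in> conn G A} =
      {e \<in> Z. \<exists>u\<in>set_uprod (ends G e). (v, u) \<in> conn G A} \<union>
      {e \<in> A - Z. \<exists>u\<in>set_uprod (ends G e). (v, u) \<in> conn G A}"
    using A by blast
  ultimately have 2: "(\<Union>u\<in>{u \<in> verts H. (q v, u) \<in> conn H ?A'}. wt H u) \<union>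
        col H ` {e \<in> ?A'. \<exists>u\<in>set_uprod (ends H e). (q v, u) \<in> conn H ?A'} =
      (\<Union>u\<in>{u \<in> verts G. (v, u) \<in> conn G A}. wt G u) \<union>
        col G ` {e \<in> A. \<exists>u\<in>set_uprod (ends G e). (v, u) \<in> conn G A}"
    by (simp add: image_Un Un_assoc)
  show ?thesis unfolding block_def 1 2 3 ..
qed

lemma blocks_contraction: "blocks s H (g ` (A - Z)) = blocks s G A"
proof -
  have "blocks s H (g ` (A - Z)) = (\<lambda>v. block s H (g ` (A - Z)) (q v)) ` verts G"
  proof -
    have "verts H = q ` verts G" using con by (simp add: contraction_def)
    then show ?thesis by (simp only: blocks_def image_image)
  qed
  then show ?thesis using block_contraction by (simp add: blocks_def cong: image_cong)
qed

end

text \<open>Colour \<open>k + 1\<close> corresponds to the \<open>k\<close>-th coordinate of the simplex.\<close>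

definition colour_blocks :: "nat \<Rightarrow> nat set \<Rightarrow> ('v, 'e) coloured_graph \<Rightarrow> (nat set \<times> nat set \<times> nat set) set" where
  "colour_blocks s F G = blocks s G {e \<in> edges G. col G e \<notin> Suc ` F}"

text \<open>The label for \<open>F\<close> collapses all colours outside \<open>F\<close> anyway, so
  collapsing some of them beforehand makes no difference. With \<open>Z\<close> empty this is
  invariance under isomorphism.\<close>

lemma colour_blocks_contraction:
  assumes "wf_graph s G" and con: "contraction s q g Z G H" and "\<And>e. e \<in> Z \<Longrightarrow> col G e \<notin> Suc ` F"
  shows "colour_blocks s F H = colour_blocks s F G"
proof -
  let ?A = "{e \<in> edges G. col G e \<notin> Suc ` F}"
  have Z: "Z \<subseteq> ?A" using assms by (auto simp: contraction_def)
  have "{e \<in> edges H. col H e \<notin> Suc ` F} = g ` (?A - Z)"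
  proof -
    have "edges H = g ` (edges G - Z)" "\<And>e. e \<in> edges G - Z \<Longrightarrow> col H (g e) = col G e"
      using con by (auto simp: contraction_def bij_betw_def)
    then show ?thesis by auto
  qed
  then show ?thesis
    unfolding colour_blocks_def using blocks_contraction[OF assms(1,2) Z] by auto
qed

section \<open>Graphs determined by their blocks\<close>

lemma contraction_weighted_iso:
  assumes iso: "weighted_iso s f g G H" shows "contraction s f g {} G H"
proof -
  have f: "inj_on f (verts G)" "f ` verts G = verts H" using iso by (auto simp: weighted_iso_def bij_betw_def)
  have "wt H y = (\<Union>u\<in>{u \<in> verts G. f u = y}. wt G u)" if "y \<in> verts H" for y
  proof -
    have "y \<in> f ` verts G" using that f(2) by simp
    then obtain v where v: "y = f v" "v \<in> verts G" by blast
    then have "{u \<in> verts G. f u = y} = {v}" using f(1) unfolding inj_on_def by blast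
    then show ?thesis using iso v by (simp add: weighted_iso_def)
  qed
  moreover have "(u, v) \<in> conn G {}" if "u \<in> verts G" "v \<in> verts G" "f u = f v" for u v
  proof -
    have "u = v" using inj_onD[OF f(1) that(3,1,2)] .
    then show ?thesis by simp
  qed
  ultimately show ?thesis
    using iso f(2) unfolding weighted_iso_def contraction_def by (simp add: uprod.set_map)
qed

lemma conn_empty: "conn G {} = Id"
  by (simp add: conn_def)

lemma block_empty: 
  "block s G {} v = (legs_at s G v, if v \<in> verts G then wt G v else {}, col G ` {e \<in> edges G. v \<in> set_uprod (ends G e)})"
  by (auto simp: block_def conn_empty legs_at_def)

text \<open>With nothing collapsed the blocks describe the vertices. A vertex is recognised by any
  of its legs, of which there is at least one, and an edge by its colour; this forces
  \<open>f\<close> and \<open>g\<close>.\<close>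

lemma weighted_iso_of_blocks:
  fixes G :: "('v, 'e) coloured_graph" and H :: "('w, 'f) coloured_graph"
  assumes eq: "blocks s G {} = blocks s H {}"
    and wf: "wf_graph s G" "wf_graph s H"
    and legs: "\<And>v. v \<in> verts G \<Longrightarrow> legs_at s G v \<noteq> {}" "\<And>v. v \<in> verts H \<Longrightarrow> legs_at s H v \<noteq> {}"
    and inj: "inj_on (col G) (edges G)" "inj_on (col H) (edges H)"
  obtains f g where "weighted_iso s f g G H"
proof -
  define f where "f = (\<lambda>v. leg H (SOME i. i \<in> legs_at s G v))"
  define g where "g = (\<lambda>e. inv_into (edges H) (col H) (col G e))"
  have key: "f v \<in> verts H \<and> block s H {} (f v) = block s G {} v" if v: "v \<in> verts G" for v
  proof -
    have "(SOME i. i \<in> legs_at s G v) \<in> legs_at s G v" using legs(1)[OF v] by (simp add: some_in_eq)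
    moreover obtain w where w: "w \<in> verts H" "block s G {} v = block s H {} w"
      using eq v unfolding blocks_def by (metis imageE imageI)
    ultimately have "(SOME i. i \<in> legs_at s G v) \<in> legs_at s H w" by (simp add: block_empty)
    then have "f v = w" by (simp add: f_def legs_at_def)
    then show ?thesis using w by simp
  qed
  have key_legs: "legs_at s H (f v) = legs_at s G v" if "v \<in> verts G" for v
    using key[OF that] by (simp add: block_empty)
  have legf: "leg H i = f (leg G i)" if "i \<in> {1..s}" for i
  proof -
    have "leg G i \<in> verts G" using wf(1) that by (auto simp: wf_graph_def)
    then have "legs_at s H (f (leg G i)) = legs_at s G (leg G i)" by (rule key_legs)
    moreover have "i \<in> legs_at s G (leg G i)" using that by (simp add: legs_at_def)
    ultimately have "i \<in> legs_at s H (f (leg G i))" by simp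
    then show ?thesis by (simp add: legs_at_def)
  qed
  have "inj_on f (verts G)"
  proof (rule inj_onI)
    fix u v assume uv: "u \<in> verts G" "v \<in> verts G" "f u = f v"
    then have "legs_at s G u = legs_at s G v" using key_legs[OF uv(1)] key_legs[OF uv(2)] by simp
    then obtain i where "i \<in> legs_at s G u" "i \<in> legs_at s G v" using legs(1)[OF uv(1)] by auto
    then show "u = v" by (simp add: legs_at_def)
  qed
  moreover have "f ` verts G = verts H"
  proof
    show "f ` verts G \<subseteq> verts H" using key by blast
    show "verts H \<subseteq> f ` verts G"
    proof
      fix w assume w: "w \<in> verts H"
      then obtain i where "i \<in> {1..s}" "leg H i = w" using legs(2)[OF w] by (auto simp: legs_at_def)
      then show "w \<in> f ` verts G" using legf wf(1) by (auto simp: wf_graph_def)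
    qed
  qed
  ultimately have bf: "bij_betw f (verts G) (verts H)" by (simp add: bij_betw_def)
  have cols: "col K ` edges K = (\<Union>b\<in>blocks s K {}. snd (snd b))" if "wf_graph s K" for K :: "('x, 'y) coloured_graph"
  proof
    show "col K ` edges K \<subseteq> (\<Union>b\<in>blocks s K {}. snd (snd b))"
    proof
      fix x assume "x \<in> col K ` edges K"
      then obtain e where e: "e \<in> edges K" "x = col K e" by blast
      obtain a where "a \<in> set_uprod (ends K e)" using set_uprod_doubleton[of "ends K e"] by blast
      moreover have "a \<in> verts K" using that e calculation by (auto simp: wf_graph_def)
      ultimately show "x \<in> (\<Union>b\<in>blocks s K {}. snd (snd b))"
        using e by (auto simp: blocks_def block_empty)
    qed
  qed (auto simp: blocks_def block_empty)
  have ceq: "col G ` edges G = col H ` edges H" using cols[OF wf(1)] cols[OF wf(2)] eq by simp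
  have "bij_betw (col G) (edges G) (col H ` edges H)"
    using inj_on_imp_bij_betw[OF inj(1)] ceq by simp
  from bij_betw_trans[OF this bij_betw_inv_into[OF inj_on_imp_bij_betw[OF inj(2)]]]
  have bg: "bij_betw g (edges G) (edges H)" by (simp add: g_def o_def)
  have ge: "g e \<in> edges H" "col H (g e) = col G e" if "e \<in> edges G" for e
  proof -
    show "g e \<in> edges H" using bij_betwE[OF bg] that by blast
    have "col G e \<in> col H ` edges H" using that ceq by blast
    then show "col H (g e) = col G e" unfolding g_def by (rule f_inv_into_f)
  qed
  have ends: "v \<in> set_uprod (ends K e) \<longleftrightarrow> col K e \<in> snd (snd (block s K {} v))"
    if "inj_on (col K) (edges K)" "e \<in> edges K" for v e and K :: "('x, 'y) coloured_graph"
    using that by (auto simp: block_empty inj_on_def)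
  have "set_uprod (ends H (g e)) = f ` set_uprod (ends G e)" if e: "e \<in> edges G" for e
  proof -
    have *: "f v \<in> set_uprod (ends H (g e)) \<longleftrightarrow> v \<in> set_uprod (ends G e)" if "v \<in> verts G" for v
      using ends[OF inj(2) ge(1)[OF e], of "f v"] ends[OF inj(1) e, of v] key[OF that] ge(2)[OF e] by simp
    have "set_uprod (ends H (g e)) \<subseteq> f ` verts G" "set_uprod (ends G e) \<subseteq> verts G"
      using wf ge(1)[OF e] e bf by (auto simp: wf_graph_def bij_betw_def)
    then show ?thesis using * by blast
  qed
  then have "ends H (g e) = map_uprod f (ends G e)" if "e \<in> edges G" for e
    using that by (intro uprod_eqI) (simp add: uprod.set_map)
  moreover have "wt H (f v) = wt G v" if "v \<in> verts G" for v
    using key[OF that] that by (auto simp: block_empty)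
  ultimately have "weighted_iso s f g G H"
    using bf bg legf ge by (simp add: weighted_iso_def)
  then show ?thesis by (rule that)
qed

section \<open>Cyclic enumerations of vertices and edges\<close>

definition cycle_indexing :: "nat \<Rightarrow> (nat \<Rightarrow> 'v) \<Rightarrow> (nat \<Rightarrow> 'e) \<Rightarrow> ('v, 'e) coloured_graph \<Rightarrow> bool" where
  "cycle_indexing k v e G \<longleftrightarrow> bij_betw v {..<k} (verts G) \<and> bij_betw e {..<k} (edges G) \<and>
     (\<forall>i<k. ends G (e i) = Upair (v i) (v ((i + 1) mod k)))"

lemma weighted_graphI:
  assumes "1 \<le> k" "k \<le> s" "cycle_indexing k v e G"
    and "\<And>i. i \<in> {1..s} \<Longrightarrow> leg G i \<in> verts G" "\<And>v. v \<in> verts G \<Longrightarrow> legs_at s G v \<noteq> {}"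
    and "inj_on (col G) (edges G)" "col G ` edges G \<subseteq> {1..s}"
    and "\<And>v. v \<in> verts G \<Longrightarrow> card (wt G v) = card (legs_at s G v) - 1"
    and "\<And>u v. u \<in> verts G \<Longrightarrow> v \<in> verts G \<Longrightarrow> u \<noteq> v \<Longrightarrow> wt G u \<inter> wt G v = {}"
    and "\<And>v. v \<in> verts G \<Longrightarrow> wt G v \<inter> col G ` edges G = {}"
    and "(\<Union>v\<in>verts G. wt G v) \<union> col G ` edges G = {1..s}"
  shows "weighted_graph s G"
proof -
  have "is_cycle k G" using assms(3) unfolding is_cycle_def cycle_indexing_def by blast
  moreover have "wt G v \<subseteq> {1..s}" if "v \<in> verts G" for v
    unfolding assms(11)[symmetric] using that by blast
  ultimately show ?thesis
    unfolding weighted_graph_def one_loop_admissible_def holocoloring_def disjoint_family_on_def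
    by (intro conjI ballI impI exI[of _ k] assms) auto
qed

lemma weighted_graphD:
  assumes "weighted_graph s G"
  shows "\<And>i. i \<in> {1..s} \<Longrightarrow> leg G i \<in> verts G" "\<And>v. v \<in> verts G \<Longrightarrow> legs_at s G v \<noteq> {}"
    and "inj_on (col G) (edges G)" "col G ` edges G \<subseteq> {1..s}"
    and "\<And>v. v \<in> verts G \<Longrightarrow> card (wt G v) = card (legs_at s G v) - 1"
    and "\<And>v. v \<in> verts G \<Longrightarrow> wt G v \<subseteq> {1..s}"
    and "\<And>u v. u \<in> verts G \<Longrightarrow> v \<in> verts G \<Longrightarrow> u \<noteq> v \<Longrightarrow> wt G u \<inter> wt G v = {}"
    and "\<And>v. v \<in> verts G \<Longrightarrow> wt G v \<inter> col G ` edges G = {}"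
    and "(\<Union>v\<in>verts G. wt G v) \<union> col G ` edges G = {1..s}"
  using assms unfolding weighted_graph_def one_loop_admissible_def holocoloring_def disjoint_family_on_def
  by simp_all

lemma weighted_graph_cycle:
  assumes "weighted_graph s G"
  obtains k v e where "1 \<le> k" "k \<le> s" "cycle_indexing k v e G"
proof -
  have "\<exists>k. 1 \<le> k \<and> k \<le> s \<and> is_cycle k G"
    using assms by (simp only: weighted_graph_def one_loop_admissible_def)
  then obtain k where k: "1 \<le> k" "k \<le> s" "is_cycle k G" by blast
  from k(3) show thesis
    using that[OF k(1,2)] unfolding is_cycle_def cycle_indexing_def by blast
qed

lemma cycle_indexing_card:
  assumes "cycle_indexing k v e G"
  shows "finite (verts G)" "finite (edges G)" "card (verts G) = k" "card (edges G) = k"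
proof -
  have v: "bij_betw v {..<k} (verts G)" and e: "bij_betw e {..<k} (edges G)"
    using assms by (simp_all add: cycle_indexing_def)
  show "finite (verts G)" "finite (edges G)"
    using bij_betw_finite[OF v] bij_betw_finite[OF e] by simp_all
  show "card (verts G) = k" "card (edges G) = k"
    using bij_betw_same_card[OF v] bij_betw_same_card[OF e] by simp_all
qed

lemma cycle_indexing_ends_subset:
  assumes "cycle_indexing k v e G" "d \<in> edges G"
  shows "set_uprod (ends G d) \<subseteq> verts G"
proof -
  have v: "bij_betw v {..<k} (verts G)" and e: "bij_betw e {..<k} (edges G)"
    using assms(1) by (simp_all add: cycle_indexing_def)
  obtain i where i: "i < k" "d = e i" using bij_betw_imp_surj_on[OF e] assms(2) by auto
  then have "ends G d = Upair (v i) (v ((i + 1) mod k))" using assms(1) by (simp add: cycle_indexing_def)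
  moreover have "v i \<in> verts G" "v ((i + 1) mod k) \<in> verts G"
    using bij_betwE[OF v] i by auto
  ultimately show ?thesis by simp
qed

lemma wf_graph_weighted: "weighted_graph s G \<Longrightarrow> wf_graph s G"
  unfolding wf_graph_def
  using weighted_graph_cycle cycle_indexing_ends_subset weighted_graphD(1) by metis

lemma bij_betw_rotate: "bij_betw (\<lambda>i. (i + r) mod k) {..<k} {..<k::nat}"
proof (cases "k = 0")
  case False
  define t where "t = k - r mod k"
  have "r mod k < k" using False by simp
  then have "r + t = k * (r div k) + k"
    using mult_div_mod_eq[of k r] unfolding t_def by linarith
  then have rt: "(i + (r + t)) mod k = i" "(i + (t + r)) mod k = i" if "i < k" for i
    using that by (simp_all add: add.commute[of t] flip: add.assoc)
  show ?thesis
  proof (rule bij_betwI[where g = "\<lambda>i. (i + t) mod k"])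
    show "((i + r) mod k + t) mod k = i" if "i \<in> {..<k}" for i
      using rt(1)[of i] that by (simp add: mod_add_left_eq add.assoc)
    show "((i + t) mod k + r) mod k = i" if "i \<in> {..<k}" for i
      using rt(2)[of i] that by (simp add: mod_add_left_eq add.assoc)
  qed (use False in auto)
qed (simp add: bij_betw_def)

lemma cycle_indexing_rotate:
  assumes "cycle_indexing k v e G"
  shows "cycle_indexing k (\<lambda>i. v ((i + r) mod k)) (\<lambda>i. e ((i + r) mod k)) G"
proof -
  have "bij_betw (v \<circ> (\<lambda>i. (i + r) mod k)) {..<k} (verts G)"
    using assms bij_betw_trans[OF bij_betw_rotate] by (auto simp: cycle_indexing_def)
  moreover have "bij_betw (e \<circ> (\<lambda>i. (i + r) mod k)) {..<k} (edges G)"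
    using assms bij_betw_trans[OF bij_betw_rotate] by (auto simp: cycle_indexing_def)
  moreover have "ends G (e ((i + r) mod k)) = Upair (v ((i + r) mod k)) (v (((i + 1) mod k + r) mod k))"
    if "i < k" for i
  proof -
    have "((i + r) mod k + 1) mod k = ((i + 1) mod k + r) mod k"
      by (simp add: mod_simps ac_simps)
    moreover have "(i + r) mod k < k" using that by simp
    ultimately show ?thesis using assms by (simp add: cycle_indexing_def)
  qed
  ultimately show ?thesis by (simp add: cycle_indexing_def o_def)
qed

text \<open>Rotating a chosen edge to the end means that its removal merely shortens the index range
  by one.\<close>

lemma cycle_indexing_last_edge:
  assumes "cycle_indexing k v e G" "d \<in> edges G"
  obtains v' e' where "cycle_indexing k v' e' G" "e' (k - 1) = d"
proof -
  have "bij_betw e {..<k} (edges G)" using assms(1) by (simp add: cycle_indexing_def)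
  then obtain i where i: "i < k" "d = e i" using bij_betw_imp_surj_on assms(2) by blast
  have "(k - 1 + (i + 1)) mod k = i" using i by simp
  then show ?thesis using that[OF cycle_indexing_rotate[OF assms(1), of "i + 1"]] i by simp
qed

lemma cycle_indexing_last_vertex:
  assumes "cycle_indexing k v e G" "u \<in> verts G"
  obtains v' e' where "cycle_indexing k v' e' G" "v' (k - 1) = u"
proof -
  have "bij_betw v {..<k} (verts G)" using assms(1) by (simp add: cycle_indexing_def)
  then obtain i where i: "i < k" "u = v i" using bij_betw_imp_surj_on assms(2) by blast
  have "(k - 1 + (i + 1)) mod k = i" using i by simp
  then show ?thesis using that[OF cycle_indexing_rotate[OF assms(1), of "i + 1"]] i by simp
qed

section \<open>Collapsing one edge and a set of edges\<close>

lemma bij_betw_lessThan_pred: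
  fixes k :: nat
  assumes "bij_betw f {..<k} A" "k \<ge> 1"
  shows "bij_betw f {..<k - 1} (A - {f (k - 1)})"
proof -
  have "{..<k} - {k - 1} = {..<k - 1}" using assms(2) by auto
  then show ?thesis
    using assms inj_on_image_set_diff[of f "{..<k}" "{..<k}" "{k - 1}"]
    by (auto simp: bij_betw_def intro: inj_on_subset)
qed

text \<open>Rotate so that \<open>d\<close> is the last edge, joining \<open>v (k - 1)\<close> to
  \<open>v 0\<close>. Merging these two vertices closes the remaining \<open>k - 1\<close> edges to
  a shorter cycle.\<close>

lemma collapse_edge_weighted:
  fixes G :: "('v::linorder, 'e) coloured_graph"
  assumes G: "weighted_graph s G" and d: "d \<in> edges G" "proper_uprod (ends G d)"
  shows "weighted_graph s (collapse_edge d G)" "edges (collapse_edge d G) = edges G - {d}"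
    "col (collapse_edge d G) = col G" "\<exists>q. contraction s q id {d} G (collapse_edge d G)"
proof -
  note W = weighted_graphD[OF G]
  obtain k v e where k: "1 \<le> k" "k \<le> s" and cyc0: "cycle_indexing k v e G"
    using weighted_graph_cycle[OF G] .
  obtain v e where cyc: "cycle_indexing k v e G" and ed: "e (k - 1) = d"
    using cycle_indexing_last_edge[OF cyc0 d(1)] .
  have v: "bij_betw v {..<k} (verts G)" and e: "bij_betw e {..<k} (edges G)"
    and ends: "\<And>i. i < k \<Longrightarrow> ends G (e i) = Upair (v i) (v ((i + 1) mod k))"
    using cyc by (simp_all add: cycle_indexing_def)
  define a where "a = v (k - 1)"
  define b where "b = v 0"
  have endd: "ends G d = Upair a b" using ends[of "k - 1"] k ed by (simp add: a_def b_def)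
  have ab: "a \<noteq> b" using d(2) endd by simp
  have k2: "2 \<le> k" using ab k by (cases "k = 1") (auto simp: a_def b_def)
  have abV: "a \<in> verts G" "b \<in> verts G" using bij_betwE[OF v] k by (auto simp: a_def b_def)
  define m where "m = min a b"
  define q where "q = (\<lambda>x. if x \<in> {a, b} then m else x)"
  define H where "H = collapse_edge d G"
  have mab: "m \<in> {a, b}" by (simp add: m_def min_def)
  have H: "H = \<lparr>verts = q ` verts G, edges = edges G - {d}, ends = (\<lambda>x. map_uprod q (ends G x)),
      leg = (\<lambda>i. q (leg G i)), col = col G, wt = (wt G)(m := (\<Union>v\<in>{a, b}. wt G v) \<union> {col G d})\<rparr>"
  proof -
    have B: "set_uprod (Upair a b) = {a, b}" "Min {a, b} = m" by (simp_all add: m_def)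
    show ?thesis unfolding H_def collapse_edge_def Let_def endd B q_def by simp
  qed
  have qm: "q x = m \<longleftrightarrow> x \<in> {a, b}" for x using mab by (auto simp: q_def)
  have qo: "q x = y \<longleftrightarrow> x = y" if "y \<notin> {a, b}" for x y using mab that by (auto simp: q_def)
  have vH: "verts H = insert m (verts G - {a, b})" using abV by (auto simp: H q_def)
  show eH: "edges (collapse_edge d G) = edges G - {d}" and cH: "col (collapse_edge d G) = col G"
    using H by (simp_all flip: H_def)
  have con: "contraction s q id {d} G H"
    unfolding contraction_def
  proof (intro conjI ballI impI)
    show "wt H y = (\<Union>u\<in>{u \<in> verts G. q u = y}. wt G u) \<union> col G ` {e \<in> {d}. y \<in> q ` set_uprod (ends G e)}"
      if y: "y \<in> verts H" for y
    proof (cases "y = m")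
      case True
      have "{u \<in> verts G. q u = m} = {a, b}" using qm abV by auto
      moreover have "{e \<in> {d}. m \<in> q ` set_uprod (ends G e)} = {d}" using endd by (auto simp: q_def)
      ultimately show ?thesis using True by (simp add: H)
    next
      case False
      then have y': "y \<in> verts G" "y \<notin> {a, b}" using y vH by auto
      then have "{u \<in> verts G. q u = y} = {y}" using qo[OF y'(2)] by auto
      moreover have "{e \<in> {d}. y \<in> q ` set_uprod (ends G e)} = {}" using endd False by (auto simp: q_def)
      ultimately show ?thesis using False unfolding H by (simp only: legged_graph.simps coloured_graph.simps fun_upd_other) simp
    qed
    show "(x, y) \<in> conn G {d}" if "x \<in> verts G" "y \<in> verts G" "q x = q y" for x y
    proof (cases "x = y")
      case False
      then have "x \<in> {a, b}" "y \<in> {a, b}" using that(3) mab by (auto simp: q_def split: if_splits)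
      then show ?thesis by (intro conn_edge[of d]) (auto simp: endd)
    qed simp
  qed (use d(1) endd in \<open>auto simp: H uprod.set_map q_def\<close>)
  then show "\<exists>q. contraction s q id {d} G (collapse_edge d G)" unfolding H_def by blast
  have legs_m: "legs_at s H m = legs_at s G a \<union> legs_at s G b"
    using qm by (auto simp: legs_at_def H)
  have legs_o: "legs_at s H y = legs_at s G y" if "y \<notin> {a, b}" for y
    using qo[OF that] by (auto simp: legs_at_def H)
  have wt_m: "wt H m = insert (col G d) (wt G a \<union> wt G b)" by (auto simp: H)
  have wt_o: "wt H y = wt G y" if "y \<notin> {a, b}" for y
    using that mab by (auto simp: H)
  have cd: "col G d \<in> col G ` edges G" using d by blast
  have dis: "wt G x \<inter> wt G y = {}" "col G d \<notin> wt G x" if "x \<in> verts G" "y \<in> verts G" "x \<noteq> y" for x y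
    using W(7)[OF that] W(8)[OF that(1)] cd by blast+
  have "weighted_graph s H"
  proof (rule weighted_graphI)
    show "1 \<le> k - 1" "k - 1 \<le> s" using k k2 by auto
    show "cycle_indexing (k - 1) (q \<circ> v) e H"
      unfolding cycle_indexing_def
    proof (intro conjI allI impI)
      have "bij_betw v {..<k - 1} (verts G - {a})"
        using bij_betw_lessThan_pred[OF v k(1)] by (simp add: a_def)
      moreover have "bij_betw q (verts G - {a}) (verts H)"
        unfolding bij_betw_def vH
      proof
        show "inj_on q (verts G - {a})" using mab by (auto simp: inj_on_def q_def)
        show "q ` (verts G - {a}) = insert m (verts G - {a, b})"
          using abV ab by (auto simp: q_def image_iff)
      qed
      ultimately show "bij_betw (q \<circ> v) {..<k - 1} (verts H)" by (rule bij_betw_trans)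
      show "bij_betw e {..<k - 1} (edges H)"
        using bij_betw_lessThan_pred[OF e k(1)] ed by (simp add: H)
      fix i assume i: "i < k - 1"
      \<comment> \<open>At the wrap-around the old successor is \<open>a = v (k - 1)\<close> and the
        new one is \<open>b = v 0\<close>; \<open>q\<close> identifies them.\<close>
      have "q (v ((i + 1) mod k)) = q (v ((i + 1) mod (k - 1)))"
      proof (cases "i + 1 = k - 1")
        case True
        then have "v ((i + 1) mod k) = a" "v ((i + 1) mod (k - 1)) = b" using k2 by (auto simp: a_def b_def)
        then show ?thesis by (simp add: q_def)
      qed (use i in simp)
      then show "ends H (e i) = Upair ((q \<circ> v) i) ((q \<circ> v) ((i + 1) mod (k - 1)))"
        using ends[of i] i by (simp add: H)
    qed
    show "leg H i \<in> verts H" if "i \<in> {1..s}" for i using W(1)[OF that] by (simp add: H)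
    show "legs_at s H y \<noteq> {}" if "y \<in> verts H" for y
    proof (cases "y = m")
      case True
      then show ?thesis using W(2)[OF abV(1)] legs_m by simp
    next
      case False
      then have "y \<in> verts G" "y \<notin> {a, b}" using that vH by auto
      then show ?thesis using W(2) legs_o by simp
    qed
    show "inj_on (col H) (edges H)" using W(3) by (auto simp: H intro: inj_on_subset)
    show "col H ` edges H \<subseteq> {1..s}" using W(4) by (auto simp: H)
    show "card (wt H y) = card (legs_at s H y) - 1" if "y \<in> verts H" for y
    proof (cases "y = m")
      case True
      have fin: "finite (wt G a)" "finite (wt G b)" "finite (legs_at s G a)" "finite (legs_at s G b)"
        using W(6)[OF abV(1)] W(6)[OF abV(2)] by (auto intro: finite_subset simp: legs_at_def)
      have "card (wt H m) = Suc (card (wt G a) + card (wt G b))"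
        unfolding wt_m using fin dis[OF abV ab] dis[OF abV(2,1)] ab by (simp add: card_Un_disjoint)
      moreover have "card (legs_at s H m) = card (legs_at s G a) + card (legs_at s G b)"
        unfolding legs_m using fin ab by (intro card_Un_disjoint) (auto simp: legs_at_def)
      \<comment> \<open>The weights add up as \<open>(p - 1) + (q - 1) + 1 = (p + q) - 1\<close> for
        \<open>p\<close> and \<open>q\<close> legs; both numbers must be positive for the truncated
        subtraction to be exact.\<close>
      moreover have "card (legs_at s G a) > 0" "card (legs_at s G b) > 0"
        using W(2)[OF abV(1)] W(2)[OF abV(2)] fin by (simp_all add: card_gt_0_iff)
      ultimately show ?thesis using W(5)[OF abV(1)] W(5)[OF abV(2)] True by simp
    next
      case False
      then have "y \<in> verts G" "y \<notin> {a, b}" using that vH by auto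
      then show ?thesis using W(5) legs_o wt_o by simp
    qed
    have m_dis: "wt H m \<inter> wt G y = {}" if "y \<in> verts G" "y \<notin> {a, b}" for y
      unfolding wt_m using dis[OF abV(1) that(1)] dis[OF abV(2) that(1)] dis(2)[OF that(1) abV(1)] that by blast
    show "wt H x \<inter> wt H y = {}" if xy: "x \<in> verts H" "y \<in> verts H" "x \<noteq> y" for x y
    proof -
      consider "x = m" "y \<in> verts G - {a, b}" | "y = m" "x \<in> verts G - {a, b}"
        | "x \<in> verts G - {a, b}" "y \<in> verts G - {a, b}"
        using xy unfolding vH by blast
      then show ?thesis
        by cases (use m_dis wt_o W(7) xy(3) in \<open>auto simp: Int_commute\<close>)
    qed
    show "wt H y \<inter> col H ` edges H = {}" if "y \<in> verts H" for y
    proof (cases "y = m")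
      case True
      have "col G d \<notin> col G ` (edges G - {d})" using W(3) d(1) by (auto simp: inj_on_def)
      moreover have "wt G a \<inter> col G ` (edges G - {d}) = {}" "wt G b \<inter> col G ` (edges G - {d}) = {}"
        using W(8)[OF abV(1)] W(8)[OF abV(2)] by blast+
      ultimately show ?thesis using True wt_m by (simp add: H Int_Un_distrib2)
    next
      case False
      then have "y \<in> verts G" "y \<notin> {a, b}" using that vH by auto
      then show ?thesis using W(8)[of y] wt_o by (auto simp: H)
    qed
    have "(\<Union>v\<in>verts H. wt H v) = wt H m \<union> (\<Union>v\<in>verts G - {a, b}. wt G v)"
      unfolding vH using wt_o by auto
    also have "\<dots> = insert (col G d) (\<Union>v\<in>verts G. wt G v)"
      unfolding wt_m using abV by blast
    finally have "(\<Union>v\<in>verts H. wt H v) \<union> col H ` edges H = (\<Union>v\<in>verts G. wt G v) \<union> col G ` edges G"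
      using d(1) by (auto simp: H)
    then show "(\<Union>v\<in>verts H. wt H v) \<union> col H ` edges H = {1..s}" using W(9) by simp
  qed
  then show "weighted_graph s (collapse_edge d G)" by (simp add: H_def)
qed

text \<open>The labels depend only on which colours survive, so the order of the collapses and the
  names of merged vertices leave no trace.\<close>

lemma collapses_weighted:
  assumes "collapses G Z H" "weighted_graph s G"
  shows "weighted_graph s H \<and> Z \<subseteq> edges G \<and> edges H = edges G - Z \<and> col H = col G \<and>
    (\<forall>F. (\<forall>e\<in>Z. col G e \<notin> Suc ` F) \<longrightarrow> colour_blocks s F H = colour_blocks s F G)"
  using assms
proof (induction rule: collapses.induct)
  case (insert e G Z H)
  note C = collapse_edge_weighted[OF insert.prems insert.hyps(1,2)]
  note IH = insert.IH[OF C(1)]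
  obtain q where q: "contraction s q id {e} G (collapse_edge e G)" using C(4) by blast
  have "colour_blocks s F H = colour_blocks s F G" if "\<forall>d\<in>insert e Z. col G d \<notin> Suc ` F" for F
    using IH colour_blocks_contraction[OF wf_graph_weighted[OF insert.prems] q, of F] that C(3) by simp
  then show ?case using IH C insert.hyps(1) by auto
qed auto

text \<open>A cycle contains a loop only when a single edge is left. Since \<open>A\<close> is a
  proper subset, at least two edges are present before each collapse.\<close>

lemma collapses_exist:
  assumes "finite A" "weighted_graph s G" "A \<subset> edges G"
  shows "\<exists>H. collapses G A H"
  using assms
proof (induction A arbitrary: G rule: finite_induct)
  case empty
  then show ?case using collapses.empty by blast
next
  case (insert d A)
  have d: "d \<in> edges G" using insert.prems by blast
  obtain k v e where k: "1 \<le> k" and cyc0: "cycle_indexing k v e G"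
    using weighted_graph_cycle[OF insert.prems(1)] .
  obtain v e where cyc: "cycle_indexing k v e G" and ed: "e (k - 1) = d"
    using cycle_indexing_last_edge[OF cyc0 d] .
  have "card (insert d A) < card (edges G)"
    using insert.prems cycle_indexing_card[OF cyc] by (intro psubset_card_mono) auto
  then have k2: "k \<ge> 2" using cycle_indexing_card(4)[OF cyc] insert.hyps by simp
  have "ends G d = Upair (v (k - 1)) (v 0)"
    using cyc k ed unfolding cycle_indexing_def by (metis add.commute le_add_diff_inverse mod_self diff_less less_numeral_extra(1) less_le_trans)
  moreover have "v (k - 1) \<noteq> v 0"
    using cyc k2 inj_onD[of v "{..<k}" "k - 1" 0] by (auto simp: cycle_indexing_def bij_betw_def)
  ultimately have nonloop: "proper_uprod (ends G d)" by simp
  note C = collapse_edge_weighted[OF insert.prems(1) d nonloop]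
  have "A \<subset> edges (collapse_edge d G)" using insert.prems(2) insert.hyps C(2) by auto
  then obtain H where "collapses (collapse_edge d G) A H" using insert.IH[OF C(1)] by blast
  then show ?case using collapses.insert[OF d nonloop] by blast
qed

section \<open>Maximal graphs\<close>

lemma sum_card_legs:
  assumes G: "weighted_graph s G"
  shows "(\<Sum>v\<in>verts G. card (legs_at s G v)) = s"
proof -
  obtain k v e where cyc: "cycle_indexing k v e G" using weighted_graph_cycle[OF G] .
  have "(\<Union>v\<in>verts G. legs_at s G v) = {1..s}"
    using weighted_graphD(1)[OF G] by (auto simp: legs_at_def)
  moreover have "card (\<Union>v\<in>verts G. legs_at s G v) = (\<Sum>v\<in>verts G. card (legs_at s G v))"
    by (rule card_UN_disjoint) (auto simp: cycle_indexing_card[OF cyc] legs_at_def)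
  ultimately show ?thesis by simp
qed

lemma finite_legs_at: "finite (legs_at s G v)"
  by (simp add: legs_at_def)

text \<open>Inverse of a collapse. With fewer than \<open>s\<close> edges some vertex
  \<open>u\<close> carries two legs, hence a colour in its weight; one leg is split off to a new
  vertex, joined to \<open>u\<close> by a new edge of that colour.\<close>

lemma expand_weighted_graph:
  fixes G :: "(nat, nat) coloured_graph"
  assumes G: "weighted_graph s G" and less: "card (edges G) < s"
  obtains G' :: "(nat, nat) coloured_graph" and q d where "weighted_graph s G'" "card (edges G') = Suc (card (edges G))"
    "contraction s q id {d} G' G" "col G' d \<notin> col G ` edges G" "col G ` edges G \<subseteq> col G' ` edges G'"
proof -
  note W = weighted_graphD[OF G]
  obtain k v0 e0 where k: "1 \<le> k" "k \<le> s" and cyc0: "cycle_indexing k v0 e0 G"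
    using weighted_graph_cycle[OF G] .
  note cards = cycle_indexing_card[OF cyc0]
  \<comment> \<open>Pigeonhole: \<open>s\<close> legs are spread over fewer than \<open>s\<close>
    vertices.\<close>
  have "\<exists>u\<in>verts G. card (legs_at s G u) \<ge> 2"
  proof (rule ccontr)
    assume "\<not> ?thesis"
    then have "card (legs_at s G u) \<le> 1" if "u \<in> verts G" for u using that by (metis not_less_eq_eq numeral_2_eq_2 One_nat_def)
    then have "(\<Sum>u\<in>verts G. card (legs_at s G u)) \<le> (\<Sum>u\<in>verts G. 1)" by (intro sum_mono) auto
    then show False using sum_card_legs[OF G] cards less by simp
  qed
  then obtain u where u: "u \<in> verts G" "card (legs_at s G u) \<ge> 2" by blast
  obtain v e where cyc: "cycle_indexing k v e G" and vu: "v (k - 1) = u"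
    using cycle_indexing_last_vertex[OF cyc0 u(1)] .
  have v: "bij_betw v {..<k} (verts G)" and e: "bij_betw e {..<k} (edges G)"
    and ends: "\<And>i. i < k \<Longrightarrow> ends G (e i) = Upair (v i) (v ((i + 1) mod k))"
    using cyc by (simp_all add: cycle_indexing_def)
  define a where "a = e (k - 1)"
  define b where "b = v 0"
  have a: "a \<in> edges G" using bij_betwE[OF e] k by (simp add: a_def)
  have b: "b \<in> verts G" using bij_betwE[OF v] k by (simp add: b_def)
  have enda: "ends G a = Upair u b" using ends[of "k - 1"] k vu by (simp add: a_def b_def)
  obtain w where w: "w \<notin> verts G" using cards(1) ex_new_if_finite infinite_UNIV_nat by blast
  obtain d where d: "d \<notin> edges G" using cards(2) ex_new_if_finite infinite_UNIV_nat by blast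
  obtain i0 where i0: "i0 \<in> legs_at s G u" using W(2)[OF u(1)] by blast
  have i0': "leg G i0 = u" "i0 \<in> {1..s}" using i0 by (auto simp: legs_at_def)
  have "card (wt G u) > 0" using W(5)[OF u(1)] u(2) by simp
  then obtain x where x: "x \<in> wt G u" by (metis card.empty ex_in_conv less_irrefl)
  have xs: "x \<in> {1..s}" using W(6)[OF u(1)] x by blast
  have xc: "x \<notin> col G ` edges G" using W(8)[OF u(1)] x by blast
  \<comment> \<open>The edge \<open>a\<close> from \<open>u\<close> to \<open>b\<close> is replaced
    by the path \<open>u\<close>, \<open>w\<close>, \<open>b\<close>, with first edge
    \<open>d\<close> and second edge \<open>a\<close>. If \<open>G\<close> has one vertex then
    \<open>b = u\<close>, and the loop \<open>a\<close> becomes one of two parallel edges.\<close>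
  define G' where "G' = \<lparr>verts = insert w (verts G), edges = insert d (edges G),
    ends = (ends G)(d := Upair u w, a := Upair w b), leg = (leg G)(i0 := w),
    col = (col G)(d := x), wt = (wt G)(u := wt G u - {x}, w := {})\<rparr>"
  have ad: "a \<noteq> d" "d \<noteq> a" and uw: "u \<noteq> w" "w \<noteq> u" and bw: "b \<noteq> w" using a d u(1) w b by auto
  define q where "q = (\<lambda>y. if y = w then u else y)"
  have qV: "q y = y" if "y \<in> verts G" for y using that w by (auto simp: q_def)
  have sub: "set_uprod (ends G f) \<subseteq> verts G" if "f \<in> edges G" for f
    using cycle_indexing_ends_subset[OF cyc that] .
  have con: "contraction s q id {d} G' G"
    unfolding contraction_def
  proof (intro conjI ballI impI)
    show "q ` verts G' = verts G" using qV u(1) w by (auto simp: G'_def q_def image_iff)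
    show "bij_betw id (edges G' - {d}) (edges G)" using d by (simp add: G'_def)
    show "set_uprod (ends G (id f)) = q ` set_uprod (ends G' f)" if f: "f \<in> edges G' - {d}" for f
    proof (cases "f = a")
      case True
      then show ?thesis using enda bw by (auto simp: G'_def q_def)
    next
      case False
      then have "f \<in> edges G" "ends G' f = ends G f" using f by (auto simp: G'_def)
      moreover have "q ` set_uprod (ends G f) = (\<lambda>y. y) ` set_uprod (ends G f)"
        using sub[of f] f qV by (intro image_cong) (auto simp: G'_def)
      ultimately show ?thesis by simp
    qed
    show "leg G i = q (leg G' i)" if "i \<in> {1..s}" for i
      using W(1)[OF that] w i0' by (auto simp: G'_def q_def)
    show "wt G y = (\<Union>u\<in>{u \<in> verts G'. q u = y}. wt G' u) \<union> col G' ` {e \<in> {d}. y \<in> q ` set_uprod (ends G' e)}"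
      if y: "y \<in> verts G" for y
    proof (cases "y = u")
      case True
      have "{z \<in> verts G'. q z = u} = {u, w}" using u(1) qV by (auto simp: G'_def q_def)
      moreover have "{e \<in> {d}. u \<in> q ` set_uprod (ends G' e)} = {d}" using ad by (auto simp: G'_def q_def)
      ultimately show ?thesis using True x ad uw by (auto simp: G'_def)
    next
      case False
      have "{z \<in> verts G'. q z = y} = {y}" using False y w by (auto simp: G'_def q_def)
      moreover have "{e \<in> {d}. y \<in> q ` set_uprod (ends G' e)} = {}" using ad False by (auto simp: G'_def q_def)
      moreover have "wt G' y = wt G y" using False y w by (auto simp: G'_def)
      ultimately show ?thesis by (simp only:) simp
    qed
    show "(y, z) \<in> conn G' {d}" if "y \<in> verts G'" "z \<in> verts G'" "q y = q z" for y z
    proof (cases "y = z")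
      case False
      then have "y \<in> {u, w}" "z \<in> {u, w}" using that by (auto simp: q_def split: if_splits)
      then show ?thesis using ad by (intro conn_edge[of d]) (auto simp: G'_def)
    qed simp
  qed (use ad d in \<open>auto simp: G'_def q_def\<close>)
  have legs_w: "legs_at s G' w = {i0}"
    using W(1) w i0' by (auto simp: G'_def legs_at_def)
  have legs_u: "legs_at s G' u = legs_at s G u - {i0}"
    using uw by (auto simp: G'_def legs_at_def)
  have legs_o: "legs_at s G' y = legs_at s G y" if "y \<noteq> u" "y \<noteq> w" for y
    using that i0' by (auto simp: G'_def legs_at_def)
  have wt: "wt G' w = {}" "wt G' u = wt G u - {x}" "\<And>y. y \<noteq> u \<Longrightarrow> y \<noteq> w \<Longrightarrow> wt G' y = wt G y"
    using uw by (auto simp: G'_def)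
  have colG': "col G' ` edges G' = insert x (col G ` edges G)" using d by (auto simp: G'_def)
  have G': "weighted_graph s G'"
  proof (rule weighted_graphI)
    show "1 \<le> Suc k" "Suc k \<le> s" using less cards by auto
    \<comment> \<open>\<open>w\<close> is appended after \<open>u = v (k - 1)\<close>; the edge
      \<open>d\<close> takes the index \<open>k - 1\<close> of \<open>a\<close>, and
      \<open>a\<close> moves to \<open>k\<close>, where it closes the cycle.\<close>
    show "cycle_indexing (Suc k) (v(k := w)) (e(k - 1 := d, k := a)) G'"
      unfolding cycle_indexing_def
    proof (intro conjI allI impI)
      have lk: "{..<Suc k} = insert k {..<k}" by auto
      have "bij_betw (v(k := w)) {..<k} (verts G)"
        using v by (rule bij_betw_cong[THEN iffD1, rotated]) auto
      then show "bij_betw (v(k := w)) {..<Suc k} (verts G')"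
        using w notIn_Un_bij_betw[of k "{..<k}" "v(k := w)" "verts G"] by (simp add: lk G'_def)
      have img: "(e(k - 1 := d, k := a)) ` {..<Suc k} = edges G'"
      proof -
        have "{..<Suc k} = {..<k - 1} \<union> {k - 1, k}" using k by auto
        moreover have "(e(k - 1 := d, k := a)) ` {..<k - 1} = edges G - {a}"
        proof -
          have "(e(k - 1 := d, k := a)) ` {..<k - 1} = e ` {..<k - 1}" by (rule image_cong) auto
          then show ?thesis using bij_betw_imp_surj_on[OF bij_betw_lessThan_pred[OF e k(1)]] by (simp add: a_def)
        qed
        moreover have "(e(k - 1 := d, k := a)) ` {k - 1, k} = {d, a}" using k by auto
        ultimately have "(e(k - 1 := d, k := a)) ` {..<Suc k} = (edges G - {a}) \<union> {d, a}"
          by (simp only: image_Un)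
        then show ?thesis using a by (auto simp: G'_def)
      qed
      moreover have "inj_on (e(k - 1 := d, k := a)) {..<Suc k}"
        by (rule eq_card_imp_inj_on) (use img d cards in \<open>simp_all add: G'_def\<close>)
      ultimately show "bij_betw (e(k - 1 := d, k := a)) {..<Suc k} (edges G')" by (simp add: bij_betw_def)
      fix i assume i: "i < Suc k"
      then consider "i < k - 1" | "i = k - 1" "i \<noteq> k" | "i = k" using k by linarith
      then show "ends G' ((e(k - 1 := d, k := a)) i) =
          Upair ((v(k := w)) i) ((v(k := w)) ((i + 1) mod Suc k))"
      proof cases
        case 1
        then have "i < k" "i \<noteq> k - 1" by auto
        then have "e i \<in> edges G" "e i \<noteq> a"
          using bij_betwE[OF e] inj_onD[OF bij_betw_imp_inj_on[OF e], of i "k - 1"] by (auto simp: a_def)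
        then have "ends G' (e i) = ends G (e i)" using d by (auto simp: G'_def)
        moreover have "(i + 1) mod Suc k = i + 1" "(i + 1) mod k = i + 1" "i \<noteq> k" "i \<noteq> k - 1" "i + 1 \<noteq> k"
          using 1 by auto
        ultimately show ?thesis using ends[of i] \<open>i < k\<close> by simp
      next
        case 2
        then show ?thesis using k vu ad by (simp add: G'_def)
      next
        case 3
        then show ?thesis using k by (simp add: G'_def b_def)
      qed
    qed
    show "leg G' i \<in> verts G'" if "i \<in> {1..s}" for i using W(1)[OF that] by (simp add: G'_def)
    have u2: "legs_at s G u - {i0} \<noteq> {}"
      using u(2) i0 card_Diff_singleton[OF i0] by (metis card.empty diff_is_0_eq not_less_eq_eq numeral_2_eq_2 One_nat_def)
    show "legs_at s G' y \<noteq> {}" if y: "y \<in> verts G'" for y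
    proof -
      consider "y = w" | "y = u" | "y \<in> verts G" "y \<noteq> u" "y \<noteq> w" using y by (auto simp: G'_def)
      then show ?thesis by cases (use u2 legs_w legs_u legs_o W(2) in auto)
    qed
    show "inj_on (col G') (edges G')"
    proof -
      have "inj_on (col G') (edges G)" using W(3) d by (auto simp: G'_def inj_on_def)
      moreover have "col G' d \<notin> col G' ` (edges G - {d})" using xc d by (auto simp: G'_def)
      ultimately show ?thesis unfolding G'_def by simp
    qed
    show "col G' ` edges G' \<subseteq> {1..s}" unfolding colG' using W(4) xs by simp
    show "card (wt G' y) = card (legs_at s G' y) - 1" if y: "y \<in> verts G'" for y
    proof -
      consider "y = w" | "y = u" | "y \<in> verts G" "y \<noteq> u" "y \<noteq> w" using y by (auto simp: G'_def)
      then show ?thesis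
      proof cases
        case 2
        then show ?thesis using W(5)[OF u(1)] x i0 by (simp add: wt legs_u card_Diff_singleton)
      qed (use W(5) legs_w legs_o wt in auto)
    qed
    have old: "y \<in> verts G" if "y \<in> verts G'" "y \<noteq> w" for y using that by (simp add: G'_def)
    have le: "wt G' y \<subseteq> wt G y" if "y \<in> verts G'" for y using wt by (cases "y = w"; cases "y = u") auto
    show "wt G' y \<inter> wt G' z = {}" if yz: "y \<in> verts G'" "z \<in> verts G'" "y \<noteq> z" for y z
    proof (cases "y = w \<or> z = w")
      case False
      then show ?thesis using W(7)[OF old[OF yz(1)] old[OF yz(2)] yz(3)] le[OF yz(1)] le[OF yz(2)] by blast
    qed (use wt in auto)
    show "wt G' y \<inter> col G' ` edges G' = {}" if y: "y \<in> verts G'" for y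
    proof (cases "y = w")
      case False
      note yV = old[OF y False]
      have "x \<notin> wt G' y"
        using wt(2) wt(3)[of y] False W(7)[OF yV u(1)] x by (cases "y = u") auto
      then show ?thesis using W(8)[OF yV] le[OF y] unfolding colG' by blast
    qed (use wt in auto)
    have "(\<Union>y\<in>verts G'. wt G' y) = (wt G u - {x}) \<union> (\<Union>y\<in>verts G - {u}. wt G y)"
    proof -
      have "verts G' = insert w (insert u (verts G - {u}))" using u(1) by (auto simp: G'_def)
      then have "(\<Union>y\<in>verts G'. wt G' y) = wt G' w \<union> wt G' u \<union> (\<Union>y\<in>verts G - {u}. wt G' y)" by auto
      moreover have "(\<Union>y\<in>verts G - {u}. wt G' y) = (\<Union>y\<in>verts G - {u}. wt G y)"
        using wt(3) w by (intro SUP_cong) auto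
      ultimately show ?thesis using wt by simp
    qed
    moreover have "(wt G u - {x}) \<union> (\<Union>y\<in>verts G - {u}. wt G y) \<union> {x} = (\<Union>y\<in>verts G. wt G y)"
      using u(1) x by blast
    ultimately show "(\<Union>y\<in>verts G'. wt G' y) \<union> col G' ` edges G' = {1..s}"
      unfolding colG' W(9)[symmetric] by blast
  qed
  show thesis
  proof (rule that[OF G' _ con])
    show "card (edges G') = Suc (card (edges G))" using d cards by (simp add: G'_def)
    show "col G' d \<notin> col G ` edges G" using xc by (simp add: G'_def)
    show "col G ` edges G \<subseteq> col G' ` edges G'" unfolding colG' by blast
  qed
qed

text \<open>Colours and legs count from 1 but permutations act on \<open>{..<s}\<close>, hence the
  shifts. Each vertex has exactly one leg, so all weights are empty.\<close>

definition top_graph :: "nat \<Rightarrow> (nat \<Rightarrow> nat) \<times> (nat \<Rightarrow> nat) \<Rightarrow> (nat, nat) coloured_graph" where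
  "top_graph s t = \<lparr>verts = {..<s}, edges = {..<s}, ends = (\<lambda>j. Upair j (Suc j mod s)),
     leg = (\<lambda>i. snd t (i - 1)), col = (\<lambda>j. Suc (fst t j)), wt = (\<lambda>_. {})\<rparr>"

lemma cyclic_arrangement_permutes:
  assumes "(c, l) \<in> cyclic_arrangements s"
  shows "c permutes {..<s}" "l permutes {..<s}"
  using assms permutes_subset[of c "{1..<s}" "{..<s}"]
  by (auto simp: cyclic_arrangements_def cyclic_colourings_def subset_iff)

lemma col_top_graph:
  assumes "t \<in> cyclic_arrangements s"
  shows "col (top_graph s t) ` edges (top_graph s t) = Suc ` {..<s}"
proof -
  have "fst t permutes {..<s}" using cyclic_arrangement_permutes(1)[of "fst t" "snd t" s] assms by simp
  from permutes_image[OF this] show ?thesis by (simp add: top_graph_def flip: image_image)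
qed

lemma legs_at_top_graph:
  assumes "t \<in> cyclic_arrangements s" "v < s"
  shows "legs_at s (top_graph s t) v = {Suc (inv_into UNIV (snd t) v)}"
proof -
  have l: "snd t permutes {..<s}" using cyclic_arrangement_permutes(2)[of "fst t" "snd t" s] assms by simp
  have "inv_into UNIV (snd t) v < s" using permutes_in_image[OF permutes_inv[OF l]] assms(2) by simp
  moreover have "snd t (inv_into UNIV (snd t) v) = v" using permutes_inverses(1)[OF l] .
  moreover have "i = Suc (inv_into UNIV (snd t) v)" if "i \<in> {1..s}" "snd t (i - 1) = v" for i
    using that permutes_inverses(2)[OF l, of "i - 1"] by auto
  ultimately show ?thesis by (auto simp: legs_at_def top_graph_def)
qed

lemma weighted_top_graph:
  assumes t: "t \<in> cyclic_arrangements s" and s: "s \<ge> 1"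
  shows "weighted_graph s (top_graph s t)"
proof (rule weighted_graphI[of s s id id])
  have p: "fst t permutes {..<s}" "snd t permutes {..<s}"
    using cyclic_arrangement_permutes[of "fst t" "snd t" s] t by simp_all
  show "cycle_indexing s id id (top_graph s t)"
    by (auto simp: cycle_indexing_def top_graph_def)
  show "leg (top_graph s t) i \<in> verts (top_graph s t)" if "i \<in> {1..s}" for i
    using permutes_in_image[OF p(2), of "i - 1"] that by (auto simp: top_graph_def)
  show "inj_on (col (top_graph s t)) (edges (top_graph s t))"
    using permutes_inj_on[OF p(1)] by (auto simp: top_graph_def inj_on_def)
  have "Suc ` {..<s} = {1..s}" by (auto simp: image_iff Bex_def Suc_le_eq gr0_conv_Suc)
  then show "col (top_graph s t) ` edges (top_graph s t) \<subseteq> {1..s}"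
    "(\<Union>v\<in>verts (top_graph s t). wt (top_graph s t) v) \<union> col (top_graph s t) ` edges (top_graph s t) = {1..s}"
    unfolding col_top_graph[OF t] by (auto simp: top_graph_def)
qed (use s legs_at_top_graph[OF t] in \<open>auto simp: top_graph_def\<close>)


text \<open>Edge \<open>i\<close> joins vertices \<open>i\<close> and \<open>i + 1\<close>.
  Reflecting edges by \<open>i\<close> to \<open>-i\<close> forces vertices to go from
  \<open>i\<close> to \<open>1 - i\<close>; edge 0 stays while edges 1 and \<open>k - 1\<close>
  trade places.\<close>

lemma cycle_indexing_reflect:
  assumes "cycle_indexing k v e G"
  shows "cycle_indexing k (\<lambda>i. v ((k + 1 - i) mod k)) (\<lambda>i. e ((k - i) mod k)) G"
proof -
  let ?r = "\<lambda>i. (k - i) mod k"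
  have r: "bij_betw ?r {..<k} {..<k}"
  proof (rule bij_betwI[where g = ?r])
    show "?r (?r i) = i" if "i \<in> {..<k}" for i using that by (cases "i = 0") auto
    then show "?r (?r i) = i" if "i \<in> {..<k}" for i using that .
  qed auto
  have shift: "(k + 1 - i) mod k = ((k - i) mod k + 1) mod k" if "i < k" for i
    using that by (simp add: mod_simps Suc_diff_le)
  have "bij_betw (v \<circ> (\<lambda>i. (i + 1) mod k) \<circ> ?r) {..<k} (verts G)"
    using assms bij_betw_trans[OF r bij_betw_trans[OF bij_betw_rotate]] unfolding cycle_indexing_def by blast
  then have "bij_betw (\<lambda>i. v ((k + 1 - i) mod k)) {..<k} (verts G)"
    by (rule bij_betw_cong[THEN iffD1, rotated]) (use shift in simp)
  moreover have "bij_betw (e \<circ> ?r) {..<k} (edges G)"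
    using assms bij_betw_trans[OF r] unfolding cycle_indexing_def by blast
  moreover have "ends G (e (?r i)) = Upair (v ((k + 1 - i) mod k)) (v ((k + 1 - (i + 1) mod k) mod k))"
    if i: "i < k" for i
  proof -
    have "(k + 1 - (i + 1) mod k) mod k = ?r i"
    proof (cases "i + 1 < k")
      case False
      then have "i + 1 = k" using i by simp
      then show ?thesis by (simp add: mod_Suc flip: \<open>i + 1 = k\<close>)
    qed simp
    moreover have "?r i < k" using i by simp
    ultimately show ?thesis
      using assms shift[OF i] unfolding cycle_indexing_def by auto
  qed
  ultimately show ?thesis by (simp add: cycle_indexing_def o_def)
qed

text \<open>With \<open>s\<close> vertices and \<open>s\<close> legs every vertex has one leg and
  empty weight. Rotation brings colour 1 to edge 0, and a reflection puts the smaller neighbouring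
  colour next, which is the normal form of \<open>cyclic_colourings\<close>.\<close>

lemma top_graph_of_maximal:
  fixes G :: "(nat, nat) coloured_graph"
  assumes G: "weighted_graph s G" and card: "card (edges G) = s" and s: "s \<ge> 3"
  obtains t f g where "t \<in> cyclic_arrangements s" "weighted_iso s f g (top_graph s t) G"
proof -
  note W = weighted_graphD[OF G]
  obtain k v0 e0 where "cycle_indexing k v0 e0 G" using weighted_graph_cycle[OF G] .
  moreover from this have "k = s" using cycle_indexing_card(4) card by blast
  ultimately have cyc0: "cycle_indexing s v0 e0 G" by simp
  note cards = cycle_indexing_card[OF cyc0]
  have colS: "col G ` edges G = {1..s}"
    using W(3,4) card by (intro card_subset_eq) (auto simp: card_image)
  have leg1: "card (legs_at s G u) = 1" if "u \<in> verts G" for u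
  proof (rule ccontr)
    have ge: "card (legs_at s G y) \<ge> 1" if "y \<in> verts G" for y
      using W(2)[OF that] finite_legs_at[of s G y] by (metis Suc_leI card_gt_0_iff One_nat_def)
    assume "card (legs_at s G u) \<noteq> 1"
    then have "1 < card (legs_at s G u)" using ge[OF that] by simp
    then have "(\<Sum>y\<in>verts G. 1) < (\<Sum>y\<in>verts G. card (legs_at s G y))"
      using ge that cards(1) by (intro sum_strict_mono_ex1) auto
    then show False using sum_card_legs[OF G] cards by simp
  qed
  have leg_inj: "i = j" if "i \<in> {1..s}" "j \<in> {1..s}" "leg G i = leg G j" for i j
  proof -
    have "i \<in> legs_at s G (leg G i)" "j \<in> legs_at s G (leg G i)" using that by (auto simp: legs_at_def)
    moreover have "card (legs_at s G (leg G i)) = 1" by (rule leg1[OF W(1)[OF that(1)]])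
    then obtain x where "legs_at s G (leg G i) = {x}" by (rule card_1_singletonE)
    ultimately show ?thesis by simp
  qed
  have wt0: "wt G u = {}" if "u \<in> verts G" for u
    using W(5)[OF that] leg1[OF that] W(6)[OF that] finite_subset[of "wt G u" "{1..s}"] by simp
  have "\<exists>v e. cycle_indexing s v e G \<and> col G (e 0) = 1"
  proof -
    have "1 \<in> col G ` edges G" using colS s by simp
    then obtain d where d: "d \<in> edges G" "col G d = 1" by auto
    obtain v e where ve: "cycle_indexing s v e G" "e (s - 1) = d" using cycle_indexing_last_edge[OF cyc0 d(1)] .
    have "(0 + (s - 1)) mod s = s - 1" using s by simp
    then show ?thesis using cycle_indexing_rotate[OF ve(1), of "s - 1"] ve(2) d(2) by (metis (no_types, lifting))
  qed
  then obtain v1 e1 where ve1: "cycle_indexing s v1 e1 G" "col G (e1 0) = 1" by blast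
  \<comment> \<open>If the neighbours of edge 0 are in the wrong order, reflecting fixes edge 0 and
    exchanges them.\<close>
  have "\<exists>v e. cycle_indexing s v e G \<and> col G (e 0) = 1 \<and> col G (e 1) < col G (e (s - 1))"
  proof (cases "col G (e1 1) < col G (e1 (s - 1))")
    case False
    have e1: "bij_betw e1 {..<s} (edges G)" using ve1 by (simp add: cycle_indexing_def)
    then have "e1 1 \<in> edges G" "e1 (s - 1) \<in> edges G" "e1 1 \<noteq> e1 (s - 1)"
      using s bij_betwE[OF e1] inj_onD[OF bij_betw_imp_inj_on[OF e1], of 1 "s - 1"] by auto
    then have "col G (e1 (s - 1)) < col G (e1 1)" using False W(3) by (metis inj_onD linorder_neqE_nat)
    moreover have "(s - 0) mod s = 0" "(s - 1) mod s = s - 1" "(s - (s - 1)) mod s = 1" using s by auto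
    ultimately show ?thesis using cycle_indexing_reflect[OF ve1(1)] ve1(2) by (metis (no_types, lifting))
  qed (use ve1 in blast)
  then obtain v e where cyc: "cycle_indexing s v e G" and norm: "col G (e 0) = 1" "col G (e 1) < col G (e (s - 1))"
    by blast
  have v: "bij_betw v {..<s} (verts G)" and e: "bij_betw e {..<s} (edges G)"
    and ends: "\<And>i. i < s \<Longrightarrow> ends G (e i) = Upair (v i) (v ((i + 1) mod s))"
    using cyc by (simp_all add: cycle_indexing_def)
  have col1: "1 \<le> col G (e j)" "col G (e j) \<le> s" if "j < s" for j
  proof -
    have "e j \<in> edges G" using bij_betwE[OF e] that by blast
    then have "col G (e j) \<in> {1..s}" using W(4) by blast
    then show "1 \<le> col G (e j)" "col G (e j) \<le> s" by simp_all
  qed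
  define c where "c = (\<lambda>j. if j < s then col G (e j) - 1 else j)"
  have colinj: "inj_on (\<lambda>j. col G (e j)) {..<s}"
    using comp_inj_on[OF bij_betw_imp_inj_on[OF e]] W(3) bij_betw_imp_surj_on[OF e] by (auto simp: o_def)
  have "inj_on c {..<s}"
  proof (rule inj_onI)
    fix i j assume ij: "i \<in> {..<s}" "j \<in> {..<s}" "c i = c j"
    then have "col G (e i) = col G (e j)" using col1[of i] col1[of j] by (simp add: c_def)
    then show "i = j" using inj_onD[OF colinj] ij by blast
  qed
  moreover have "c j < s" if "j < s" for j using col1[OF that] that by (simp add: c_def)
  then have "c ` {..<s} \<subseteq> {..<s}" by auto
  ultimately have "bij_betw c {..<s} {..<s}" by (simp add: bij_betw_def endo_inj_surj)
  then have "c permutes {..<s}" by (rule bij_imp_permutes) (simp add: c_def)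
  then have "c permutes {1..<s}"
  proof (rule permutes_superset)
    fix x assume "x \<in> {..<s} - {1..<s}"
    then have "x = 0" by auto
    then show "c x = x" using norm s by (simp add: c_def)
  qed
  then have cC: "c \<in> cyclic_colourings s"
    using norm s col1[of 1] col1[of "s - 1"] by (simp add: cyclic_colourings_def c_def)
  define l where "l = (\<lambda>i. if i < s then inv_into {..<s} v (leg G (Suc i)) else i)"
  have legV: "leg G (Suc i) \<in> v ` {..<s}" if "i < s" for i
    using W(1)[of "Suc i"] bij_betw_imp_surj_on[OF v] that by simp
  have lv: "v (l i) = leg G (Suc i)" "l i < s" if "i < s" for i
    using f_inv_into_f[OF legV[OF that]] inv_into_into[OF legV[OF that]] that by (simp_all add: l_def)
  have "inj_on l {..<s}"
  proof (rule inj_onI)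
    fix i j assume ij: "i \<in> {..<s}" "j \<in> {..<s}" "l i = l j"
    then have "leg G (Suc i) = leg G (Suc j)" using lv(1)[of i] lv(1)[of j] by simp
    then show "i = j" using leg_inj[of "Suc i" "Suc j"] ij by simp
  qed
  moreover have "l ` {..<s} \<subseteq> {..<s}" using lv(2) by auto
  ultimately have "bij_betw l {..<s} {..<s}" by (simp add: bij_betw_def endo_inj_surj)
  then have "l permutes {..<s}" by (rule bij_imp_permutes) (simp add: l_def)
  with cC have t: "(c, l) \<in> cyclic_arrangements s" by (simp add: cyclic_arrangements_def)
  have "weighted_iso s v e (top_graph s (c, l)) G"
    unfolding weighted_iso_def
  proof (intro conjI ballI)
    show "leg G i = v (leg (top_graph s (c, l)) i)" if "i \<in> {1..s}" for i
    proof -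
      have "i - 1 < s" "Suc (i - 1) = i" using that by auto
      then show ?thesis using lv(1)[of "i - 1"] by (simp add: top_graph_def)
    qed
    show "col G (e j) = col (top_graph s (c, l)) j" if "j \<in> edges (top_graph s (c, l))" for j
      using col1(1)[of j] that by (simp add: top_graph_def c_def)
  qed (use v e ends wt0 bij_betwE[OF v] in \<open>auto simp: top_graph_def c_def\<close>)
  then show thesis using that t by blast
qed

text \<open>Expand vertices until the graph is maximal. A single \<open>t\<close> serves all faces
  \<open>F\<close> of the simplex of \<open>G\<close>, which later gives continuity on that
  simplex.\<close>

lemma top_graph_blocks:
  fixes G :: "(nat, nat) coloured_graph"
  assumes "weighted_graph s G" "s \<ge> 3"
  shows "\<exists>t\<in>cyclic_arrangements s. \<forall>F. Suc ` F \<subseteq> col G ` edges G \<longrightarrow>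
    colour_blocks s F G = colour_blocks s F (top_graph s t)"
  using assms(1)
proof (induction "s - card (edges G)" arbitrary: G rule: less_induct)
  case less
  obtain k v e where k: "k \<le> s" "cycle_indexing k v e G" using weighted_graph_cycle[OF less.prems] .
  then have le: "card (edges G) \<le> s" using cycle_indexing_card(4) by metis
  show ?case
  proof (cases "card (edges G) = s")
    case True
    obtain t f g where t: "t \<in> cyclic_arrangements s" "weighted_iso s f g (top_graph s t) G"
      using top_graph_of_maximal[OF less.prems True assms(2)] .
    have "weighted_graph s (top_graph s t)" using weighted_top_graph[OF t(1)] assms(2) by simp
    then show ?thesis
      using colour_blocks_contraction[OF wf_graph_weighted contraction_weighted_iso[OF t(2)]] t(1) by auto
  next
    case False
    then have "card (edges G) < s" using le by simp
    from expand_weighted_graph[OF less.prems this]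
    obtain G' :: "(nat, nat) coloured_graph" and q d where G': "weighted_graph s G'" "card (edges G') = Suc (card (edges G))"
      "contraction s q id {d} G' G" "col G' d \<notin> col G ` edges G" "col G ` edges G \<subseteq> col G' ` edges G'" .
    have "s - card (edges G') < s - card (edges G)" using G'(2) \<open>card (edges G) < s\<close> by simp
    from less.hyps[OF this G'(1)] obtain t where t: "t \<in> cyclic_arrangements s"
      "\<And>F. Suc ` F \<subseteq> col G' ` edges G' \<Longrightarrow> colour_blocks s F G' = colour_blocks s F (top_graph s t)" by blast
    have "colour_blocks s F G = colour_blocks s F (top_graph s t)" if F: "Suc ` F \<subseteq> col G ` edges G" for F
    proof -
      have "colour_blocks s F G = colour_blocks s F G'"
        by (rule colour_blocks_contraction[OF wf_graph_weighted[OF G'(1)] G'(3)]) (use F G'(4) in auto)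
      then show ?thesis using t(2)[of F] F G'(5) by auto
    qed
    then show ?thesis using t(1) by blast
  qed
qed

section \<open>Labels of maximal graphs\<close>

text \<open>Realises a label by an actual graph, so that equality of labels can be turned into an
  isomorphism. The surviving edge \<open>e0\<close> ensures that not all edges are to be
  collapsed.\<close>

lemma reduced_graph:
  assumes G: "weighted_graph s G" and F: "e0 \<in> edges G" "col G e0 \<in> Suc ` F"
  obtains H where "collapses G {e \<in> edges G. col G e \<notin> Suc ` F} H" "weighted_graph s H"
    "edges H = {e \<in> edges G. col G e \<in> Suc ` F}" "col H = col G" "blocks s H {} = colour_blocks s F G"
    "\<And>F'. F' \<subseteq> F \<Longrightarrow> colour_blocks s F' H = colour_blocks s F' G"
proof -
  let ?A = "{e \<in> edges G. col G e \<notin> Suc ` F}"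
  obtain k v e where cyc: "cycle_indexing k v e G" using weighted_graph_cycle[OF G] .
  have "finite ?A" using cycle_indexing_card(2)[OF cyc] by simp
  moreover have "?A \<subset> edges G" using F by blast
  ultimately obtain H where H: "collapses G ?A H" using collapses_exist[OF _ G] by blast
  note C = collapses_weighted[OF H G]
  have eH: "edges H = {e \<in> edges G. col G e \<in> Suc ` F}" "col H = col G" using C by auto
  have sub: "colour_blocks s F' H = colour_blocks s F' G" if "F' \<subseteq> F" for F'
  proof -
    have "\<forall>e\<in>?A. col G e \<notin> Suc ` F'" using that by blast
    then show ?thesis using C by blast
  qed
  have none: "{e \<in> edges H. col H e \<notin> Suc ` F} = {}" using eH by auto
  have "blocks s H {} = colour_blocks s F H" unfolding colour_blocks_def none ..
  then have "blocks s H {} = colour_blocks s F G" using sub[of F] by simp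
  then show thesis using that[OF H _ eH] C sub by blast
qed

lemma weighted_iso_of_blocks_weighted:
  assumes G: "weighted_graph s G" and H: "weighted_graph s H" and eq: "blocks s G {} = blocks s H {}"
  obtains f g where "weighted_iso s f g G H"
  by (rule weighted_iso_of_blocks[OF eq wf_graph_weighted[OF G] wf_graph_weighted[OF H]
        weighted_graphD(2)[OF G] weighted_graphD(2)[OF H] weighted_graphD(3)[OF G] weighted_graphD(3)[OF H]])

definition top_label :: "nat \<Rightarrow> nat set \<Rightarrow> (nat \<Rightarrow> nat) \<times> (nat \<Rightarrow> nat) \<Rightarrow> (nat set \<times> nat set \<times> nat set) set" where
  "top_label s F t = colour_blocks s F (top_graph s t)"

text \<open>Equal labels at \<open>F'\<close> mean isomorphic graphs after the collapse to
  \<open>F'\<close>, and isomorphic graphs stay indistinguishable under the further collapse to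
  \<open>F\<close>.\<close>

lemma coherent_top_label:
  assumes s: "s \<ge> 1"
  shows "coherent (s - 1) (cyclic_arrangements s) (top_label s)"
  unfolding coherent_def
proof (intro allI impI)
  fix F F' t t'
  assume F: "F \<noteq> {}" "F \<subseteq> F'" "F' \<subseteq> {..s - 1}"
    and t: "t \<in> cyclic_arrangements s" "t' \<in> cyclic_arrangements s"
    and eq: "top_label s F' t = top_label s F' t'"
  note G = weighted_top_graph[OF t(1) s] weighted_top_graph[OF t(2) s]
  obtain k where k: "k \<in> F'" "k < s" using F s by (metis One_nat_def Suc_pred atMost_iff bot.extremum_uniqueI ex_in_conv le_imp_less_Suc less_eq_Suc_le subset_iff)
  have ex: "\<exists>e\<in>edges (top_graph s t). col (top_graph s t) e \<in> Suc ` F'" if "t \<in> cyclic_arrangements s" for t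
  proof -
    have "Suc k \<in> col (top_graph s t) ` edges (top_graph s t)" using col_top_graph[OF that] k by simp
    then show ?thesis using k by force
  qed
  obtain e where e: "e \<in> edges (top_graph s t)" "col (top_graph s t) e \<in> Suc ` F'"
    using ex[OF t(1)] by blast
  obtain e' where e': "e' \<in> edges (top_graph s t')" "col (top_graph s t') e' \<in> Suc ` F'"
    using ex[OF t(2)] by blast
  obtain H where "collapses (top_graph s t) {e \<in> edges (top_graph s t). col (top_graph s t) e \<notin> Suc ` F'} H"
    and H: "weighted_graph s H"
    and "edges H = {e \<in> edges (top_graph s t). col (top_graph s t) e \<in> Suc ` F'}" "col H = col (top_graph s t)"
    and Hb: "blocks s H {} = colour_blocks s F' (top_graph s t)"
      "\<And>F''. F'' \<subseteq> F' \<Longrightarrow> colour_blocks s F'' H = colour_blocks s F'' (top_graph s t)"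
    by (rule reduced_graph[OF G(1) e]) blast
  obtain H' where "collapses (top_graph s t') {e \<in> edges (top_graph s t'). col (top_graph s t') e \<notin> Suc ` F'} H'"
    and H2: "weighted_graph s H'"
    and "edges H' = {e \<in> edges (top_graph s t'). col (top_graph s t') e \<in> Suc ` F'}" "col H' = col (top_graph s t')"
    and H2b: "blocks s H' {} = colour_blocks s F' (top_graph s t')"
      "\<And>F''. F'' \<subseteq> F' \<Longrightarrow> colour_blocks s F'' H' = colour_blocks s F'' (top_graph s t')"
    by (rule reduced_graph[OF G(2) e']) blast
  have "blocks s H {} = blocks s H' {}" using Hb(1) H2b(1) eq by (simp add: top_label_def)
  from weighted_iso_of_blocks_weighted[OF H H2 this]
  obtain f g where "weighted_iso s f g H H'" by blast
  from colour_blocks_contraction[OF wf_graph_weighted[OF H] contraction_weighted_iso[OF this], of F]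
  have "colour_blocks s F H' = colour_blocks s F H" by simp
  then show "top_label s F t = top_label s F t'" using Hb(2)[OF F(2)] H2b(2)[OF F(2)] by (simp add: top_label_def)
qed

section \<open>Cyclic order of colours read off from codimension-one labels\<close>

lemma conn_single:
  assumes "set_uprod (ends G d) = {a, b}"
  shows "(u, w) \<in> conn G {d} \<longleftrightarrow> u = w \<or> u \<in> {a, b} \<and> w \<in> {a, b}"
proof
  show "u = w \<or> u \<in> {a, b} \<and> w \<in> {a, b}" if "(u, w) \<in> conn G {d}"
    using that unfolding conn_def
  proof (induction rule: rtrancl_induct)
    case (step y z)
    then have "y \<in> {a, b}" "z \<in> {a, b}" using assms by auto
    then show ?case using step.IH by blast
  qed simp
next
  assume uw: "u = w \<or> u \<in> {a, b} \<and> w \<in> {a, b}"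
  show "(u, w) \<in> conn G {d}"
  proof (cases "u = w")
    case False
    with uw show ?thesis by (intro conn_edge[of d]) (simp_all add: assms)
  qed simp
qed

lemma edges_top_graph: "edges (top_graph s t) = {..<s}"
  by (simp add: top_graph_def)

definition prv :: "nat \<Rightarrow> nat \<Rightarrow> nat" where
  "prv s v = (if v = 0 then s - 1 else v - 1)"

lemma prv: "v < s \<Longrightarrow> prv s v < s" "v < s \<Longrightarrow> Suc (prv s v) mod s = v" "e < s \<Longrightarrow> prv s (Suc e mod s) = e"
  by (auto simp: prv_def mod_Suc)

lemma prv_eq_iff: "e < s \<Longrightarrow> v < s \<Longrightarrow> Suc e mod s = v \<longleftrightarrow> e = prv s v"
  using prv by metis

text \<open>Vertex \<open>v\<close> lies between the edges \<open>prv s v\<close> and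
  \<open>v\<close>, so these are the pairs of consecutive colours: the cyclic order without starting
  point and direction.\<close>

definition adjacency :: "nat \<Rightarrow> (nat \<Rightarrow> nat) \<Rightarrow> nat set set" where
  "adjacency s c = (\<lambda>v. {Suc (c (prv s v)), Suc (c v)}) ` {..<s}"

text \<open>Recovers the adjacency of all colours from the label after the collapse of colour \<open>k\<close>: the block
  of weight \<open>{k + 1}\<close> lies between the two neighbours of \<open>k\<close>.\<close>

definition merged_adjacency :: "nat \<Rightarrow> (nat set \<times> nat set \<times> nat set) set \<Rightarrow> nat set set" where
  "merged_adjacency k D = {N. \<exists>L. (L, {}, N) \<in> D} \<union> {{Suc k, y} |y. \<exists>L N. (L, {Suc k}, N) \<in> D \<and> y \<in> N}"

context
  fixes s c l j
  assumes s: "s \<ge> 3" and cl: "(c, l) \<in> cyclic_arrangements s" and j: "j < s"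
begin

lemma c_less: "v < s \<Longrightarrow> c v < s"
  using permutes_in_image[OF cyclic_arrangement_permutes(1)[OF cl], of v] by simp

lemma c_eq: "c u = c v \<longleftrightarrow> u = v"
  using permutes_inj[OF cyclic_arrangement_permutes(1)[OF cl]] by (simp add: inj_eq)

lemma zero_edges: "{e \<in> edges (top_graph s (c, l)). col (top_graph s (c, l)) e \<notin> Suc ` ({..s - 1} - {c j})} = {j}"
proof -
  have "Suc (c e) \<notin> Suc ` ({..s - 1} - {c j}) \<longleftrightarrow> e = j" if "e < s" for e
    using c_less[OF that] c_eq[of e j] by (auto simp: image_iff)
  then show ?thesis using j by (auto simp: top_graph_def)
qed

lemma conn_j: "(u, w) \<in> conn (top_graph s (c, l)) {j} \<longleftrightarrow> u = w \<or> u \<in> {j, (Suc j mod s)} \<and> w \<in> {j, (Suc j mod s)}"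
  by (rule conn_single) (simp add: top_graph_def)

lemma block_unmerged:
  assumes v: "v < s" "v \<notin> {j, (Suc j mod s)}"
  shows "block s (top_graph s (c, l)) {j} v = (legs_at s (top_graph s (c, l)) v, {}, {Suc (c (prv s v)), Suc (c v)})"
proof -
  define P where "P = (\<lambda>e. \<exists>u\<in>set_uprod (ends (top_graph s (c, l)) e). (v, u) \<in> conn (top_graph s (c, l)) {j})"
  have "P e \<longleftrightarrow> e = v \<or> e = prv s v" if "e < s" for e
    using prv_eq_iff[OF that v(1)] v(2) unfolding P_def conn_j by (auto simp: top_graph_def)
  moreover have "prv s v \<noteq> j" using v prv(2)[of v s] by auto
  ultimately have "{e \<in> {..<s} - {j}. P e} = {prv s v, v}" using prv(1)[OF v(1)] v by auto
  then have "{e \<in> edges (top_graph s (c, l)) - {j}. \<exists>u\<in>set_uprod (ends (top_graph s (c, l)) e). (v, u) \<in> conn (top_graph s (c, l)) {j}} = {prv s v, v}"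
    unfolding P_def by (simp only: edges_top_graph)
  moreover have "{e \<in> {j}. \<exists>u\<in>set_uprod (ends (top_graph s (c, l)) e). (v, u) \<in> conn (top_graph s (c, l)) {j}} = {}"
    using v unfolding conn_j by (auto simp: top_graph_def)
  moreover have "{i \<in> {1..s}. (v, leg (top_graph s (c, l)) i) \<in> conn (top_graph s (c, l)) {j}} = legs_at s (top_graph s (c, l)) v"
    using v unfolding conn_j by (auto simp: legs_at_def)
  moreover have "(\<Union>u\<in>{u \<in> verts (top_graph s (c, l)). (v, u) \<in> conn (top_graph s (c, l)) {j}}. wt (top_graph s (c, l)) u) = {}" by (simp add: top_graph_def)
  moreover have "col (top_graph s (c, l)) ` {prv s v, v} = {Suc (c (prv s v)), Suc (c v)}" by (simp add: top_graph_def)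
  ultimately show ?thesis unfolding block_def by (simp only: Un_empty_left image_empty)
qed

lemma block_merged:
  assumes v: "v \<in> {j, (Suc j mod s)}"
  shows "\<exists>L. block s (top_graph s (c, l)) {j} v = (L, {Suc (c j)}, {Suc (c (prv s j)), Suc (c (Suc j mod s))})"
proof -
  have jj: "(Suc j mod s) < s" using s by simp
  have "prv s j \<noteq> j" "(Suc j mod s) \<noteq> j" using s j by (auto simp: prv_def mod_Suc)
  moreover define P where "P = (\<lambda>e. \<exists>u\<in>set_uprod (ends (top_graph s (c, l)) e). (v, u) \<in> conn (top_graph s (c, l)) {j})"
  have "P e \<longleftrightarrow> e \<in> {j, (Suc j mod s)} \<or> Suc e mod s \<in> {j, (Suc j mod s)}" for e
    using v unfolding P_def conn_j by (auto simp: top_graph_def)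
  then have "P e \<longleftrightarrow> e \<in> {j, (Suc j mod s)} \<or> e = prv s j" if "e < s" for e
    using prv_eq_iff[OF that j] prv_eq_iff[OF that jj] prv(3)[OF j] by auto
  ultimately have "{e \<in> {..<s} - {j}. P e} = {prv s j, (Suc j mod s)}" using prv(1)[OF j] jj by auto
  then have "{e \<in> edges (top_graph s (c, l)) - {j}. \<exists>u\<in>set_uprod (ends (top_graph s (c, l)) e). (v, u) \<in> conn (top_graph s (c, l)) {j}} = {prv s j, (Suc j mod s)}"
    unfolding P_def by (simp only: edges_top_graph)
  moreover have "{e \<in> {j}. \<exists>u\<in>set_uprod (ends (top_graph s (c, l)) e). (v, u) \<in> conn (top_graph s (c, l)) {j}} = {j}"
    using v unfolding conn_j by (auto simp: top_graph_def)
  moreover have "(\<Union>u\<in>{u \<in> verts (top_graph s (c, l)). (v, u) \<in> conn (top_graph s (c, l)) {j}}. wt (top_graph s (c, l)) u) = {}" by (simp add: top_graph_def)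
  moreover have "col (top_graph s (c, l)) ` {prv s j, (Suc j mod s)} = {Suc (c (prv s j)), Suc (c (Suc j mod s))}" "col (top_graph s (c, l)) ` {j} = {Suc (c j)}"
    by (simp_all add: top_graph_def)
  ultimately show ?thesis unfolding block_def by (simp only: Un_empty_left) blast
qed

lemma top_label_eq: "top_label s ({..s - 1} - {c j}) (c, l) = block s (top_graph s (c, l)) {j} ` {..<s}"
  unfolding top_label_def colour_blocks_def zero_edges blocks_def by (simp add: top_graph_def)

lemma merged_adjacency_top_label:
  "merged_adjacency (c j) (top_label s ({..s - 1} - {c j}) (c, l)) = adjacency s c"
proof -
  let ?D = "top_label s ({..s - 1} - {c j}) (c, l)"
  let ?N = "\<lambda>v. {Suc (c (prv s v)), Suc (c v)}"
  have jj: "(Suc j mod s) < s" "prv s (Suc j mod s) = j" using s prv(3)[OF j] by simp_all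
  obtain Lj where bj: "block s (top_graph s (c, l)) {j} j = (Lj, {Suc (c j)}, {Suc (c (prv s j)), Suc (c (Suc j mod s))})"
    using block_merged[of j] by blast
  have m: "N = {Suc (c (prv s j)), Suc (c (Suc j mod s))}" if LN: "(L, {Suc (c j)}, N) \<in> ?D" for L N
  proof -
    obtain v where v: "v < s" "block s (top_graph s (c, l)) {j} v = (L, {Suc (c j)}, N)" using LN unfolding top_label_eq by auto
    then have "v \<in> {j, (Suc j mod s)}" using block_unmerged[of v] by auto
    from block_merged[OF this] show ?thesis using v(2) by auto
  qed
  have "(Lj, {Suc (c j)}, {Suc (c (prv s j)), Suc (c (Suc j mod s))}) \<in> ?D" unfolding top_label_eq using bj j by force
  then have 2: "{{Suc (c j), y} |y. \<exists>L N. (L, {Suc (c j)}, N) \<in> ?D \<and> y \<in> N} = {?N j, ?N (Suc j mod s)}"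
    using m jj(2) by (auto simp: insert_commute)
  have 1: "{N. \<exists>L. (L, {}, N) \<in> ?D} = ?N ` ({..<s} - {j, (Suc j mod s)})"
  proof
    show "{N. \<exists>L. (L, {}, N) \<in> ?D} \<subseteq> ?N ` ({..<s} - {j, (Suc j mod s)})"
    proof clarify
      fix N L assume "(L, {}, N) \<in> ?D"
      then obtain v where v: "v < s" "block s (top_graph s (c, l)) {j} v = (L, {}, N)" unfolding top_label_eq by auto
      then have "v \<notin> {j, (Suc j mod s)}" using block_merged[of v] by auto
      then show "N \<in> ?N ` ({..<s} - {j, (Suc j mod s)})" using v block_unmerged[of v] by auto
    qed
    show "?N ` ({..<s} - {j, (Suc j mod s)}) \<subseteq> {N. \<exists>L. (L, {}, N) \<in> ?D}"
      unfolding top_label_eq using block_unmerged by (force simp: image_iff)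
  qed
  have "adjacency s c = ?N ` (({..<s} - {j, (Suc j mod s)}) \<union> {j, (Suc j mod s)})"
    unfolding adjacency_def using j jj by (intro arg_cong[where f = "image ?N"]) auto
  also have "\<dots> = ?N ` ({..<s} - {j, (Suc j mod s)}) \<union> {?N j, ?N (Suc j mod s)}" by (simp only: image_Un image_insert image_empty)
  finally show ?thesis unfolding merged_adjacency_def 1 2 ..
qed

lemma adjacency_neighbours:
  assumes v: "v < s"
  shows "{y. {Suc (c v), Suc y} \<in> adjacency s c} = {c (prv s v), c (Suc v mod s)}"
proof
  show "{y. {Suc (c v), Suc y} \<in> adjacency s c} \<subseteq> {c (prv s v), c (Suc v mod s)}"
  proof
    fix y assume "y \<in> {y. {Suc (c v), Suc y} \<in> adjacency s c}"
    then obtain u where u: "u < s" "{Suc (c v), Suc y} = {Suc (c (prv s u)), Suc (c u)}" by (auto simp: adjacency_def)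
    then consider "c v = c (prv s u)" "y = c u" | "c v = c u" "y = c (prv s u)" by (auto simp: doubleton_eq_iff)
    then show "y \<in> {c (prv s v), c (Suc v mod s)}"
    proof cases
      case 1
      then have "Suc v mod s = u" using c_eq prv(2)[OF u(1)] by simp
      then show ?thesis using 1 by simp
    qed (simp add: c_eq)
  qed
  have "Suc v mod s < s" "prv s (Suc v mod s) = v" using s prv(3)[OF v] by auto
  then show "{c (prv s v), c (Suc v mod s)} \<subseteq> {y. {Suc (c v), Suc y} \<in> adjacency s c}"
    using v by (force simp: adjacency_def insert_commute)
qed

end

text \<open>Both colourings start at 0, and the condition on the neighbours of 0 picks the
  direction. From then on each colour is the neighbour of its predecessor that has not just been
  visited.\<close>

lemma adjacency_determines:
  assumes s: "s \<ge> 3" and t: "(c, l) \<in> cyclic_arrangements s" "(c', l') \<in> cyclic_arrangements s"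
    and eq: "adjacency s c = adjacency s c'"
  shows "c = c'"
proof -
  have nb: "{c (prv s v), c (Suc v mod s)} = {c' (prv s v), c' (Suc v mod s)}" if "v < s" "c v = c' v" for v
    using adjacency_neighbours[OF s t(1) that(1) that(1)] adjacency_neighbours[OF s t(2) that(1) that(1)] that(2) eq by simp
  have p: "c permutes {1..<s}" "c' permutes {1..<s}" "c 1 < c (s - 1)" "c' 1 < c' (s - 1)"
    using t by (auto simp: cyclic_arrangements_def cyclic_colourings_def)
  have out: "c x = c' x" if "x \<notin> {1..<s}" for x using permutes_not_in[OF p(1) that] permutes_not_in[OF p(2) that] by simp
  have c1: "c 1 = c' 1"
  proof -
    have "{c (s - 1), c 1} = {c' (s - 1), c' 1}" using nb[of 0] out[of 0] s by (simp add: prv_def)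
    then show ?thesis using p(3,4) by (auto simp: doubleton_eq_iff)
  qed
  have "\<forall>u\<le>v. c u = c' u" if "v < s" for v
    using that
  proof (induction v)
    case 0
    then show ?case using out[of 0] by simp
  next
    case (Suc v)
    then have IH: "\<forall>u\<le>v. c u = c' u" by simp
    have "c (Suc v) = c' (Suc v)"
    proof (cases "v = 0")
      case False
      then have "{c (v - 1), c (Suc v)} = {c' (v - 1), c' (Suc v)}" "c (v - 1) = c' (v - 1)"
        using nb[of v] IH Suc.prems by (simp_all add: prv_def)
      then show ?thesis by (auto simp: doubleton_eq_iff)
    qed (use c1 in simp)
    then show ?case using IH by (auto simp: le_Suc_eq)
  qed
  then have "c x = c' x" for x using out[of x] by (cases "x < s") auto
  then show ?thesis by blast
qed

text \<open>The label yields the adjacency of all colours and so \<open>c\<close>. The legs at the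
  unmerged vertices are visible in their blocks, so \<open>l'\<close> differs from \<open>l\<close>
  by a permutation of the two ends of edge \<open>j\<close>.\<close>

lemma top_label_eq_iff:
  assumes s: "s \<ge> 3" and j: "j < s" and t: "(c, l) \<in> cyclic_arrangements s" "(c', l') \<in> cyclic_arrangements s"
  shows "top_label s ({..s - 1} - {c j}) (c, l) = top_label s ({..s - 1} - {c j}) (c', l') \<longleftrightarrow>
      c' = c \<and> (l' = l \<or> l' = swap_at s j \<circ> l)"
proof
  let ?j = "Suc j mod s"
  assume eq: "top_label s ({..s - 1} - {c j}) (c, l) = top_label s ({..s - 1} - {c j}) (c', l')"
  \<comment> \<open>A priori the collapsed colour may sit at another edge \<open>i\<close> of the
    second cycle, so its adjacency is computed there.\<close>
  have "c j < s" using c_less[OF s t(1) j j] .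
  then obtain i where i: "i < s" "c' i = c j"
    using permutes_image[OF cyclic_arrangement_permutes(1)[OF t(2)]] by (metis imageE lessThan_iff)
  have "adjacency s c = adjacency s c'"
    using merged_adjacency_top_label[OF s t(1) j] merged_adjacency_top_label[OF s t(2) i(1)] eq i(2) by simp
  then have c: "c' = c" using adjacency_determines[OF s t] by simp
  note l = cyclic_arrangement_permutes(2)[OF t(1)] and l' = cyclic_arrangement_permutes(2)[OF t(2)]
  let ?l = "inv_into UNIV l" and ?l' = "inv_into UNIV l'"
  have inv: "?l v = ?l' v" if v: "v < s" "v \<notin> {j, ?j}" for v
  proof -
    have "block s (top_graph s (c, l)) {j} v \<in> block s (top_graph s (c, l')) {j} ` {..<s}"
      using eq v unfolding c top_label_eq[OF s t(1) j] top_label_eq[OF s t(2)[unfolded c] j] by blast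
    then obtain u where u: "u < s" "block s (top_graph s (c, l)) {j} v = block s (top_graph s (c, l')) {j} u" by auto
    note bv = block_unmerged[OF s t(1) j v]
    have "u \<notin> {j, ?j}" using block_merged[OF s t(2)[unfolded c] j, of u] u(2) bv by auto
    note bu = block_unmerged[OF s t(2)[unfolded c] j u(1) this]
    have legs: "legs_at s (top_graph s (c, l)) v = legs_at s (top_graph s (c, l')) u"
      and N: "{Suc (c (prv s v)), Suc (c v)} = {Suc (c (prv s u)), Suc (c u)}" using u(2) bv bu by simp_all
    \<comment> \<open>For \<open>s \<ge> 3\<close> two consecutive edges share only one vertex, so
      the two colours of a block locate it.\<close>
    have "u = v"
    proof (rule ccontr)
      assume "u \<noteq> v"
      then have "c (prv s v) = c u" "c v = c (prv s u)" using N c_eq[OF s t(1) j] by (auto simp: doubleton_eq_iff)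
      then have "prv s v = u" "v = prv s u" using c_eq[OF s t(1) j] by simp_all
      then show False using s v u(1) by (auto simp: prv_def split: if_splits)
    qed
    then show ?thesis
      using legs legs_at_top_graph[OF t(1) v(1)] legs_at_top_graph[OF t(2) v(1)] by (simp add: c)
  qed
  let ?\<sigma> = "l' \<circ> ?l"
  have "?\<sigma> permutes {..<s}" by (rule permutes_compose[OF permutes_inv[OF l] l'])
  then have "?\<sigma> permutes {j, ?j}"
  proof (rule permutes_superset)
    fix x assume "x \<in> {..<s} - {j, ?j}"
    then show "?\<sigma> x = x" using inv[of x] permutes_inverses(1)[OF l'] by simp
  qed
  then have "?\<sigma> = id \<or> ?\<sigma> = swap_at s j" by (simp add: permutes_doubleton_iff swap_at_def)
  moreover have "l' = ?\<sigma> \<circ> l" using permutes_inverses(2)[OF l] by (auto simp: fun_eq_iff)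
  ultimately show "c' = c \<and> (l' = l \<or> l' = swap_at s j \<circ> l)" using c by (metis id_comp)
next
  assume R: "c' = c \<and> (l' = l \<or> l' = swap_at s j \<circ> l)"
  \<comment> \<open>The exchanged legs end up at the same merged vertex, so the exchange is
    invisible.\<close>
  have "block s (top_graph s (c, swap_at s j \<circ> l)) {j} v = block s (top_graph s (c, l)) {j} v" for v
  proof -
    let ?G = "top_graph s (c, l)" and ?G' = "top_graph s (c, swap_at s j \<circ> l)"
    have conn: "conn ?G' {j} = conn ?G {j}" by (simp add: conn_def top_graph_def)
    have "(v, leg ?G' i) \<in> conn ?G {j} \<longleftrightarrow> (v, leg ?G i) \<in> conn ?G {j}" for i
      unfolding conn_j[OF s t(1) j] by (auto simp: top_graph_def swap_at_def Transposition.transpose_def)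
    then have "{i \<in> {1..s}. (v, leg ?G' i) \<in> conn ?G' {j}} = {i \<in> {1..s}. (v, leg ?G i) \<in> conn ?G {j}}"
      unfolding conn by simp
    then show ?thesis unfolding block_def conn by (simp add: top_graph_def)
  qed
  then have "block s (top_graph s (c, l')) {j} ` {..<s} = block s (top_graph s (c, l)) {j} ` {..<s}" using R by auto
  then show "top_label s ({..s - 1} - {c j}) (c, l) = top_label s ({..s - 1} - {c j}) (c', l')"
    using R top_label_eq[OF s t(1) j] top_label_eq[OF s _ j, of c l'] t(2) by simp
qed

text \<open>By coherence, equal full labels stay equal on every codimension-one face. Were the legs
  different, they would differ both by the exchange at edge 0 and by that at edge 1, which are
  distinct for \<open>s \<ge> 3\<close>.\<close>

lemma inj_top_label:
  assumes s: "s \<ge> 3"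
  shows "inj_on (top_label s {..s - 1}) (cyclic_arrangements s)"
proof (rule inj_onI)
  fix t t' assume t: "t \<in> cyclic_arrangements s" "t' \<in> cyclic_arrangements s"
    and eq: "top_label s {..s - 1} t = top_label s {..s - 1} t'"
  obtain c l c' l' where cl: "t = (c, l)" "t' = (c', l')" by (cases t; cases t')
  have *: "c' = c \<and> (l' = l \<or> l' = swap_at s j \<circ> l)" if j: "j < s" for j
  proof -
    have "0 \<in> {..s - 1} - {c j} \<or> 1 \<in> {..s - 1} - {c j}" using s by auto
    then have "{..s - 1} - {c j} \<noteq> {}" by blast
    then have "top_label s ({..s - 1} - {c j}) t = top_label s ({..s - 1} - {c j}) t'"
      using s t by (intro coherentD[OF coherent_top_label eq]) auto
    then show ?thesis using top_label_eq_iff[OF s j] t cl by simp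
  qed
  have "l' = l"
  proof (rule ccontr)
    assume "l' \<noteq> l"
    then have "swap_at s 0 \<circ> l = swap_at s 1 \<circ> l" using *[of 0] *[of 1] s by simp
    then have "swap_at s 0 0 = swap_at s 1 0"
      using permutes_surj[OF cyclic_arrangement_permutes(2)[OF t(1)[unfolded cl]]] by (metis comp_apply surjD)
    then show False using s by (simp add: swap_at_def Transposition.transpose_def)
  qed
  then show "t = t'" using *[of 0] s cl by simp
qed

section \<open>The moduli space as a glued space\<close>

lemma continuous_map_from_sum_topology:
  "continuous_map (sum_topology X I) Y f \<longleftrightarrow> (\<forall>i\<in>I. continuous_map (X i) Y (\<lambda>x. f (i, x)))"
proof
  assume f: "continuous_map (sum_topology X I) Y f"
  show "\<forall>i\<in>I. continuous_map (X i) Y (\<lambda>x. f (i, x))"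
    using continuous_map_compose[OF continuous_map_component_injection f] by (simp add: o_def)
next
  assume f: "\<forall>i\<in>I. continuous_map (X i) Y (\<lambda>x. f (i, x))"
  show "continuous_map (sum_topology X I) Y f"
    unfolding continuous_map_def
  proof (intro conjI allI impI)
    show "f \<in> topspace (sum_topology X I) \<rightarrow> topspace Y"
      using f by (auto simp: continuous_map_def Pi_iff)
    fix U assume U: "openin Y U"
    have "{x. (i, x) \<in> {z \<in> topspace (sum_topology X I). f z \<in> U}} = {x \<in> topspace (X i). f (i, x) \<in> U}"
      if "i \<in> I" for i using that by auto
    then show "openin (sum_topology X I) {z \<in> topspace (sum_topology X I). f z \<in> U}"
      using f U unfolding openin_sum_topology by (auto simp: continuous_map_def)
  qed
qed

lemma homeomorphic_space_quotients:
  assumes A: "quotient_map Z A a" and B: "quotient_map Z B b"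
    and eq: "\<And>x y. x \<in> topspace Z \<Longrightarrow> y \<in> topspace Z \<Longrightarrow> a x = a y \<longleftrightarrow> b x = b y"
  shows "A homeomorphic_space B"
proof -
  obtain g where g: "continuous_map A B g" "\<And>x. x \<in> topspace Z \<Longrightarrow> g (a x) = b x"
    using quotient_map_lift_exists[OF A quotient_imp_continuous_map[OF B]] eq by metis
  obtain h where h: "continuous_map B A h" "\<And>x. x \<in> topspace Z \<Longrightarrow> h (b x) = a x"
    using quotient_map_lift_exists[OF B quotient_imp_continuous_map[OF A]] eq by metis
  have "\<forall>y\<in>a ` topspace Z. h (g y) = y" "\<forall>y\<in>b ` topspace Z. g (h y) = y"
    using g h by simp_all
  then have "\<forall>y\<in>topspace A. h (g y) = y" "\<forall>y\<in>topspace B. g (h y) = y"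
    by (simp_all only: quotient_imp_surjective_map[OF A] quotient_imp_surjective_map[OF B])
  then have "homeomorphic_maps A B g h"
    using g(1) h(1) unfolding homeomorphic_maps_def by blast
  then show ?thesis unfolding homeomorphic_space_def by blast
qed

text \<open>At most one edge of a weighted graph has a given colour. The sum supplies length 0 for
  collapsed colours, so a face keeps the coordinates of the larger simplex.\<close>

definition colour_lengths :: "('v, 'e) coloured_graph \<Rightarrow> ('e \<Rightarrow> real) \<Rightarrow> nat \<Rightarrow> real" where
  "colour_lengths G l k = sum l {e \<in> edges G. col G e = Suc k}"

text \<open>A complete invariant of points of the moduli space: lengths by colour, and the blocks
  left after collapsing all edges of length 0.\<close>

definition metric_point :: "nat \<Rightarrow> ('v, 'e) coloured_graph \<times> ('e \<Rightarrow> real) \<Rightarrow>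
    (nat \<Rightarrow> real) \<times> (nat set \<times> nat set \<times> nat set) set" where
  "metric_point s = (\<lambda>(G, l). (colour_lengths G l, colour_blocks s (supp (colour_lengths G l)) G))"

lemma topspace_metric_simplex:
  "l \<in> topspace (metric_simplex G) \<longleftrightarrow>
     l \<in> extensional (edges G) \<and> (\<forall>e\<in>edges G. 0 \<le> l e) \<and> (\<Sum>e\<in>edges G. l e) = 1"
  by (auto simp: metric_simplex_def PiE_def)

lemma topspace_simplices:
  "(G, l) \<in> topspace (simplices s) \<longleftrightarrow> weighted_graph s G \<and> l \<in> topspace (metric_simplex G)"
  by (auto simp: simplices_def)

context
  fixes s and G :: "('v, 'e) coloured_graph"
  assumes G: "weighted_graph s G"
begin

lemma finite_edges: "finite (edges G)"
  using weighted_graph_cycle[OF G] cycle_indexing_card(2) by metis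

lemma col_ge_1: "e \<in> edges G \<Longrightarrow> 1 \<le> col G e \<and> col G e \<le> s"
  using weighted_graphD(4)[OF G] by (auto simp: subset_iff)

lemma colour_lengths_edge:
  assumes "e \<in> edges G" "col G e = Suc k"
  shows "colour_lengths G l k = l e"
proof -
  have "{e' \<in> edges G. col G e' = Suc k} = {e}"
    using assms weighted_graphD(3)[OF G] by (auto simp: inj_on_def)
  then show ?thesis by (simp add: colour_lengths_def)
qed

lemma colour_lengths_none: "Suc k \<notin> col G ` edges G \<Longrightarrow> colour_lengths G l k = 0"
proof -
  assume "Suc k \<notin> col G ` edges G"
  then have none: "{e \<in> edges G. col G e = Suc k} = {}" by force
  show ?thesis unfolding colour_lengths_def none by simp
qed

lemma Suc_supp_colour_lengths: "Suc ` supp (colour_lengths G l) = {col G e |e. e \<in> edges G \<and> l e \<noteq> 0}"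
proof
  show "Suc ` supp (colour_lengths G l) \<subseteq> {col G e |e. e \<in> edges G \<and> l e \<noteq> 0}"
  proof clarify
    fix k assume "k \<in> supp (colour_lengths G l)"
    then have k: "colour_lengths G l k \<noteq> 0" by (simp add: supp_def)
    then have "Suc k \<in> col G ` edges G" using colour_lengths_none by blast
    then obtain e where "e \<in> edges G" "col G e = Suc k" by force
    then show "\<exists>e. Suc k = col G e \<and> e \<in> edges G \<and> l e \<noteq> 0" using colour_lengths_edge k by metis
  qed
  show "{col G e |e. e \<in> edges G \<and> l e \<noteq> 0} \<subseteq> Suc ` supp (colour_lengths G l)"
  proof clarify
    fix e assume e: "e \<in> edges G" "l e \<noteq> 0"
    then obtain k where "col G e = Suc k" using col_ge_1[OF e(1)] by (cases "col G e") auto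
    then show "col G e \<in> Suc ` supp (colour_lengths G l)"
      using colour_lengths_edge[OF e(1)] e(2) by (auto simp: supp_def)
  qed
qed

lemma zero_length_iff:
  assumes "e \<in> edges G"
  shows "col G e \<in> Suc ` supp (colour_lengths G l) \<longleftrightarrow> l e \<noteq> 0"
  unfolding Suc_supp_colour_lengths using assms weighted_graphD(3)[OF G] by (auto simp: inj_on_def)

lemma colour_lengths_simplex:
  assumes l: "l \<in> topspace (metric_simplex G)"
  shows "colour_lengths G l \<in> standard_simplex (s - 1)"
proof (rule standard_simplexI)
  show "0 \<le> colour_lengths G l i" for i
    unfolding colour_lengths_def using l by (intro sum_nonneg) (auto simp: topspace_metric_simplex)
  show "colour_lengths G l i = 0" if "i > s - 1" for i
    using that col_ge_1 by (intro colour_lengths_none) force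
  have "(\<Sum>i\<le>s - 1. colour_lengths G l i) = (\<Sum>i\<le>s - 1. sum l {e \<in> edges G. col G e - 1 = i})"
    unfolding colour_lengths_def using col_ge_1
    by (intro sum.cong refl arg_cong[where f = "sum l"]) force
  also have "\<dots> = sum l (edges G)"
    using col_ge_1 by (intro sum.group finite_edges) (auto simp: diff_le_mono)
  finally show "(\<Sum>i\<le>s - 1. colour_lengths G l i) = 1" using l by (simp add: topspace_metric_simplex)
qed

lemma continuous_colour_lengths:
  "continuous_map (metric_simplex G) (rsub (standard_simplex (s - 1))) (colour_lengths G)"
proof (rule continuous_map_into_rsub)
  fix i
  have "continuous_map (metric_simplex G) euclideanreal (\<lambda>l. l e)" if "e \<in> edges G" for e
    unfolding metric_simplex_def
    using continuous_map_product_projection[OF that, of "\<lambda>_. euclideanreal"]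
    by (rule continuous_map_from_subtopology)
  then show "continuous_map (metric_simplex G) euclideanreal (\<lambda>l. colour_lengths G l i)"
    unfolding colour_lengths_def using finite_edges by (intro continuous_map_sum) auto
qed (rule colour_lengths_simplex)

end

section \<open>The fibres of the invariant are the glued classes\<close>

lemma metric_point_iso:
  assumes G: "weighted_graph s G" and H: "weighted_graph s H" and iso: "weighted_iso s f g G H"
    and m: "\<forall>e\<in>edges G. m (g e) = l e"
  shows "metric_point s (H, m) = metric_point s (G, l)"
proof -
  have g: "bij_betw g (edges G) (edges H)" "\<And>e. e \<in> edges G \<Longrightarrow> col H (g e) = col G e"
    using iso by (auto simp: weighted_iso_def)
  have "colour_lengths H m k = colour_lengths G l k" for k
  proof -
    have "{e \<in> edges H. col H e = Suc k} = g ` {e \<in> edges G. col G e = Suc k}"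
      using g(2) bij_betw_imp_surj_on[OF g(1)] by (auto simp flip: bij_betw_imp_surj_on[OF g(1)])
    moreover have "inj_on g {e \<in> edges G. col G e = Suc k}"
      using g(1) by (auto simp: bij_betw_def intro: inj_on_subset)
    ultimately have "colour_lengths H m k = (\<Sum>e\<in>{e \<in> edges G. col G e = Suc k}. m (g e))"
      by (simp add: colour_lengths_def sum.reindex)
    also have "\<dots> = colour_lengths G l k" unfolding colour_lengths_def by (rule sum.cong) (use m in auto)
    finally show ?thesis .
  qed
  then have "colour_lengths H m = colour_lengths G l" by blast
  then show ?thesis
    using colour_blocks_contraction[OF wf_graph_weighted[OF G] contraction_weighted_iso[OF iso]]
    by (simp add: metric_point_def)
qed

lemma metric_point_face:
  fixes G :: "(nat, nat) coloured_graph"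
  assumes Gl: "(G, l) \<in> topspace (simplices s)" and Z: "Z \<subset> edges G" "\<forall>e\<in>Z. l e = 0" and H: "collapses G Z H"
  shows "(H, restrict l (edges G - Z)) \<in> topspace (simplices s)"
    "metric_point s (H, restrict l (edges G - Z)) = metric_point s (G, l)"
proof -
  have G: "weighted_graph s G" and l: "l \<in> topspace (metric_simplex G)" using Gl by (auto simp: topspace_simplices)
  note C = collapses_weighted[OF H G]
  let ?m = "restrict l (edges G - Z)"
  have eH: "edges H = edges G - Z" "col H = col G" using C by auto
  have "sum ?m (edges H) = sum l (edges G)"
    unfolding eH using finite_edges[OF G] Z by (intro sum.mono_neutral_cong_left) auto
  then show "(H, ?m) \<in> topspace (simplices s)"
    using C l eH by (simp add: topspace_simplices topspace_metric_simplex)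
  have "colour_lengths H ?m k = colour_lengths G l k" for k
    unfolding colour_lengths_def eH using finite_edges[OF G] Z by (intro sum.mono_neutral_cong_left) auto
  then have cl: "colour_lengths H ?m = colour_lengths G l" by blast
  have "\<forall>e\<in>Z. col G e \<notin> Suc ` supp (colour_lengths G l)"
    using zero_length_iff[OF G] Z by blast
  then have "colour_blocks s (supp (colour_lengths G l)) H = colour_blocks s (supp (colour_lengths G l)) G"
    using C by blast
  then show "metric_point s (H, ?m) = metric_point s (G, l)" by (simp add: metric_point_def cl)
qed

lemma glue_metric_point:
  assumes "glue s z z'"
  shows "z \<in> topspace (simplices s) \<and> z' \<in> topspace (simplices s) \<and> metric_point s z' = metric_point s z"
  using assms
proof cases
  case (iso G l H m f g)
  then show ?thesis using metric_point_iso[of s G H f g m l] by (simp add: topspace_simplices)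
next
  case (face G l Z H)
  then show ?thesis using metric_point_face[of G l s Z H] by simp
qed

lemma equivclp_glue_metric_point: "equivclp (glue s) z z' \<Longrightarrow> metric_point s z' = metric_point s z"
proof (induction rule: equivclp_induct)
  case (step y y')
  then show ?case using glue_metric_point by metis
qed simp

text \<open>Collapsing all edges of length 0 gives a normal form whose own blocks are the label.
  Lengths sum to 1, so some edge survives.\<close>

lemma reduced_metric_graph:
  assumes "(G, l) \<in> topspace (simplices s)"
  obtains H m where "glue s (G, l) (H, m)" "(H, m) \<in> topspace (simplices s)"
    "blocks s H {} = snd (metric_point s (G, l))"
    "metric_point s (H, m) = metric_point s (G, l)"
proof -
  have G: "weighted_graph s G" and l: "l \<in> topspace (metric_simplex G)" using assms by (auto simp: topspace_simplices)
  let ?F = "supp (colour_lengths G l)"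
  have "\<exists>e\<in>edges G. l e \<noteq> 0"
    using l unfolding topspace_metric_simplex by (metis sum.neutral zero_neq_one)
  then obtain e0 where e0: "e0 \<in> edges G" "col G e0 \<in> Suc ` ?F" using zero_length_iff[OF G] by blast
  let ?A = "{e \<in> edges G. col G e \<notin> Suc ` ?F}"
  obtain H where H: "collapses G ?A H" "weighted_graph s H" "edges H = {e \<in> edges G. col G e \<in> Suc ` ?F}"
    "col H = col G" "blocks s H {} = colour_blocks s ?F G"
    by (rule reduced_graph[OF G e0]) blast
  have A: "?A \<subset> edges G" "\<forall>e\<in>?A. l e = 0" using e0 zero_length_iff[OF G] by blast+
  let ?m = "restrict l (edges G - ?A)"
  show thesis
  proof (rule that)
    show "glue s (G, l) (H, ?m)" by (rule glue.face[OF assms A H(1)])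
    show "(H, ?m) \<in> topspace (simplices s)" "metric_point s (H, ?m) = metric_point s (G, l)"
      using metric_point_face[OF assms A H(1)] .
    show "blocks s H {} = snd (metric_point s (G, l))" using H(5) by (simp add: metric_point_def)
  qed
qed

text \<open>Both points are glued to their normal forms; these have equal blocks, hence isomorphic
  graphs, and the isomorphism closes the zigzag.\<close>

lemma equivclp_glue_of_metric_point:
  assumes z: "z \<in> topspace (simplices s)" "z' \<in> topspace (simplices s)" and eq: "metric_point s z = metric_point s z'"
  shows "equivclp (glue s) z z'"
proof -
  obtain G l where zG: "z = (G, l)" by (cases z)
  obtain G' l' where zG': "z' = (G', l')" by (cases z')
  obtain H m where H: "glue s z (H, m)" "(H, m) \<in> topspace (simplices s)" "blocks s H {} = snd (metric_point s z)"
    "metric_point s (H, m) = metric_point s z"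
    by (rule reduced_metric_graph[OF z(1)[unfolded zG], folded zG]) blast
  obtain H' m' where H': "glue s z' (H', m')" "(H', m') \<in> topspace (simplices s)" "blocks s H' {} = snd (metric_point s z')"
    "metric_point s (H', m') = metric_point s z'"
    by (rule reduced_metric_graph[OF z(2)[unfolded zG'], folded zG']) blast
  have W: "weighted_graph s H" "weighted_graph s H'" using H(2) H'(2) by (auto simp: topspace_simplices)
  obtain f g where iso: "weighted_iso s f g H H'"
    using weighted_iso_of_blocks_weighted[OF W] H(3) H'(3) eq by metis
  have cl: "colour_lengths H m = colour_lengths H' m'" using arg_cong[where f = fst, OF trans[OF H(4) trans[OF eq H'(4)[symmetric]]]] by (simp add: metric_point_def)
  \<comment> \<open>The isomorphism preserves colours, and equal lengths by colour therefore give
    equal metrics.\<close>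
  have "m' (g e) = m e" if e: "e \<in> edges H" for e
  proof -
    have ge: "g e \<in> edges H'" "col H' (g e) = col H e" using iso e by (auto simp: weighted_iso_def bij_betw_def)
    obtain k where k: "col H e = Suc k" using col_ge_1[OF W(1) e] by (cases "col H e") auto
    show ?thesis
      using colour_lengths_edge[OF W(1) e k, of m] colour_lengths_edge[OF W(2) ge(1), of k m'] ge(2) k cl by simp
  qed
  then have "glue s (H, m) (H', m')" using glue.iso[OF H(2) H'(2) iso] by blast
  then have "equivclp (glue s) (H, m) (H', m')" by (rule r_into_equivclp)
  then show ?thesis
    using r_into_equivclp[of "glue s", OF H(1)] converse_r_into_equivclp[of "glue s", OF H'(1)] equivclp_trans by metis
qed

lemma glue_rel_iff:
  assumes "z \<in> topspace (simplices s)" "z' \<in> topspace (simplices s)"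
  shows "(z, z') \<in> glue_rel s \<longleftrightarrow> metric_point s z = metric_point s z'"
proof
  assume "(z, z') \<in> glue_rel s"
  then have "equivclp (glue s) z z'" by (simp add: glue_rel_def)
  from equivclp_glue_metric_point[OF this] show "metric_point s z = metric_point s z'" by simp
next
  assume "metric_point s z = metric_point s z'"
  from equivclp_glue_of_metric_point[OF assms this] assms show "(z, z') \<in> glue_rel s"
    by (simp add: glue_rel_def)
qed

section \<open>Identification of the moduli space with the glued space\<close>

definition top_metric :: "nat \<Rightarrow> (nat \<Rightarrow> real) \<times> (nat \<Rightarrow> nat) \<times> (nat \<Rightarrow> nat) \<Rightarrow> metric_graph" where
  "top_metric s = (\<lambda>(x, t). (top_graph s t, \<lambda>j\<in>{..<s}. x (fst t j)))"

text \<open>\<open>glue_map\<close> is the composite of \<open>top_metric\<close> and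
  \<open>metric_point\<close>. Both factors are continuous and the composite is a quotient map, so
  the second factor is one as well; open sets never have to be examined over all graphs.\<close>

lemma quotient_metric_point:
  assumes s: "s \<ge> 3"
  shows "quotient_map (simplices s)
    (glued_space (cyclic_arrangements s) (top_label s) (standard_simplex (s - 1))) (metric_point s)"
proof -
  let ?T = "cyclic_arrangements s" and ?S = "standard_simplex (s - 1)"
  let ?X = "glued_space ?T (top_label s) ?S" and ?P = "prod_topology (rsub ?S) (discrete_topology ?T)"
  have perm: "fst t permutes {..<s}" if "t \<in> ?T" for t
    using cyclic_arrangement_permutes(1)[of "fst t" "snd t"] that by simp
  have W: "weighted_graph s (top_graph s t)" if "t \<in> ?T" for t using weighted_top_graph[OF that] s by simp
  have metric: "(\<lambda>j\<in>{..<s}. x (fst t j)) \<in> topspace (metric_simplex (top_graph s t))" if t: "t \<in> ?T" and x: "x \<in> ?S" for t x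
  proof -
    have "(\<Sum>j<s. x (fst t j)) = (\<Sum>k<s. x k)"
      using permutes_imp_bij[OF perm[OF t]] by (rule sum.reindex_bij_betw)
    also have "\<dots> = (\<Sum>k\<le>s - 1. x k)" using s by (intro sum.cong) auto
    finally show ?thesis
      using x by (simp add: topspace_metric_simplex edges_top_graph standard_simplex_def)
  qed
  have "continuous_map (simplices s) ?X (metric_point s)"
    unfolding simplices_def continuous_map_from_sum_topology
  proof
    fix G :: "(nat, nat) coloured_graph" assume "G \<in> {G. weighted_graph s G}"
    then have G: "weighted_graph s G" by simp
    \<comment> \<open>The same \<open>t\<close> works for every metric on \<open>G\<close>, so on
      this simplex the map is \<open>colour_lengths\<close> followed by the inclusion of one maximal
      simplex.\<close>
    obtain t where t: "t \<in> ?T" "\<And>F. Suc ` F \<subseteq> col G ` edges G \<Longrightarrow> colour_blocks s F G = top_label s F t"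
      using top_graph_blocks[OF G s] unfolding top_label_def by blast
    have "metric_point s (G, l) = (colour_lengths G l, top_label s (supp (colour_lengths G l)) t)" for l
    proof -
      have "Suc ` supp (colour_lengths G l) \<subseteq> col G ` edges G" unfolding Suc_supp_colour_lengths[OF G] by blast
      then show ?thesis using t(2) by (simp add: metric_point_def)
    qed
    then show "continuous_map (metric_simplex G) ?X (\<lambda>l. metric_point s (G, l))"
      using continuous_map_into_glued[OF t(1) continuous_colour_lengths[OF G]] by simp
  qed
  moreover have "continuous_map ?P (simplices s) (top_metric s)"
    unfolding continuous_map_prod_discrete
  proof
    fix t assume t: "t \<in> ?T"
    have "continuous_map (rsub ?S) (metric_simplex (top_graph s t)) (\<lambda>x. \<lambda>j\<in>{..<s}. x (fst t j))"
      unfolding metric_simplex_def continuous_map_in_subtopology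
    proof
      show "continuous_map (rsub ?S) (powertop_real (edges (top_graph s t))) (\<lambda>x. \<lambda>j\<in>{..<s}. x (fst t j))"
        unfolding continuous_map_componentwise edges_top_graph
        using continuous_rsub_projection by auto
    qed (use metric[OF t] in \<open>auto simp: topspace_metric_simplex\<close>)
    moreover have "continuous_map (metric_simplex (top_graph s t)) (simplices s) (\<lambda>l. (top_graph s t, l))"
      unfolding simplices_def by (rule continuous_map_component_injection) (use W[OF t] in simp)
    ultimately show "continuous_map (rsub ?S) (simplices s) (\<lambda>x. top_metric s (x, t))"
      using continuous_map_compose by (fastforce simp: top_metric_def o_def)
  qed
  moreover have "quotient_map ?P ?X (metric_point s \<circ> top_metric s)"
  proof (rule quotient_map_eq[OF quotient_glue_map])
    fix z assume z: "z \<in> topspace ?P"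
    then obtain x t where z: "z = (x, t)" "x \<in> ?S" "t \<in> ?T" by auto
    let ?l = "\<lambda>j\<in>{..<s}. x (fst t j)"
    have "colour_lengths (top_graph s t) ?l k = x k" for k
    proof (cases "k < s")
      case True
      then obtain j where j: "j < s" "fst t j = k" using permutes_image[OF perm[OF z(3)]] by (metis imageE lessThan_iff)
      then show ?thesis using colour_lengths_edge[OF W[OF z(3)], of j k ?l] by (simp add: top_graph_def)
    next
      case False
      then have "Suc k \<notin> col (top_graph s t) ` edges (top_graph s t)" using col_top_graph[OF z(3)] by auto
      then show ?thesis using colour_lengths_none[OF W[OF z(3)]] z(2) False s by (simp add: standard_simplex_def)
    qed
    then have "colour_lengths (top_graph s t) ?l = x" by blast
    then show "glue_map (top_label s) z = (metric_point s \<circ> top_metric s) z"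
      by (simp add: z glue_map_def metric_point_def top_metric_def top_label_def)
  qed
  ultimately show ?thesis using quotient_map_from_composition by blast
qed

lemma moduli_space_homeomorphic:
  assumes "s \<ge> 3"
  shows "moduli_space s homeomorphic_space
    glued_space (cyclic_arrangements s) (top_label s) (standard_simplex (s - 1))"
proof (rule homeomorphic_space_quotients[OF _ quotient_metric_point[OF assms]])
  show "quotient_map (simplices s) (moduli_space s) (\<lambda>z. glue_rel s `` {z})"
    unfolding moduli_space_def by (rule quotient_map_quotient_topology[OF equiv_glue_rel])
  show "glue_rel s `` {z} = glue_rel s `` {z'} \<longleftrightarrow> metric_point s z = metric_point s z'"
    if "z \<in> topspace (simplices s)" "z' \<in> topspace (simplices s)" for z z'
    using eq_equiv_class_iff[OF equiv_glue_rel that] glue_rel_iff[OF that] by simp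
qed

theorem mainTheorem5:
  fixes s :: nat
  assumes "s \<ge> 3"
  shows "homology_group (int s - 1) (moduli_space s)
           \<cong> product_group {..<fact (s - 1) div 2 :: nat} (\<lambda>_. integer_group)"
proof -
  interpret cyclic_labels s "top_label s"
    using assms top_label_eq_iff by unfold_locales auto
  have "homology_group (int s - 1) (moduli_space s) \<cong>
      homology_group (int s - 1) (glued_space (cyclic_arrangements s) (top_label s) (standard_simplex (s - 1)))"
    by (rule homeomorphic_space_imp_isomorphic_homology_groups[OF moduli_space_homeomorphic[OF assms]])
  also have "\<dots> \<cong> product_group {..<fact (s - 1) div 2 :: nat} (\<lambda>_. integer_group)"
    using assms by (intro top_homology_cyclic coherent_top_label inj_top_label) auto
  finally show ?thesis .
qed

end
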